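(* Let $d\ge1$ be an integer, let $1\le q<\infty$, and let $I\subseteq\mathbb{R}$ be a bounded open interval. Suppose that $A_0\in W^{1,q}(I,M_d(\mathbb{C}))$ and $\inf_{x\in I}\sigma_d(A_0(x))>0$. Then there is a neighborhood $\mathcal{U}$ of $A_0$ in $W^{1,q}(I,M_d(\mathbb{C}))$ such that $\kappa(A)\in W^{1,q}(I,\mathbb{R})$ is well-defined for $A\in\mathcal{U}$, and the map $\kappa:\mathcal{U}\to W^{1,q}(I,\mathbb{R})$ is continuous.
   Context: $M_d(\mathbb{C})$ is the space of complex $d\times d$ matrices with the Frobenius norm $\|\cdot\|_2$. For $B\in M_d(\mathbb{C})$, $\sigma_1(B)\ge\dots\ge\sigma_d(B)\ge0$ are its singular values (nonnegative square roots of the eigenvalues of $B^*B$, with multiplicity). The condition number of a nonsingular $B$ is $\kappa(B)=\sigma_1(B)/\sigma_d(B)$; for $A:I\to M_d(\mathbb{C})$, $\kappa(A)$ is the function $x\mapsto\kappa(A(x))$. $W^{1,q}(I,V)$ has the norm $\|f\|_{L^q}+\|f'\|_{L^q}$ with $\|f\|_{L^q}=\big\|\,\|f\|_2\,\big\|_{L^q(I)}$, and elements are represented by their absolutely continuous representatives. *)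

theory Defs
  imports "HOL-Analysis.Analysis" "HOL-Computational_Algebra.Computational_Algebra"
begin

section \<open>Singular values and the condition number\<close>

text \<open>
  Matrices are \<^typ>\<open>complex^'d^'d\<close>. The library norm on this type is the iterated Euclidean
  norm, that is, the Frobenius norm.
\<close>

lemma norm_matrix_eq_Frobenius:
  fixes B :: "complex^'n^'m"
  shows "norm B = sqrt (\<Sum>i\<in>UNIV. \<Sum>j\<in>UNIV. (cmod (B $ i $ j))\<^sup>2)"
  by (simp add: norm_vec_def L2_set_def sum_nonneg)

definition conj_transpose :: "complex^'n^'m \<Rightarrow> complex^'m^'n" where
  "conj_transpose B = (\<chi> i j. cnj (B $ j $ i))"

definition charpoly :: "complex^'d^'d \<Rightarrow> complex poly" where
  "charpoly M = det (\<chi> i j. (if i = j then [:0, 1:] else 0) - [:M $ i $ j:])"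

text \<open>
  \<^term>\<open>proots\<close> lists the eigenvalues with algebraic multiplicity. For the matrices
  \<open>B\<^sup>* B\<close> considered here they are nonnegative real numbers, so that \<^term>\<open>Re\<close> is only a
  change of type.
\<close>

definition singular_values :: "complex^'d^'d \<Rightarrow> real list" where
  "singular_values B =
     rev (sorted_list_of_multiset
       (image_mset (\<lambda>z. sqrt (Re z)) (proots (charpoly (conj_transpose B ** B)))))"

text \<open>The index \<open>k\<close> runs from \<open>1\<close> to \<open>CARD('d)\<close>, the largest singular value being the first.\<close>

definition sing_val :: "nat \<Rightarrow> complex^'d^'d \<Rightarrow> real" where
  "sing_val k B = singular_values B ! (k - 1)"

text \<open>Meaningful for nonsingular \<open>B\<close> only.\<close>

definition cond_number :: "complex^'d^'d \<Rightarrow> real" where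
  "cond_number B = sing_val 1 B / sing_val CARD('d) B"


section \<open>Sobolev spaces on an interval\<close>

text \<open>
  Functions on \<open>I\<close> are represented by total functions on the reals; every notion below
  depends only on the values on \<open>I\<close>.
\<close>

definition Lq_space :: "real \<Rightarrow> real set \<Rightarrow> (real \<Rightarrow> 'v::euclidean_space) set" where
  "Lq_space q I = {f. set_borel_measurable lebesgue I f \<and>
                      set_integrable lebesgue I (\<lambda>x. norm (f x) powr q)}"

definition Lq_norm :: "real \<Rightarrow> real set \<Rightarrow> (real \<Rightarrow> 'v::euclidean_space) \<Rightarrow> real" where
  "Lq_norm q I f = (LINT x:I|lebesgue. norm (f x) powr q) powr (1 / q)"

definition test_function :: "real set \<Rightarrow> (real \<Rightarrow> real) \<Rightarrow> bool" where
  "test_function I \<phi> \<longleftrightarrow>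
     (\<forall>n x. (deriv ^^ n) \<phi> field_differentiable at x) \<and>
     compact (closure {x. \<phi> x \<noteq> 0}) \<and> closure {x. \<phi> x \<noteq> 0} \<subseteq> I"

definition locally_integrable :: "real set \<Rightarrow> (real \<Rightarrow> 'v::euclidean_space) \<Rightarrow> bool" where
  "locally_integrable I f \<longleftrightarrow> (\<forall>K. compact K \<and> K \<subseteq> I \<longrightarrow> set_integrable lebesgue K f)"

definition has_weak_derivative ::
  "(real \<Rightarrow> 'v::euclidean_space) \<Rightarrow> (real \<Rightarrow> 'v) \<Rightarrow> real set \<Rightarrow> bool" where
  "has_weak_derivative f g I \<longleftrightarrow>
     locally_integrable I f \<and> locally_integrable I g \<and>
     (\<forall>\<phi>. test_function I \<phi> \<longrightarrow>
        (LINT x:I|lebesgue. deriv \<phi> x *\<^sub>R f x) = - (LINT x:I|lebesgue. \<phi> x *\<^sub>R g x))"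

text \<open>The weak derivative is unique up to null sets, so the choice does not affect \<open>L\<^sup>q\<close>-norms.\<close>

definition weak_derivative ::
  "real set \<Rightarrow> (real \<Rightarrow> 'v::euclidean_space) \<Rightarrow> (real \<Rightarrow> 'v)" where
  "weak_derivative I f = (SOME g. has_weak_derivative f g I)"

definition abs_continuous_on :: "real set \<Rightarrow> (real \<Rightarrow> 'v::euclidean_space) \<Rightarrow> bool" where
  "abs_continuous_on I f \<longleftrightarrow>
     (\<forall>\<epsilon>>0. \<exists>\<delta>>0. \<forall>D :: (real \<times> real) set.
        finite D \<and> (\<forall>(s, t)\<in>D. s \<le> t \<and> {s..t} \<subseteq> I) \<and>
        pairwise (\<lambda>(s, t) (s', t'). {s<..<t} \<inter> {s'<..<t'} = {}) D \<and>
        (\<Sum>(s, t)\<in>D. t - s) < \<delta>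
        \<longrightarrow> (\<Sum>(s, t)\<in>D. norm (f t - f s)) < \<epsilon>)"

text \<open>
  The elements of \<open>W\<^sup>1\<^sup>,\<^sup>q(I, V)\<close> are given by their absolutely continuous representatives,
  which are unique on \<open>I\<close>.
\<close>

definition sobolev_space :: "real \<Rightarrow> real set \<Rightarrow> (real \<Rightarrow> 'v::euclidean_space) set" where
  "sobolev_space q I = {f. abs_continuous_on I f \<and> f \<in> Lq_space q I \<and>
                           (\<exists>g\<in>Lq_space q I. has_weak_derivative f g I)}"

definition sobolev_norm :: "real \<Rightarrow> real set \<Rightarrow> (real \<Rightarrow> 'v::euclidean_space) \<Rightarrow> real" where
  "sobolev_norm q I f = Lq_norm q I f + Lq_norm q I (weak_derivative I f)"

definition sobolev_dist ::
  "real \<Rightarrow> real set \<Rightarrow> (real \<Rightarrow> 'v::euclidean_space) \<Rightarrow> (real \<Rightarrow> 'v) \<Rightarrow> real" where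
  "sobolev_dist q I f g = sobolev_norm q I (\<lambda>x. f x - g x)"

definition sobolev_neighborhood ::
  "real \<Rightarrow> real set \<Rightarrow> (real \<Rightarrow> 'v::euclidean_space) \<Rightarrow> (real \<Rightarrow> 'v) set \<Rightarrow> bool" where
  "sobolev_neighborhood q I f U \<longleftrightarrow> f \<in> sobolev_space q I \<and> U \<subseteq> sobolev_space q I \<and>
     (\<exists>r>0. \<forall>g\<in>sobolev_space q I. sobolev_dist q I g f < r \<longrightarrow> g \<in> U)"

definition sobolev_continuous_on ::
  "real \<Rightarrow> real set \<Rightarrow> (real \<Rightarrow> 'v::euclidean_space) set \<Rightarrow>
   ((real \<Rightarrow> 'v) \<Rightarrow> (real \<Rightarrow> 'w::euclidean_space)) \<Rightarrow> bool" where
  "sobolev_continuous_on q I U F \<longleftrightarrow>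
     (\<forall>f\<in>U. \<forall>\<epsilon>>0. \<exists>\<delta>>0. \<forall>g\<in>U.
        sobolev_dist q I g f < \<delta> \<longrightarrow> sobolev_dist q I (F g) (F f) < \<epsilon>)"

end

theory Submission
  imports Defs
begin

text \<open>
  On invertible matrices \<open>\<kappa>(A) = N(A) N(A\<^sup>-\<^sup>1)\<close>, where \<open>N\<close> is the operator norm. The difficulty is that
  \<open>N\<close> is only Lipschitz, and composition with a Lipschitz function of several variables is in general
  not continuous on \<open>W\<^sup>1\<^sup>,\<^sup>q\<close>. What saves the situation is that \<open>N\<close> is convex. If \<open>X\<close> is an absolutely
  continuous curve, \<open>N \<circ> X\<close> has both one-sided derivatives wherever \<open>X\<close> is differentiable, and they
  agree outside a countable set; so almost everywhere \<open>(N \<circ> X)'\<close> is a two-sided directional derivative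
  of \<open>N\<close> at \<open>X\<close> along \<open>X'\<close>. Two-sided directional derivatives of a convex function are limits of
  difference quotients from above and from below, hence stable under convergence of base point and
  direction. Given \<open>A\<^sub>n \<rightarrow> A\<close> in \<open>W\<^sup>1\<^sup>,\<^sup>q\<close>, fast enough for \<open>A\<^sub>n' \<rightarrow> A'\<close> almost everywhere, the derivatives of
  \<open>\<kappa>(A\<^sub>n)\<close> therefore converge almost everywhere, and they are dominated by \<open>L |A\<^sub>n'|\<close>.
\<close>

section \<open>Differentiation of indefinite integrals and of absolutely continuous functions\<close>

text \<open>A curve may spend a set of times of positive measure at matrices whose largest singular
  value is multiple. There \<open>N\<close> has no gradient, and the derivative of \<open>N\<close>
  along the curve cannot be written as a gradient applied to the velocity. Hence the derivative is
  carried by a relation between base point, direction and value, and all limits are phrased through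
  difference quotients. Two-sidedness is essential: a one-sided directional derivative of a convex
  function is only upper semicontinuous, since quotients with positive step bound it from above
  alone; negative steps supply the lower bound. The smallest singular value is in general not convex
  in the matrix, so it enters as the reciprocal of the norm of the inverse: inversion is smooth, the
  inverse curve is differentiable wherever the curve is, and the product rule joins the two factors.
  Since convexity speaks about pointwise quotients, the weak derivatives of the definitions have to
  be traded for almost everywhere derivatives. The fast sequence is available because it is chosen
  as a witness against continuity.\<close>

lemma has_vector_derivative_iff_quotient:
  fixes f :: "real \<Rightarrow> 'v::real_normed_vector"
  shows "(f has_vector_derivative D) (at x within S) \<longleftrightarrow>
    ((\<lambda>y. (f y - f x) /\<^sub>R (y - x)) \<longlongrightarrow> D) (at x within S)"
proof -
  have "((\<lambda>y. (1 / norm (y - x)) *\<^sub>R (f y - (f x + (y - x) *\<^sub>R D))) \<longlongrightarrow> 0) (at x within S)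
     \<longleftrightarrow> ((\<lambda>y. norm ((f y - f x) /\<^sub>R (y - x) - D)) \<longlongrightarrow> 0) (at x within S)"
    (is "(?l \<longlongrightarrow> 0) ?F \<longleftrightarrow> (?r \<longlongrightarrow> 0) ?F")
  proof -
    have *: "norm (?l y) = ?r y" if "y \<noteq> x" for y
    proof -
      have "(f y - f x) /\<^sub>R (y - x) - D = (f y - (f x + (y - x) *\<^sub>R D)) /\<^sub>R (y - x)"
        using that by (simp add: scaleR_diff_right scaleR_add_right)
      then show ?thesis by (simp add: divide_inverse)
    qed
    have "(?l \<longlongrightarrow> 0) ?F \<longleftrightarrow> ((\<lambda>y. norm (?l y)) \<longlongrightarrow> 0) ?F"
      by (rule tendsto_norm_zero_iff[symmetric])
    also have "\<dots> \<longleftrightarrow> (?r \<longlongrightarrow> 0) ?F"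
      by (rule tendsto_cong) (use * in \<open>auto simp: eventually_at_filter\<close>)
    finally show ?thesis .
  qed
  also have "\<dots> \<longleftrightarrow> ((\<lambda>y. (f y - f x) /\<^sub>R (y - x)) \<longlongrightarrow> D) ?F"
    by (simp add: tendsto_norm_zero_iff LIM_zero_iff)
  finally show ?thesis
    by (simp add: has_vector_derivative_def has_derivative_within bounded_linear_scaleR_left)
qed

section \<open>Lebesgue points on the real line\<close>

text \<open>The averages in \<open>integrable_ccontinuous_explicit\<close> run over cubes with
  corner \<open>x\<close>. On the line these are intervals to the right of \<open>x\<close>, so only
  the right-hand limit comes out.\<close>

lemma lebesgue_differentiation_right:
  fixes g :: "real \<Rightarrow> 'v::euclidean_space"
  assumes "\<And>u v. g integrable_on {u..v}"
  obtains N where "negligible N"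
    "\<And>x. x \<notin> N \<Longrightarrow> ((\<lambda>h. integral {x..x + h} g /\<^sub>R h) \<longlongrightarrow> g x) (at_right 0)"
proof -
  obtain N where N: "negligible N"
    "\<And>x e. \<lbrakk>x \<notin> N; 0 < e\<rbrakk> \<Longrightarrow> \<exists>d>0. \<forall>h. 0 < h \<and> h < d \<longrightarrow>
       norm (integral (cbox x (x + h *\<^sub>R One)) g /\<^sub>R h ^ DIM(real) - g x) < e"
    using integrable_ccontinuous_explicit[of g] assms by (metis cbox_interval)
  have "((\<lambda>h. integral {x..x + h} g /\<^sub>R h) \<longlongrightarrow> g x) (at_right 0)" if "x \<notin> N" for x
    unfolding tendsto_iff eventually_at_right_field dist_norm
  proof (intro allI impI)
    fix e :: real assume "0 < e"
    from N(2)[OF that this] obtain d where "d > 0" "\<forall>h. 0 < h \<and> h < d \<longrightarrow>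
       norm (integral (cbox x (x + h *\<^sub>R One)) g /\<^sub>R h ^ DIM(real) - g x) < e" by blast
    then show "\<exists>b>0. \<forall>y>0. y < b \<longrightarrow> norm (integral {x..x + y} g /\<^sub>R y - g x) < e"
      by (intro exI[of _ d]) simp
  qed
  with N(1) show ?thesis by (rule that)
qed

text \<open>Left-hand averages at \<open>x\<close> are right-hand averages of the reflected function
  at \<open>- x\<close>. Two applications of the one-sided lemma therefore give a two-sided
  derivative outside a negligible set.\<close>

theorem lebesgue_differentiation:
  fixes g :: "real \<Rightarrow> 'v::euclidean_space"
  assumes g: "g integrable_on {c..d}"
  obtains N where "negligible N"
    "\<And>x. c < x \<Longrightarrow> x < d \<Longrightarrow> x \<notin> N \<Longrightarrow>
       ((\<lambda>u. integral {c..u} g) has_vector_derivative g x) (at x)"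
proof -
  \<comment> \<open>Extension by zero: \<open>G\<close> is integrable on every interval, as the
    one-sided lemma demands, and equals \<open>g\<close> on \<open>{c..d}\<close>.\<close>
  define G where "G = (\<lambda>x. if x \<in> {c..d} then g x else 0)"
  have G_int: "G integrable_on {u..v}" for u v
  proof -
    have "G integrable_on UNIV"
      unfolding G_def using g integrable_restrict_UNIV by blast
    then show ?thesis
      using integrable_on_subcbox[of G UNIV u v] by simp
  qed
  have G_refl: "(\<lambda>x. G (- x)) integrable_on {u..v}" for u v
    using G_int[of "- v" "- u"] Henstock_Kurzweil_Integration.integrable_reflect_real[where f = G and a = "-v" and b = "-u"] by simp
  obtain N where N: "negligible N"
    "\<And>x. x \<notin> N \<Longrightarrow> ((\<lambda>h. integral {x..x + h} G /\<^sub>R h) \<longlongrightarrow> G x) (at_right 0)"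
    using lebesgue_differentiation_right[of G] G_int by blast
  obtain M where M: "negligible M"
    "\<And>x. x \<notin> M \<Longrightarrow> ((\<lambda>h. integral {x..x + h} (\<lambda>x. G (- x)) /\<^sub>R h) \<longlongrightarrow> G (- x)) (at_right 0)"
    using lebesgue_differentiation_right[of "\<lambda>x. G (- x)"] G_refl by blast
  have "negligible (uminus ` M)"
    by (intro negligible_differentiable_image_negligible M(1)) (auto intro!: derivative_intros simp: differentiable_on_def)
  with N(1) have neg: "negligible (N \<union> uminus ` M)" by simp
  have "((\<lambda>u. integral {c..u} g) has_vector_derivative g x) (at x)"
    if x: "c < x" "x < d" "x \<notin> N \<union> uminus ` M" for x
  proof -
    have combine: "integral {c..v} g - integral {c..u} g = integral {u..v} G"
      if "c \<le> u" "u \<le> v" "v \<le> d" for u v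
    proof -
      have "integral {c..u} g + integral {u..v} g = integral {c..v} g"
        using that integrable_subinterval_real[OF g, of c v]
        by (intro Henstock_Kurzweil_Integration.integral_combine) auto
      moreover have "integral {u..v} g = integral {u..v} G"
        using that by (intro integral_cong) (auto simp: G_def)
      ultimately show ?thesis by (simp add: algebra_simps)
    qed
    have gx: "G x = g x" using x by (simp add: G_def)
    have r: "((\<lambda>h. integral {x..x + h} G /\<^sub>R h) \<longlongrightarrow> g x) (at_right 0)"
      using N(2)[of x] x gx by simp
    have l: "((\<lambda>h. integral {x - h..x} G /\<^sub>R h) \<longlongrightarrow> g x) (at_right 0)"
    proof -
      have "- x \<notin> M" using x(3) by force
      from M(2)[OF this] have "((\<lambda>h. integral {- x..- x + h} (\<lambda>x. G (- x)) /\<^sub>R h) \<longlongrightarrow> g x) (at_right 0)"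
        by (simp add: gx)
      moreover have "integral {- x..- x + h} (\<lambda>x. G (- x)) = integral {x - h..x} G" for h
        using Henstock_Kurzweil_Integration.integral_reflect_real[where f = G and a = "x - h" and b = x] by simp
      ultimately show ?thesis by simp
    qed
    have R: "((\<lambda>y. (integral {c..y} g - integral {c..x} g) /\<^sub>R (y - x)) \<longlongrightarrow> g x) (at_right x)"
    proof -
      have "((\<lambda>y. integral {x..y} G /\<^sub>R (y - x)) \<longlongrightarrow> g x) (at_right x)"
        using r by (subst filterlim_at_right_to_0) (simp add: add.commute)
      then show ?thesis
      proof (rule Lim_transform_eventually)
        show "\<forall>\<^sub>F y in at_right x. integral {x..y} G /\<^sub>R (y - x)
            = (integral {c..y} g - integral {c..x} g) /\<^sub>R (y - x)"
          using x by (auto simp: eventually_at_right_field combine intro!: exI[of _ d])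
      qed
    qed
    have L: "((\<lambda>y. (integral {c..y} g - integral {c..x} g) /\<^sub>R (y - x)) \<longlongrightarrow> g x) (at_left x)"
    proof -
      have "((\<lambda>y. integral {y..x} G /\<^sub>R (x - y)) \<longlongrightarrow> g x) (at_left x)"
        using l filterlim_at_left_to_right[of "\<lambda>y. integral {y..x} G /\<^sub>R (x - y)" "nhds (g x)" x]
         filterlim_at_right_to_0[of "\<lambda>y. integral {-y..x} G /\<^sub>R (x + y)" "nhds (g x)" "-x"]
        by simp
      then show ?thesis
      proof (rule Lim_transform_eventually)
        have "(integral {c..y} g - integral {c..x} g) /\<^sub>R (y - x)
              = (integral {c..x} g - integral {c..y} g) /\<^sub>R (x - y)" for y
          by (metis (no_types) inverse_minus_eq minus_diff_eq scaleR_minus_left scaleR_minus_right)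
        then show "\<forall>\<^sub>F y in at_left x. integral {y..x} G /\<^sub>R (x - y)
            = (integral {c..y} g - integral {c..x} g) /\<^sub>R (y - x)"
          using x by (auto simp: eventually_at_left_field combine intro!: exI[of _ c])
      qed
    qed
    from L R show ?thesis
      unfolding has_vector_derivative_iff_quotient by (simp add: filterlim_at_split)
  qed
  with neg show ?thesis by (rule that)
qed

section \<open>Points at which the one-sided derivatives disagree\<close>

text \<open>For a rational slope \<open>\<rho>\<close> strictly between \<open>l\<close> and
  \<open>r\<close>, the point \<open>x\<close> is a strict minimum of
  \<open>f y - \<rho> * y\<close> on an interval with rational end points \<open>p\<close> and
  \<open>q\<close>. A strict minimum is unique in its interval, so each \<open>T \<rho> p q\<close>
  has at most one point, and there are only countably many triples.\<close>

lemma countable_one_sided_derivatives_less: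
  fixes f :: "real \<Rightarrow> real"
  shows "countable {x. \<exists>l r. (f has_vector_derivative l) (at_left x) \<and>
    (f has_vector_derivative r) (at_right x) \<and> l < r}" (is "countable ?S")
proof -
  define T where "T = (\<lambda>\<rho> p q. {x. p < x \<and> x < q \<and>
    (\<forall>y. p < y \<and> y < q \<and> y \<noteq> x \<longrightarrow> f x - \<rho> * x < f y - \<rho> * y)})"
  have "?S \<subseteq> (\<Union>\<rho>\<in>\<rat>. \<Union>p\<in>\<rat>. \<Union>q\<in>\<rat>. T \<rho> p q)"
  proof
    fix x assume "x \<in> ?S"
    then obtain l r where l: "((\<lambda>y. (f y - f x) /\<^sub>R (y - x)) \<longlongrightarrow> l) (at_left x)"
      and r: "((\<lambda>y. (f y - f x) /\<^sub>R (y - x)) \<longlongrightarrow> r) (at_right x)" and "l < r"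
      by (auto simp: has_vector_derivative_iff_quotient)
    obtain \<rho> where \<rho>: "\<rho> \<in> \<rat>" "l < \<rho>" "\<rho> < r"
      using Rats_dense_in_real[OF \<open>l < r\<close>] by blast
    obtain u where u: "u < x" "\<And>y. u < y \<Longrightarrow> y < x \<Longrightarrow> (f y - f x) /\<^sub>R (y - x) < \<rho>"
      using order_tendstoD(2)[OF l \<rho>(2)] unfolding eventually_at_left_field by blast
    obtain v where v: "x < v" "\<And>y. x < y \<Longrightarrow> y < v \<Longrightarrow> \<rho> < (f y - f x) /\<^sub>R (y - x)"
      using order_tendstoD(1)[OF r \<rho>(3)] unfolding eventually_at_right_field by blast
    obtain p where p: "p \<in> \<rat>" "u < p" "p < x" using Rats_dense_in_real[OF u(1)] by blast
    obtain q where q: "q \<in> \<rat>" "x < q" "q < v" using Rats_dense_in_real[OF v(1)] by blast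
    have "f x - \<rho> * x < f y - \<rho> * y" if "p < y" "y < q" "y \<noteq> x" for y
    proof (cases "y < x")
      case True
      then have "(f y - f x) / (y - x) < \<rho>" using u(2)[of y] p that by (simp add: divide_inverse mult.commute)
      then show ?thesis using True by (simp add: neg_divide_less_eq algebra_simps)
    next
      case False
      then have "\<rho> < (f y - f x) / (y - x)" using v(2)[of y] q that by (simp add: divide_inverse mult.commute)
      then show ?thesis using False that by (simp add: pos_less_divide_eq algebra_simps)
    qed
    then have "x \<in> T \<rho> p q" using p q by (auto simp: T_def)
    with \<rho> p q show "x \<in> (\<Union>\<rho>\<in>\<rat>. \<Union>p\<in>\<rat>. \<Union>q\<in>\<rat>. T \<rho> p q)" by blast
  qed
  moreover have "countable (T \<rho> p q)" for \<rho> p q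
  proof (cases "T \<rho> p q = {}")
    case False
    then obtain x where x: "x \<in> T \<rho> p q" by blast
    have "T \<rho> p q \<subseteq> {x}"
    proof
      fix y assume y: "y \<in> T \<rho> p q"
      show "y \<in> {x}"
      proof (rule ccontr)
        assume "y \<notin> {x}"
        then have "f x - \<rho> * x < f y - \<rho> * y" "f y - \<rho> * y < f x - \<rho> * x"
          using x y unfolding T_def by blast+
        then show False by simp
      qed
    qed
    then show ?thesis by (rule countable_subset) simp
  qed simp
  ultimately show ?thesis
    by (meson countable_UN countable_rat countable_subset)
qed

lemma countable_one_sided_derivatives_differ:
  fixes f :: "real \<Rightarrow> real"
  shows "countable {x. \<exists>l r. (f has_vector_derivative l) (at_left x) \<and>
    (f has_vector_derivative r) (at_right x) \<and> l \<noteq> r}" (is "countable ?S")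
proof -
  have "?S \<subseteq> {x. \<exists>l r. (f has_vector_derivative l) (at_left x) \<and>
    (f has_vector_derivative r) (at_right x) \<and> l < r} \<union>
     {x. \<exists>l r. ((\<lambda>x. - f x) has_vector_derivative l) (at_left x) \<and>
    ((\<lambda>x. - f x) has_vector_derivative r) (at_right x) \<and> l < r}" (is "_ \<subseteq> ?A \<union> ?B")
  proof
    fix x assume "x \<in> ?S"
    then obtain l r where lr: "(f has_vector_derivative l) (at_left x)"
      "(f has_vector_derivative r) (at_right x)" "l \<noteq> r" by blast
    show "x \<in> ?A \<union> ?B"
    proof (cases "l < r")
      case False
      with lr(3) have "- l < - r" by simp
      then show ?thesis
        using has_vector_derivative_minus[OF lr(1)] has_vector_derivative_minus[OF lr(2)] by blast
    qed (use lr in blast)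
  qed
  then show ?thesis
    by (rule countable_subset) (intro countable_Un countable_one_sided_derivatives_less)
qed

section \<open>The fundamental theorem of calculus for absolutely continuous functions\<close>

lemma negligible_outer_open:
  fixes N :: "'a::euclidean_space set"
  assumes "negligible N" "0 < \<delta>"
  obtains T where "open T" "N \<subseteq> T" "T \<in> lmeasurable" "measure lebesgue T < \<delta>"
proof -
  have N: "N \<in> lmeasurable" "measure lebesgue N = 0"
    using assms(1) by (auto simp: negligible_iff_measure)
  obtain T where T: "open T" "N \<subseteq> T" "T - N \<in> lmeasurable" "emeasure lebesgue (T - N) < ennreal \<delta>"
    using sets_lebesgue_outer_open[OF fmeasurableD[OF N(1)] assms(2)] by blast
  have T': "T \<in> lmeasurable"
    using fmeasurable.Un[OF T(3) N(1)] T(2) by (simp add: Un_absorb2)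
  have "measure lebesgue T = measure lebesgue (T - N)"
    using N T' by (subst measure_Diff_null_set) (auto simp: negligible_iff_null_sets[symmetric] assms)
  also have "\<dots> < \<delta>"
    using T(3,4) assms(2) by (simp add: emeasure_eq_measure2 fmeasurableD ennreal_less_iff)
  finally show ?thesis using that T T' by blast
qed

text \<open>Restates absolute continuity for divisions, the form in which gauge integration delivers
  families of intervals. Smallness of the total length is expressed by a set \<open>T\<close> of
  small measure containing all of them.\<close>

lemma abs_continuous_on_small_cover:
  fixes f :: "real \<Rightarrow> 'v::euclidean_space"
  assumes ac: "abs_continuous_on I f" and "0 < \<epsilon>"
  obtains \<delta> where "0 < \<delta>"
    "\<And>\<D> T. \<D> division_of \<Union>\<D> \<Longrightarrow> \<Union>\<D> \<subseteq> I \<inter> T \<Longrightarrow> T \<in> lmeasurable \<Longrightarrow> measure lebesgue T < \<delta> \<Longrightarrow>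
       (\<Sum>K\<in>\<D>. norm (f (Sup K) - f (Inf K))) < \<epsilon>"
proof -
  obtain \<delta> where \<delta>: "\<delta> > 0" and *: "\<And>D :: (real \<times> real) set.
        finite D \<and> (\<forall>(s, t)\<in>D. s \<le> t \<and> {s..t} \<subseteq> I) \<and>
        pairwise (\<lambda>(s, t) (s', t'). {s<..<t} \<inter> {s'<..<t'} = {}) D \<and>
        (\<Sum>(s, t)\<in>D. t - s) < \<delta>
        \<Longrightarrow> (\<Sum>(s, t)\<in>D. norm (f t - f s)) < \<epsilon>"
    using ac \<open>0 < \<epsilon>\<close> unfolding abs_continuous_on_def by meson
  have "(\<Sum>K\<in>\<D>. norm (f (Sup K) - f (Inf K))) < \<epsilon>"
    if div: "\<D> division_of \<Union>\<D>" and sub: "\<Union>\<D> \<subseteq> I \<inter> T"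
      and T: "T \<in> lmeasurable" "measure lebesgue T < \<delta>" for \<D> T
  proof -
    have int: "\<exists>u v. K = {u..v} \<and> u \<le> v" if "K \<in> \<D>" for K
      using division_ofD(3,4)[OF div that] by auto
    define D where "D = (\<lambda>K. (Inf K, Sup K)) ` \<D>"
    have inj: "inj_on (\<lambda>K. (Inf K, Sup K)) \<D>"
    proof (rule inj_onI)
      fix K L assume "K \<in> \<D>" "L \<in> \<D>" and eq: "(Inf K, Sup K) = (Inf L, Sup L)"
      with int obtain u v u' v' where "K = {u..v}" "u \<le> v" "L = {u'..v'}" "u' \<le> v'" by metis
      with eq show "K = L" by simp
    qed
    have fin: "finite \<D>" using div by blast
    have "(\<Sum>(s, t)\<in>D. t - s) = (\<Sum>K\<in>\<D>. measure lebesgue K)"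
    proof -
      have "Sup K - Inf K = measure lebesgue K" if K: "K \<in> \<D>" for K
      proof -
        obtain u v where "K = {u..v}" "u \<le> v" using int[OF K] by blast
        then show ?thesis by simp
      qed
      then show ?thesis
        unfolding D_def by (subst sum.reindex[OF inj]) simp
    qed
    also have "\<dots> = measure lebesgue (\<Union>\<D>)"
      using content_division[OF div] by simp
    also have "\<dots> \<le> measure lebesgue T"
    proof (rule measure_mono_fmeasurable)
      show "\<Union>\<D> \<in> sets lebesgue"
        using lmeasurable_division[OF div] by (rule fmeasurableD)
    qed (use sub T in auto)
    also have "\<dots> < \<delta>" by (rule T)
    finally have len: "(\<Sum>(s, t)\<in>D. t - s) < \<delta>" .
    have pw: "pairwise (\<lambda>(s, t) (s', t'). {s<..<t} \<inter> {s'<..<t'} = {}) D"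
      unfolding D_def pairwise_image
    proof (rule pairwiseI)
      fix K L assume KL: "K \<in> \<D>" "L \<in> \<D>" "K \<noteq> L"
      then have "interior K \<inter> interior L = {}" using division_ofD(5)[OF div] by blast
      moreover obtain u v u' v' where "K = {u..v}" "u \<le> v" "L = {u'..v'}" "u' \<le> v'"
        using int KL(1,2) by metis
      ultimately have "{Inf K<..<Sup K} \<inter> {Inf L<..<Sup L} = {}" by simp
      then show "(Inf K, Sup K) \<noteq> (Inf L, Sup L) \<longrightarrow>
       (case (Inf K, Sup K) of (s, t) \<Rightarrow> \<lambda>(s', t'). {s<..<t} \<inter> {s'<..<t'} = {}) (Inf L, Sup L)"
        by simp
    qed
    have "\<forall>(s, t)\<in>D. s \<le> t \<and> {s..t} \<subseteq> I"
    proof -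
      have "Inf K \<le> Sup K \<and> {Inf K..Sup K} \<subseteq> I" if K: "K \<in> \<D>" for K
      proof -
        obtain u v where uv: "K = {u..v}" "u \<le> v" using int[OF K] by blast
        moreover have "K \<subseteq> I" using sub K by blast
        ultimately show ?thesis by simp
      qed
      then show ?thesis by (simp add: D_def)
    qed
    with fin len pw have "(\<Sum>(s, t)\<in>D. norm (f t - f s)) < \<epsilon>"
      by (intro *) (simp add: D_def)
    then show ?thesis
      unfolding D_def by (subst (asm) sum.reindex[OF inj]) simp
  qed
  with \<delta> show ?thesis by (rule that)
qed

text \<open>A gauge argument. An interval tagged off \<open>N\<close> has an increment close to its
  length times \<open>g x\<close>, by differentiability. Intervals tagged in \<open>N\<close> all
  lie in an open set of small measure, where absolute continuity bounds the sum of the increments.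
  Integrability of \<open>g\<close> is part of the conclusion.\<close>

theorem abs_continuous_on_has_integral:
  fixes f :: "real \<Rightarrow> 'v::euclidean_space"
  assumes ac: "abs_continuous_on I f" and sub: "{s..t} \<subseteq> I" and "s \<le> t" and N: "negligible N"
    and D: "\<And>x. x \<in> {s..t} - N \<Longrightarrow> (f has_vector_derivative g x) (at x within {s..t})"
  shows "(g has_integral f t - f s) {s..t}"
proof -
  \<comment> \<open>With the value 0 on \<open>N\<close> the Riemann terms with tag in
    \<open>N\<close> vanish, and only increments of \<open>f\<close> remain there.\<close>
  define g0 where "g0 = (\<lambda>x. if x \<in> N then 0 else g x)"
  have "(g0 has_integral f t - f s) (cbox s t)"
    unfolding has_integral
  proof (intro allI impI)
    fix e :: real assume "0 < e"
    \<comment> \<open>Half of \<open>e\<close> is reserved for tags off \<open>N\<close>, where the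
      errors add up to at most \<open>\<epsilon> * (t - s)\<close>; the \<open>+ 1\<close> keeps the
      denominator positive when \<open>s = t\<close>.\<close>
    define \<epsilon> where "\<epsilon> = e / (2 * (t - s + 1))"
    have \<epsilon>: "\<epsilon> > 0" using \<open>0 < e\<close> \<open>s \<le> t\<close> by (simp add: \<epsilon>_def)
    obtain \<delta> where \<delta>: "0 < \<delta>"
      "\<And>\<D> T. \<D> division_of \<Union>\<D> \<Longrightarrow> \<Union>\<D> \<subseteq> I \<inter> T \<Longrightarrow> T \<in> lmeasurable \<Longrightarrow> measure lebesgue T < \<delta> \<Longrightarrow>
       (\<Sum>K\<in>\<D>. norm (f (Sup K) - f (Inf K))) < e / 2"
      using abs_continuous_on_small_cover[OF ac half_gt_zero[OF \<open>0 < e\<close>]] by blast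
    obtain T where T: "open T" "N \<subseteq> T" "T \<in> lmeasurable" "measure lebesgue T < \<delta>"
      using negligible_outer_open[OF N \<delta>(1)] .
    have "\<exists>d>0. \<forall>y\<in>{s..t}. \<bar>y - x\<bar> < d \<longrightarrow> norm (f y - f x - (y - x) *\<^sub>R g x) \<le> \<epsilon> * \<bar>y - x\<bar>"
      if "x \<in> {s..t} - N" for x
      using D[OF that] \<epsilon> unfolding has_vector_derivative_def has_derivative_within_alt
      by (auto simp: real_norm_def)
    then obtain d where d: "\<And>x. x \<in> {s..t} - N \<Longrightarrow> d x > 0"
      "\<And>x y. x \<in> {s..t} - N \<Longrightarrow> y \<in> {s..t} \<Longrightarrow> \<bar>y - x\<bar> < d x \<Longrightarrow>
         norm (f y - f x - (y - x) *\<^sub>R g x) \<le> \<epsilon> * \<bar>y - x\<bar>"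
      by metis
    \<comment> \<open>On \<open>N\<close> the gauge pushes intervals into the small open set
      \<open>T\<close>; on the rest of \<open>{s..t}\<close> it enforces the linear
      approximation.\<close>
    define \<gamma> where "\<gamma> x = (if x \<in> N then T else if x \<in> {s..t} then ball x (d x) else UNIV)" for x
    have gauge: "gauge \<gamma>" using T d(1) by (auto simp: gauge_def \<gamma>_def)
    have bound: "norm ((\<Sum>(x, K)\<in>p. Henstock_Kurzweil_Integration.content K *\<^sub>R g0 x) - (f t - f s)) < e"
      if p: "p tagged_division_of cbox s t" and fine: "\<gamma> fine p" for p
    proof -
      define A where "A K = f (Sup K) - f (Inf K)" for K :: "real set"
      have pK: "\<exists>u v. K = {u..v} \<and> u \<le> v \<and> x \<in> {u..v} \<and> {u..v} \<subseteq> {s..t} \<and> {u..v} \<subseteq> \<gamma> x"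
        if xK: "(x, K) \<in> p" for x K
      proof -
        obtain u v where "K = cbox u v" using tagged_division_ofD(4)[OF p xK] by blast
        with tagged_division_ofD(2,3)[OF p xK] fineD[OF fine xK] show ?thesis
          by (intro exI[of _ u] exI[of _ v]) auto
      qed
      have fin: "finite p" using p by blast
      define P where "P = {(x, K) \<in> p. x \<in> N}"
      have P: "P \<subseteq> p" "finite P" using fin by (auto simp: P_def intro: finite_subset)
      have "(\<Sum>(x, K)\<in>p. A K) = f t - f s"
        unfolding A_def using additive_tagged_division_1[of s t p f] \<open>s \<le> t\<close> p by simp
      then have "norm ((\<Sum>(x, K)\<in>p. Henstock_Kurzweil_Integration.content K *\<^sub>R g0 x) - (f t - f s))
          = norm (\<Sum>(x, K)\<in>p. Henstock_Kurzweil_Integration.content K *\<^sub>R g0 x - A K)"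
        by (simp add: sum_subtractf case_prod_unfold)
      also have "\<dots> \<le> (\<Sum>(x, K)\<in>p. norm (Henstock_Kurzweil_Integration.content K *\<^sub>R g0 x - A K))"
        using norm_sum[of "\<lambda>(x, K). Henstock_Kurzweil_Integration.content K *\<^sub>R g0 x - A K" p] by (simp add: case_prod_unfold)
      also have "\<dots> = (\<Sum>(x, K)\<in>p - P. norm (Henstock_Kurzweil_Integration.content K *\<^sub>R g0 x - A K))
            + (\<Sum>(x, K)\<in>P. norm (Henstock_Kurzweil_Integration.content K *\<^sub>R g0 x - A K))"
        using sum.subset_diff[OF P(1) fin] by blast
      also have "(\<Sum>(x, K)\<in>P. norm (Henstock_Kurzweil_Integration.content K *\<^sub>R g0 x - A K)) = (\<Sum>(x, K)\<in>P. norm (A K))"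
        by (intro sum.cong) (auto simp: P_def g0_def)
      also have "\<dots> < e / 2"
      proof -
        have "P tagged_partial_division_of cbox s t"
          using p P(1) by (meson tagged_division_of_def tagged_partial_division_subset)
        then have tag: "P tagged_division_of \<Union>(snd ` P)"
          by (rule tagged_partial_division_of_Union_self)
        then have div: "snd ` P division_of \<Union>(snd ` P)"
          by (rule division_of_tagged_division)
        \<comment> \<open>An interval can occur with two different tags only if it is degenerate.
          Setting \<open>B\<close> to 0 on degenerate intervals permits the passage from a sum over
          tagged intervals to a sum over intervals, and costs nothing because a single point has no
          increment.\<close>
        define B where "B K = (if Henstock_Kurzweil_Integration.content K = 0 then 0 else norm (A K))" for K :: "real set"
        have AB: "B K = norm (A K)" if xK: "(x, K) \<in> P" for x K
        proof -
          obtain u v where "K = {u..v}" "u \<le> v" using pK[OF subsetD[OF P(1) xK]] by blast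
          then show ?thesis by (simp add: B_def A_def)
        qed
        have "(\<Sum>(x, K)\<in>P. norm (A K)) = (\<Sum>(x, K)\<in>P. B K)"
          by (intro sum.cong) (auto simp: AB)
        also have "\<dots> = sum B (snd ` P)"
          by (rule sum.over_tagged_division_lemma[OF tag])
             (simp add: B_def content_eq_0_interior)
        also have "\<dots> = (\<Sum>K\<in>snd ` P. norm (A K))"
          by (intro sum.cong) (auto simp: AB)
        also have "\<dots> < e / 2"
          unfolding A_def
        proof (rule \<delta>(2)[OF div _ T(3,4)])
          show "\<Union>(snd ` P) \<subseteq> I \<inter> T"
          proof
            fix y assume "y \<in> \<Union>(snd ` P)"
            then obtain x K where xK: "(x, K) \<in> p" "x \<in> N" "y \<in> K" by (auto simp: P_def)
            with pK[OF xK(1)] sub show "y \<in> I \<inter> T" by (auto simp: \<gamma>_def)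
          qed
        qed
        finally show ?thesis .
      qed
      also have "(\<Sum>(x, K)\<in>p - P. norm (Henstock_Kurzweil_Integration.content K *\<^sub>R g0 x - A K)) \<le> (\<Sum>(x, K)\<in>p - P. \<epsilon> * Henstock_Kurzweil_Integration.content K)"
      proof (rule sum_mono)
        fix z assume z: "z \<in> p - P"
        obtain x K where xK: "z = (x, K)" by fastforce
        with z have x: "x \<notin> N" "(x, K) \<in> p" by (auto simp: P_def)
        obtain u v where uv: "K = {u..v}" "u \<le> v" "x \<in> {u..v}" "{u..v} \<subseteq> {s..t}" "{u..v} \<subseteq> \<gamma> x"
          using pK[OF x(2)] by blast
        have xs: "x \<in> {s..t} - N" using uv x by blast
        have "{u..v} \<subseteq> ball x (d x)" using uv(5) xs by (auto simp: \<gamma>_def split: if_splits)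
        then have ball: "\<bar>y - x\<bar> < d x" if "u \<le> y" "y \<le> v" for y
          using that by (force simp: dist_real_def abs_minus_commute)
        have uvd: "\<bar>u - x\<bar> < d x" "\<bar>v - x\<bar> < d x" "u \<in> {s..t}" "v \<in> {s..t}"
          using uv(2,4) by (auto intro!: ball)
        have "Henstock_Kurzweil_Integration.content K *\<^sub>R g0 x - A K = (f u - f x - (u - x) *\<^sub>R g x) - (f v - f x - (v - x) *\<^sub>R g x)"
          using uv xs by (simp add: A_def g0_def algebra_simps)
        also have "norm \<dots> \<le> \<epsilon> * \<bar>u - x\<bar> + \<epsilon> * \<bar>v - x\<bar>"
          using d(2)[OF xs uvd(3,1)] d(2)[OF xs uvd(4,2)] norm_triangle_ineq4 by (smt (verit))
        \<comment> \<open>The tag \<open>x\<close> lies between \<open>u\<close> and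
          \<open>v\<close>, so the two distances add up to the length of \<open>K\<close>.\<close>
        also have "\<dots> = \<epsilon> * Henstock_Kurzweil_Integration.content K" using uv by (simp add: algebra_simps)
        finally show "(case z of (x, K) \<Rightarrow> norm (Henstock_Kurzweil_Integration.content K *\<^sub>R g0 x - A K)) \<le> (case z of (x, K) \<Rightarrow> \<epsilon> * Henstock_Kurzweil_Integration.content K)"
          by (simp add: xK)
      qed
      also have "\<dots> \<le> (\<Sum>(x, K)\<in>p. \<epsilon> * Henstock_Kurzweil_Integration.content K)"
        by (rule sum_mono2) (use fin \<epsilon> in auto)
      also have "\<dots> = \<epsilon> * (\<Sum>(x, K)\<in>p. Henstock_Kurzweil_Integration.content K)"
        by (simp add: sum_distrib_left case_prod_unfold)
      also have "(\<Sum>(x, K)\<in>p. Henstock_Kurzweil_Integration.content K) = t - s"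
        using additive_content_tagged_division[OF p] \<open>s \<le> t\<close> by simp
      also have "\<epsilon> * (t - s) \<le> e / 2"
        using \<open>0 < e\<close> \<open>s \<le> t\<close> by (simp add: \<epsilon>_def field_simps)
      finally show ?thesis by simp
    qed
    show "\<exists>\<gamma>. gauge \<gamma> \<and> (\<forall>\<D>. \<D> tagged_division_of cbox s t \<and> \<gamma> fine \<D> \<longrightarrow>
        norm ((\<Sum>(x, K)\<in>\<D>. Henstock_Kurzweil_Integration.content K *\<^sub>R g0 x) - (f t - f s)) < e)"
      by (intro exI[of _ \<gamma>] conjI allI impI gauge) (elim conjE, rule bound)
  qed
  then have "(g0 has_integral f t - f s) {s..t}" by simp
  then show ?thesis
    by (rule has_integral_spike[OF N, rotated]) (simp add: g0_def)
qed

section \<open>Smooth step functions\<close>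

text \<open>An algebra of functions closed under differentiation, so that the infinitely many
  derivatives demanded by \<open>test_function\<close> follow by induction. The generator
  \<open>flat\<close> carries an arbitrary polynomial because differentiating it changes the
  polynomial.\<close>

inductive smooth_fun :: "(real \<Rightarrow> real) \<Rightarrow> bool" where
  flat: "smooth_fun (\<lambda>x. if 0 < x then poly p (1 / x) * exp (- (1 / x)) else 0)"
| const: "smooth_fun (\<lambda>x. c)"
| add: "smooth_fun f \<Longrightarrow> smooth_fun g \<Longrightarrow> smooth_fun (\<lambda>x. f x + g x)"
| mult: "smooth_fun f \<Longrightarrow> smooth_fun g \<Longrightarrow> smooth_fun (\<lambda>x. f x * g x)"
| recip: "smooth_fun f \<Longrightarrow> (\<And>x. f x \<noteq> 0) \<Longrightarrow> smooth_fun (\<lambda>x. inverse (f x))"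
| affine: "smooth_fun f \<Longrightarrow> smooth_fun (\<lambda>x. f (m * x + k))"

lemma poly_times_exp_minus_tendsto_0:
  fixes p :: "real poly"
  shows "((\<lambda>u. poly p u * exp (- u)) \<longlongrightarrow> 0) at_top"
proof -
  have "((\<lambda>u. \<Sum>i\<le>degree p. coeff p i * (u ^ i / exp u)) \<longlongrightarrow> (\<Sum>i\<le>degree p. coeff p i * 0)) at_top"
    by (intro tendsto_intros tendsto_power_div_exp_0)
  then show ?thesis
    by (simp add: poly_altdef sum_distrib_right exp_minus divide_inverse mult.assoc)
qed

text \<open>With \<open>u = 1 / x\<close> one has \<open>du/dx = - u^2\<close>, so differentiation
  turns \<open>p\<close> into \<open>u^2 * (p - pderiv p)\<close>. At the origin, exponential decay
  beats every polynomial in \<open>u\<close>.\<close>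

lemma flat_has_derivative:
  fixes p :: "real poly"
  defines "f \<equiv> \<lambda>p x. if 0 < x then poly p (1 / x) * exp (- (1 / x)) else 0 :: real"
  shows "(f p has_real_derivative f ([:0, 0, 1:] * (p - pderiv p)) x) (at x)"
proof -
  consider "x < 0" | "x = 0" | "0 < x" by linarith
  then show ?thesis
  proof cases
    case 1
    have "((\<lambda>x. 0) has_real_derivative 0) (at x)" by simp
    moreover have "\<forall>\<^sub>F y in nhds x. f p y = 0"
      using eventually_nhds_in_open[of "{..<0}" x] 1 by (auto simp: f_def elim!: eventually_mono)
    ultimately have "(f p has_real_derivative 0) (at x)"
      by (subst DERIV_cong_ev[OF refl _ refl]) auto
    then show ?thesis using 1 by (simp add: f_def)
  next
    case 3
    have "((\<lambda>x. poly p (1 / x) * exp (- (1 / x))) has_real_derivative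
       f ([:0, 0, 1:] * (p - pderiv p)) x) (at x)"
      using 3
      by (auto intro!: derivative_eq_intros DERIV_chain2[OF poly_DERIV] simp: f_def)
         (simp add: field_simps power2_eq_square)
    moreover have "\<forall>\<^sub>F y in nhds x. f p y = poly p (1 / y) * exp (- (1 / y))"
      using eventually_nhds_in_open[of "{0<..}" x] 3 by (auto simp: f_def elim!: eventually_mono)
    ultimately show ?thesis
      by (subst DERIV_cong_ev[OF refl _ refl]) auto
  next
    case 2
    have "((\<lambda>h. f p h / h) \<longlongrightarrow> 0) (at_right 0)"
    proof -
      have "((\<lambda>h. poly ([:0, 1:] * p) (inverse h) * exp (- (inverse h))) \<longlongrightarrow> 0) (at_right 0)"
        by (rule filterlim_compose[OF poly_times_exp_minus_tendsto_0 filterlim_inverse_at_top_right])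
      then show ?thesis
        by (rule Lim_transform_eventually)
           (auto simp: f_def divide_inverse eventually_at_right_field intro!: exI[of _ 1])
    qed
    moreover have "((\<lambda>h. f p h / h) \<longlongrightarrow> 0) (at_left 0)"
      by (rule tendsto_eventually) (auto simp: f_def eventually_at_left_field intro!: exI[of _ "-1"])
    ultimately have "((\<lambda>h. f p h / h) \<longlongrightarrow> 0) (at 0)"
      by (simp add: filterlim_at_split)
    moreover have "f p 0 = 0" "f ([:0, 0, 1:] * (p - pderiv p)) 0 = 0" by (simp_all add: f_def)
    ultimately show ?thesis
      using 2 by (simp add: DERIV_def)
  qed
qed

lemma smooth_fun_derivative:
  "smooth_fun f \<Longrightarrow> \<exists>f'. smooth_fun f' \<and> (\<forall>x. (f has_real_derivative f' x) (at x))"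
proof (induction rule: smooth_fun.induct)
  case (flat p)
  then show ?case using flat_has_derivative smooth_fun.flat by blast
next
  case (const c)
  show ?case by (intro exI[of _ "\<lambda>_. 0"]) (auto intro: smooth_fun.const)
next
  case (add f g)
  then obtain f' g' where "smooth_fun f'" "smooth_fun g'"
    "\<And>x. (f has_real_derivative f' x) (at x)" "\<And>x. (g has_real_derivative g' x) (at x)" by blast
  then show ?case
    by (intro exI[of _ "\<lambda>x. f' x + g' x"]) (auto intro!: smooth_fun.add DERIV_add)
next
  case (mult f g)
  then obtain f' g' where "smooth_fun f'" "smooth_fun g'"
    "\<And>x. (f has_real_derivative f' x) (at x)" "\<And>x. (g has_real_derivative g' x) (at x)" by blast
  with mult(1,2) show ?case
    by (intro exI[of _ "\<lambda>x. f' x * g x + g' x * f x"])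
       (auto intro!: smooth_fun.add smooth_fun.mult DERIV_mult)
next
  case (recip f)
  then obtain f' where f': "smooth_fun f'" "\<And>x. (f has_real_derivative f' x) (at x)" by blast
  have i: "smooth_fun (\<lambda>x. inverse (f x))" using recip by (intro smooth_fun.recip)
  have "smooth_fun (\<lambda>x. (-1) * (inverse (f x) * (f' x * inverse (f x))))"
    by (intro smooth_fun.mult smooth_fun.const i f')
  moreover have "((\<lambda>x. inverse (f x)) has_real_derivative (-1) * (inverse (f x) * (f' x * inverse (f x)))) (at x)" for x
    using DERIV_inverse'[OF f'(2) recip(2)] by (simp add: mult.assoc)
  ultimately show ?case by blast
next
  case (affine f m k)
  then obtain f' where f': "smooth_fun f'" "\<And>x. (f has_real_derivative f' x) (at x)" by blast
  have "smooth_fun (\<lambda>x. m * f' (m * x + k))"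
    by (intro smooth_fun.mult smooth_fun.const smooth_fun.affine f')
  moreover have "((\<lambda>x. f (m * x + k)) has_real_derivative m * f' (m * x + k)) (at x)" for x
  proof -
    have "((\<lambda>x. m * x + k) has_real_derivative m) (at x)"
      by (auto intro!: derivative_eq_intros)
    from DERIV_chain2[OF f'(2) this] show ?thesis by (simp add: mult.commute)
  qed
  ultimately show ?case by blast
qed

lemma smooth_fun_deriv:
  assumes "smooth_fun f"
  shows "smooth_fun (deriv f)" "(f has_real_derivative deriv f x) (at x)"
proof -
  obtain f' where f': "smooth_fun f'" "\<And>x. (f has_real_derivative f' x) (at x)"
    using smooth_fun_derivative[OF assms] by blast
  then have "deriv f = f'" using DERIV_imp_deriv by blast
  with f' show "smooth_fun (deriv f)" "(f has_real_derivative deriv f x) (at x)" by auto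
qed

lemma smooth_fun_higher_deriv:
  assumes "smooth_fun f"
  shows "(deriv ^^ n) f field_differentiable at x"
proof -
  have "smooth_fun ((deriv ^^ n) f)"
    by (induction n) (auto intro: assms smooth_fun_deriv)
  then show ?thesis
    using smooth_fun_deriv(2) field_differentiable_def by blast
qed

lemma smooth_fun_continuous: "smooth_fun f \<Longrightarrow> continuous_on S f"
  using smooth_fun_deriv(2) by (meson DERIV_isCont continuous_at_imp_continuous_on)

text \<open>The classical quotient of \<open>e x\<close> by \<open>e x + e (1 - x)\<close>, whose
  denominator is positive since \<open>x\<close> and \<open>1 - x\<close> are never both
  nonpositive. Differences of rescaled copies of \<open>H\<close> serve as test functions.\<close>

lemma smooth_step_exists:
  obtains H :: "real \<Rightarrow> real" where "smooth_fun H"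
    "\<And>x. x \<le> 0 \<Longrightarrow> H x = 0" "\<And>x. 1 \<le> x \<Longrightarrow> H x = 1" "\<And>x. 0 \<le> H x" "\<And>x. H x \<le> 1"
proof -
  define e :: "real \<Rightarrow> real" where "e x = (if 0 < x then exp (- (1 / x)) else 0)" for x
  define H where "H x = e x * inverse (e x + e (1 - x))" for x
  have e: "smooth_fun e"
    using smooth_fun.flat[of 1] by (simp add: e_def[abs_def] cong: if_cong)
  then have e': "smooth_fun (\<lambda>x. e (1 - x))"
    using smooth_fun.affine[OF e, of "-1" 1] by simp
  have nn: "0 \<le> e x" for x by (simp add: e_def)
  have pos: "0 < e x + e (1 - x)" for x
  proof (cases "0 < x")
    case True
    then have "0 < e x" by (simp add: e_def)
    then show ?thesis using nn[of "1 - x"] by simp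
  next
    case False
    then have "0 < e (1 - x)" by (simp add: e_def)
    then show ?thesis using nn[of x] by simp
  qed
  show ?thesis
  proof (rule that[of H])
    show "smooth_fun H"
      unfolding H_def by (intro smooth_fun.mult smooth_fun.recip smooth_fun.add e e' less_imp_neq[OF pos, symmetric])
    show "H x = 0" if "x \<le> 0" for x using that by (simp add: H_def e_def)
    show "H x = 1" if "1 \<le> x" for x
    proof -
      have "e (1 - x) = 0" "0 < e x" using that by (simp_all add: e_def)
      then show ?thesis by (simp add: H_def)
    qed
    show "0 \<le> H x" for x using nn pos[of x] by (simp add: H_def)
    show "H x \<le> 1" for x
      using nn[of "1 - x"] pos[of x] by (simp add: H_def divide_inverse[symmetric] pos_divide_le_eq)
  qed
qed

section \<open>The rescaled derivative of a step as a one-sided mollifier\<close>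

lemma smooth_step_deriv_outside:
  assumes "smooth_fun H" "\<And>x. x \<le> 0 \<Longrightarrow> H x = 0" "\<And>x. 1 \<le> x \<Longrightarrow> H x = 1" "x < 0 \<or> 1 < x"
  shows "deriv H x = 0"
proof -
  have "\<exists>c. \<forall>\<^sub>F y in nhds x. H y = c"
    using assms(4)
  proof
    assume "x < 0"
    then show ?thesis
      using eventually_nhds_in_open[of "{..<0}" x] assms(2) by (auto elim!: eventually_mono)
  next
    assume "1 < x"
    then show ?thesis
      using eventually_nhds_in_open[of "{1<..}" x] assms(3) by (auto elim!: eventually_mono)
  qed
  then obtain c where c: "\<forall>\<^sub>F y in nhds x. H y = c" by blast
  have "((\<lambda>_. c) has_real_derivative 0) (at x)" by simp
  then have "(H has_real_derivative 0) (at x)"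
    using c by (subst DERIV_cong_ev[OF refl _ refl]) auto
  then show ?thesis by (rule DERIV_imp_deriv)
qed

lemma smooth_step_deriv_bounded:
  assumes "smooth_fun H" "\<And>x. x \<le> 0 \<Longrightarrow> H x = 0" "\<And>x. 1 \<le> x \<Longrightarrow> H x = 1"
  obtains M where "0 < M" "\<And>x. \<bar>deriv H x\<bar> \<le> M"
proof -
  have "continuous_on {0..1} (deriv H)"
    by (intro smooth_fun_continuous smooth_fun_deriv assms(1))
  then have "bounded (deriv H ` {0..1})"
    by (intro compact_imp_bounded compact_continuous_image) auto
  then obtain M where M: "0 < M" "\<And>x. x \<in> {0..1} \<Longrightarrow> \<bar>deriv H x\<bar> \<le> M"
    unfolding bounded_pos by (auto simp: real_norm_def)
  have "\<bar>deriv H x\<bar> \<le> M" for x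
    using M smooth_step_deriv_outside[OF assms, of x] by (cases "x \<in> {0..1}") auto
  with M(1) that show ?thesis by blast
qed

lemma smooth_step_approximate_identity:
  fixes f :: "real \<Rightarrow> 'v::euclidean_space"
  assumes H: "smooth_fun H" "\<And>x. x \<le> 0 \<Longrightarrow> H x = 0" "\<And>x. 1 \<le> x \<Longrightarrow> H x = 1"
    and f: "continuous_on {s..t} f" and c: "s \<le> c" "c < t"
  shows "(\<lambda>n. integral {s..t} (\<lambda>z. (real n * deriv H (real n * (z - c))) *\<^sub>R f z)) \<longlonglongrightarrow> f c"
proof -
  define k where "k n z = real n * deriv H (real n * (z - c))" for n z
  obtain M where M: "0 < M" "\<And>x. \<bar>deriv H x\<bar> \<le> M"
    using smooth_step_deriv_bounded[OF H] by blast
  have k_cont: "continuous_on S (k n)" for S n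
    unfolding k_def
    by (intro continuous_intros continuous_on_compose2[OF smooth_fun_continuous[OF smooth_fun_deriv(1)[OF H(1)], of UNIV]]) auto
  have k_int: "(k n has_integral 1) {s..t}" if n: "1 / (t - c) \<le> real n" "0 < n" for n
  proof -
    have "((\<lambda>z. H (real n * (z - c))) has_vector_derivative k n z) (at z within {s..t})" for z
    proof -
      have "((\<lambda>z. H (real n * (z - c))) has_real_derivative k n z) (at z)"
      proof -
        have "((\<lambda>z. real n * (z - c)) has_real_derivative real n) (at z)"
          by (auto intro!: derivative_eq_intros)
        from DERIV_chain2[OF smooth_fun_deriv(2)[OF H(1)] this]
        show ?thesis by (simp add: mult.commute k_def)
      qed
      then show ?thesis
        by (simp add: has_real_derivative_iff_has_vector_derivative has_vector_derivative_at_within)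
    qed
    then have "(k n has_integral H (real n * (t - c)) - H (real n * (s - c))) {s..t}"
      using c by (intro fundamental_theorem_of_calculus) auto
    moreover have "1 \<le> real n * (t - c)" using n c by (simp add: field_simps)
    moreover have "real n * (s - c) \<le> 0" using c by (simp add: mult_nonneg_nonpos)
    ultimately show ?thesis using H by simp
  qed
  show ?thesis
    unfolding k_def[symmetric] LIMSEQ_iff
  proof (intro allI impI)
    fix e :: real assume "0 < e"
    define \<epsilon> where "\<epsilon> = e / (2 * M)"
    have \<epsilon>: "0 < \<epsilon>" using \<open>0 < e\<close> M by (simp add: \<epsilon>_def)
    obtain d where d: "0 < d" "\<And>z. z \<in> {s..t} \<Longrightarrow> \<bar>z - c\<bar> < d \<Longrightarrow> norm (f z - f c) < \<epsilon>"
      using f c \<epsilon> unfolding continuous_on_iff dist_norm real_norm_def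
      by (metis atLeastAtMost_iff less_imp_le)
    \<comment> \<open>Makes the support of the kernel end before \<open>t\<close> and stay within
      distance \<open>d\<close> of \<open>c\<close>.\<close>
    define no where "no = nat \<lceil>max (1 / (t - c)) (1 / d)\<rceil> + 1"
    have "norm (integral {s..t} (\<lambda>z. k n z *\<^sub>R f z) - f c) < e" if "no \<le> n" for n
    proof -
      have n: "1 / (t - c) \<le> real n" "1 / d < real n" "0 < n"
        using that unfolding no_def by linarith+
      have nd: "1 / real n < d" using n d by (simp add: field_simps)
      have ct: "c + 1 / real n \<le> t" using n c by (simp add: field_simps)
      have i1: "(\<lambda>z. k n z *\<^sub>R f z) integrable_on {s..t}"
        by (intro integrable_continuous_real continuous_intros k_cont f)
      have i2: "((\<lambda>z. k n z *\<^sub>R f c) has_integral f c) {s..t}"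
        using has_integral_scaleR_left[OF k_int[OF n(1,3)], of "f c"] by simp
      have "((\<lambda>z. k n z *\<^sub>R f z - k n z *\<^sub>R f c) has_integral
            (integral {s..t} (\<lambda>z. k n z *\<^sub>R f z) - f c)) {s..t}"
        by (intro has_integral_diff i2 integrable_integral i1)
      then have i3: "(\<lambda>z. k n z *\<^sub>R f z - k n z *\<^sub>R f c) integrable_on {s..t}"
        and eq: "integral {s..t} (\<lambda>z. k n z *\<^sub>R f z) - f c = integral {s..t} (\<lambda>z. k n z *\<^sub>R f z - k n z *\<^sub>R f c)"
        by (auto simp: integrable_on_def integral_unique)
      have "((\<lambda>z. real n * M * \<epsilon>) has_integral (1 / real n) * (real n * M * \<epsilon>)) {c..c + 1 / real n}"
        using has_integral_const_real[of "real n * M * \<epsilon>" c "c + 1 / real n"] by simp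
      then have i4: "((\<lambda>z. if z \<in> {c..c + 1 / real n} then real n * M * \<epsilon> else 0) has_integral M * \<epsilon>) {s..t}"
        using n c ct by (subst has_integral_restrict) auto
      have "norm (integral {s..t} (\<lambda>z. k n z *\<^sub>R f z - k n z *\<^sub>R f c))
          \<le> integral {s..t} (\<lambda>z. if z \<in> {c..c + 1 / real n} then real n * M * \<epsilon> else 0)"
      proof (rule integral_norm_bound_integral[OF i3])
        show "(\<lambda>z. if z \<in> {c..c + 1 / real n} then real n * M * \<epsilon> else 0) integrable_on {s..t}"
          using i4 by blast
        fix z assume z: "z \<in> {s..t}"
        show "norm (k n z *\<^sub>R f z - k n z *\<^sub>R f c) \<le> (if z \<in> {c..c + 1 / real n} then real n * M * \<epsilon> else 0)"
        proof (cases "z \<in> {c..c + 1 / real n}")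
          case True
          then have "\<bar>z - c\<bar> < d" using nd by auto
          then have "norm (f z - f c) \<le> \<epsilon>" using d(2)[OF z] by simp
          moreover have "\<bar>k n z\<bar> \<le> real n * M"
            by (simp add: k_def abs_mult M mult_left_mono)
          ultimately have "\<bar>k n z\<bar> * norm (f z - f c) \<le> real n * M * \<epsilon>"
            using M by (intro mult_mono) auto
          then show ?thesis using True by (simp flip: scaleR_diff_right)
        next
          case False
          then have "real n * (z - c) < 0 \<or> 1 < real n * (z - c)"
            using n(3) by (auto simp: field_simps mult_less_0_iff)
          then have "k n z = 0"
            unfolding k_def using smooth_step_deriv_outside[OF H] by simp
          then show ?thesis using M(1) \<epsilon> by simp
        qed
      qed
      also have "\<dots> = M * \<epsilon>" using i4 by (rule integral_unique)
      also have "\<dots> < e" using \<open>0 < e\<close> M by (simp add: \<epsilon>_def)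
      finally show ?thesis using eq by simp
    qed
    then show "\<exists>no. \<forall>n\<ge>no. norm (integral {s..t} (\<lambda>z. k n z *\<^sub>R f z) - f c) < e" by blast
  qed
qed

section \<open>Weak derivatives\<close>

lemma smooth_fun_diff: "smooth_fun f \<Longrightarrow> smooth_fun g \<Longrightarrow> smooth_fun (\<lambda>x. f x - g x)"
  using smooth_fun.add[OF _ smooth_fun.mult[OF smooth_fun.const[of "-1"]], of f g] by simp

text \<open>The test function \<open>\<phi> n\<close> passes from 0 to 1 just to the right of
  \<open>s\<close> and back to 0 just to the right of \<open>t\<close>. Tested against
  \<open>f\<close>, its derivative consists of two mollifiers and tends to \<open>f s - f t\<close>;
  tested against \<open>g\<close>, it tends to the integral of \<open>g\<close> by dominated
  convergence.\<close>

lemma has_weak_derivative_increment: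
  fixes f g :: "real \<Rightarrow> 'v::euclidean_space"
  assumes w: "has_weak_derivative f g {a<..<b}" and f: "continuous_on {a<..<b} f"
    and st: "a < s" "s < t" "t < b"
  shows "(g has_integral f t - f s) {s..t}"
proof -
  \<comment> \<open>Room to the right of \<open>t\<close> for the second flank: from
    \<open>n0\<close> on, \<open>\<phi> n\<close> is supported in \<open>{s..r}\<close>, a compact
    part of the open interval.\<close>
  define r where "r = (t + b) / 2"
  have r: "t < r" "r < b" using st by (simp_all add: r_def)
  obtain H :: "real \<Rightarrow> real" where H: "smooth_fun H" "\<And>x. x \<le> 0 \<Longrightarrow> H x = 0" "\<And>x. 1 \<le> x \<Longrightarrow> H x = 1"
    and H01: "\<And>x. 0 \<le> H x" "\<And>x. H x \<le> 1"
    by (rule smooth_step_exists) blast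
  define \<phi> where "\<phi> n z = H (real n * (z - s)) - H (real n * (z - t))" for n z
  define k where "k c n z = real n * deriv H (real n * (z - c))" for c n z
  define n0 where "n0 = nat \<lceil>1 / (r - t)\<rceil> + 1"
  have sub: "{s..r} \<subseteq> {a<..<b}" using st r by auto
  have n0: "1 \<le> real n * (r - t)" "0 < n" if "n0 \<le> n" for n
  proof -
    have "1 / (r - t) \<le> real n" using that unfolding n0_def by linarith
    then show "1 \<le> real n * (r - t)" using r by (simp add: field_simps)
    show "0 < n" using that by (simp add: n0_def)
  qed
  have dc: "((\<lambda>z. H (real n * (z - c))) has_real_derivative k c n z) (at z)" for c n z
  proof -
    have "((\<lambda>z. real n * (z - c)) has_real_derivative real n) (at z)"
      by (auto intro!: derivative_eq_intros)
    from DERIV_chain2[OF smooth_fun_deriv(2)[OF H(1)] this]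
    show ?thesis by (simp add: mult.commute k_def)
  qed
  have d\<phi>: "deriv (\<phi> n) z = k s n z - k t n z" for n z
    unfolding \<phi>_def by (intro DERIV_imp_deriv DERIV_diff dc)
  have far: "real n * (z - s) < 0 \<and> real n * (z - t) < 0 \<or> 1 < real n * (z - s) \<and> 1 < real n * (z - t)"
    if "n0 \<le> n" "z \<notin> {s..r}" for n z
  proof (cases "z < s")
    case True
    then show ?thesis using n0(2)[OF that(1)] st by (simp add: mult_less_0_iff)
  next
    case False
    then have "r < z" using that(2) by simp
    then have "real n * (r - t) < real n * (z - t)" "real n * (z - t) < real n * (z - s)"
      using n0(2)[OF that(1)] st by simp_all
    then show ?thesis using n0(1)[OF that(1)] by linarith
  qed
  have zero: "\<phi> n z = 0" "deriv (\<phi> n) z = 0" if "n0 \<le> n" "z \<notin> {s..r}" for n z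
  proof -
    show "\<phi> n z = 0"
      using far[OF that] H(2,3) unfolding \<phi>_def by (metis diff_self less_imp_le)
    have "k s n z = 0" "k t n z = 0"
      using far[OF that] smooth_step_deriv_outside[OF H] unfolding k_def by (metis mult_zero_right)+
    then show "deriv (\<phi> n) z = 0" by (simp add: d\<phi>)
  qed
  have test: "test_function {a<..<b} (\<phi> n)" if n: "n0 \<le> n" for n
    unfolding test_function_def
  proof (intro conjI allI)
    have "smooth_fun (\<lambda>z. H (real n * z + (- real n * c)))" for c
      by (rule smooth_fun.affine[OF H(1)])
    then have "smooth_fun (\<lambda>z. H (real n * (z - c)))" for c
      by (simp add: right_diff_distrib)
    then have "smooth_fun (\<phi> n)"
      unfolding \<phi>_def by (intro smooth_fun_diff)
    then show "(deriv ^^ m) (\<phi> n) field_differentiable at x" for m x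
      by (rule smooth_fun_higher_deriv)
    have supp: "closure {x. \<phi> n x \<noteq> 0} \<subseteq> {s..r}"
      using zero(1)[OF n] by (intro closure_minimal subsetI) (blast, simp)
    then show "closure {x. \<phi> n x \<noteq> 0} \<subseteq> {a<..<b}" using sub by blast
    show "compact (closure {x. \<phi> n x \<noteq> 0})"
      using supp by (meson bounded_closed_interval bounded_subset closed_closure compact_eq_bounded_closed)
  qed
  have g: "set_integrable lebesgue {s..r} g"
    using w sub by (simp add: has_weak_derivative_def locally_integrable_def)
  have fsr: "continuous_on {s..r} f" using f sub by (rule continuous_on_subset)
  have lhs: "(\<lambda>n. LINT x:{a<..<b}|lebesgue. deriv (\<phi> n) x *\<^sub>R f x) \<longlonglongrightarrow> f s - f t"
  proof -
    have k_cont: "continuous_on {s..r} (k c n)" for c n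
      unfolding k_def
      by (intro continuous_intros continuous_on_compose2[OF smooth_fun_continuous[OF smooth_fun_deriv(1)[OF H(1)], of UNIV]]) auto
    have ki: "(\<lambda>x. k c n x *\<^sub>R f x) absolutely_integrable_on {s..r}" for c n
      by (intro absolutely_integrable_continuous_real continuous_intros k_cont fsr)
    have eq: "(LINT x:{a<..<b}|lebesgue. deriv (\<phi> n) x *\<^sub>R f x)
       = integral {s..r} (\<lambda>x. k s n x *\<^sub>R f x) - integral {s..r} (\<lambda>x. k t n x *\<^sub>R f x)"
      if n: "n0 \<le> n" for n
    proof -
      have "(LINT x:{a<..<b}|lebesgue. deriv (\<phi> n) x *\<^sub>R f x) = (LINT x:{s..r}|lebesgue. deriv (\<phi> n) x *\<^sub>R f x)"
        unfolding set_lebesgue_integral_def using zero(2)[OF n] sub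
        by (intro Bochner_Integration.integral_cong refl) (auto simp: indicator_def)
      also have "\<dots> = (LINT x:{s..r}|lebesgue. k s n x *\<^sub>R f x - k t n x *\<^sub>R f x)"
        by (simp add: d\<phi> scaleR_diff_left)
      also have "\<dots> = (LINT x:{s..r}|lebesgue. k s n x *\<^sub>R f x) - (LINT x:{s..r}|lebesgue. k t n x *\<^sub>R f x)"
        by (rule set_integral_diff(2)[OF ki ki])
      finally show ?thesis
        by (simp add: set_lebesgue_integral_eq_integral(2)[OF ki])
    qed
    have lim: "(\<lambda>n. integral {s..r} (\<lambda>x. k s n x *\<^sub>R f x) - integral {s..r} (\<lambda>x. k t n x *\<^sub>R f x)) \<longlonglongrightarrow> f s - f t"
      unfolding k_def
      by (intro tendsto_diff smooth_step_approximate_identity H fsr) (use st r in auto)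
    show ?thesis
      by (rule Lim_transform_eventually[OF lim eventually_mono[OF eventually_ge_at_top[of n0]]]) (rule eq[symmetric])
  qed
  define G where "G x = indicat_real {s..r} x *\<^sub>R g x" for x
  have G: "integrable lebesgue G" using g by (simp add: set_integrable_def G_def[abs_def])
  \<comment> \<open>The limit interval contains \<open>t\<close> but not \<open>s\<close>: the steps
    vanish at the point where they start, so eventually \<open>\<phi> n\<close> is 0 at
    \<open>s\<close> and 1 at \<open>t\<close>.\<close>
  have rhs: "(\<lambda>n. LINT x:{a<..<b}|lebesgue. \<phi> n x *\<^sub>R g x) \<longlonglongrightarrow> (LINT x:{s<..t}|lebesgue. g x)"
  proof -
    have lim: "(\<lambda>n. LINT x|lebesgue. \<phi> n x *\<^sub>R G x) \<longlonglongrightarrow> (LINT x|lebesgue. indicat_real {s<..t} x *\<^sub>R G x)"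
    proof (rule integral_dominated_convergence[where w = "\<lambda>x. norm (G x)"])
      have cont: "continuous_on UNIV (\<phi> n)" for n
        unfolding \<phi>_def
        by (intro continuous_intros continuous_on_compose2[OF smooth_fun_continuous[OF H(1), of UNIV]]) auto
      have "\<phi> n \<in> borel_measurable lebesgue" for n
        using borel_measurable_continuous_onI[OF cont] by (intro measurable_completion) simp
      then show "(\<lambda>x. \<phi> n x *\<^sub>R G x) \<in> borel_measurable lebesgue" for n
        using G by (intro borel_measurable_scaleR) auto
      show "(\<lambda>x. indicat_real {s<..t} x *\<^sub>R G x) \<in> borel_measurable lebesgue"
        using G by (intro borel_measurable_scaleR borel_measurable_indicator) auto
      show "integrable lebesgue (\<lambda>x. norm (G x))" using G by simp
      show "AE x in lebesgue. (\<lambda>n. \<phi> n x *\<^sub>R G x) \<longlonglongrightarrow> indicat_real {s<..t} x *\<^sub>R G x"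
      proof (intro AE_I2 tendsto_scaleR tendsto_const)
        fix x
        have ev: "\<forall>\<^sub>F n in sequentially. H (real n * (x - c)) = (if c < x then 1 else 0)" for c
        proof (cases "c < x")
          case True
          have "1 \<le> real n * (x - c)" if "nat \<lceil>1 / (x - c)\<rceil> \<le> n" for n
          proof -
            have "1 / (x - c) \<le> real n" using that by linarith
            then show ?thesis using True by (simp add: field_simps)
          qed
          then show ?thesis
            using True H(3) unfolding eventually_sequentially by (metis (full_types))
        next
          case False
          then show ?thesis using H(2) by (auto simp: mult_nonneg_nonpos)
        qed
        have "\<forall>\<^sub>F n in sequentially. \<phi> n x = indicat_real {s<..t} x"
          using ev[of s] ev[of t] by eventually_elim (use st in \<open>auto simp: \<phi>_def indicator_def\<close>)
        then show "(\<lambda>n. \<phi> n x) \<longlonglongrightarrow> indicat_real {s<..t} x"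
          by (rule tendsto_eventually)
      qed
      have "\<bar>\<phi> n x\<bar> \<le> 1" for n x
        unfolding \<phi>_def using H01[of "real n * (x - s)"] H01[of "real n * (x - t)"] by linarith
      then show "AE x in lebesgue. norm (\<phi> n x *\<^sub>R G x) \<le> norm (G x)" for n
        by (simp add: mult_left_le_one_le)
    qed
    have eq: "(LINT x|lebesgue. indicat_real {s<..t} x *\<^sub>R G x) = (LINT x:{s<..t}|lebesgue. g x)"
      unfolding set_lebesgue_integral_def G_def using r
      by (intro Bochner_Integration.integral_cong refl) (auto simp: indicator_def)
    have eq': "(LINT x|lebesgue. \<phi> n x *\<^sub>R G x) = (LINT x:{a<..<b}|lebesgue. \<phi> n x *\<^sub>R g x)"
      if n: "n0 \<le> n" for n
      unfolding set_lebesgue_integral_def G_def using zero(1)[OF n] sub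
      by (intro Bochner_Integration.integral_cong refl) (auto simp: indicator_def)
    show ?thesis
      by (rule Lim_transform_eventually[OF lim[unfolded eq] eventually_mono[OF eventually_ge_at_top[of n0]]]) (rule eq')
  qed
  have "(\<lambda>n. LINT x:{a<..<b}|lebesgue. deriv (\<phi> n) x *\<^sub>R f x) \<longlonglongrightarrow> - (LINT x:{s<..t}|lebesgue. g x)"
  proof (rule Lim_transform_eventually[OF tendsto_minus[OF rhs]])
    have "(LINT x:{a<..<b}|lebesgue. deriv (\<phi> n) x *\<^sub>R f x)
      = - (LINT x:{a<..<b}|lebesgue. \<phi> n x *\<^sub>R g x)" if "n0 \<le> n" for n
      using w test[OF that] unfolding has_weak_derivative_def by blast
    then show "\<forall>\<^sub>F n in sequentially. - (LINT x:{a<..<b}|lebesgue. \<phi> n x *\<^sub>R g x)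
       = (LINT x:{a<..<b}|lebesgue. deriv (\<phi> n) x *\<^sub>R f x)"
      by (intro eventually_mono[OF eventually_ge_at_top[of n0]]) simp
  qed
  with lhs have "f s - f t = - (LINT x:{s<..t}|lebesgue. g x)" by (rule LIMSEQ_unique)
  then have eq: "(LINT x:{s<..t}|lebesgue. g x) = f t - f s" by (simp add: algebra_simps)
  have "set_integrable lebesgue {s<..t} g"
    by (rule set_integrable_subset[OF g]) (use r in auto)
  from has_integral_set_lebesgue[OF this] have "(g has_integral f t - f s) {s<..t}"
    by (simp only: eq)
  then show ?thesis
    by (rule has_integral_spike_set_eq[THEN iffD1, rotated 2])
       (auto intro: negligible_subset[OF negligible_sing[of s]])
qed

text \<open>On each compact interval \<open>{s n..t n}\<close> of an exhaustion, \<open>f\<close> is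
  a constant plus the indefinite integral of \<open>g\<close>, and Lebesgue differentiation applies.
  The exhaustion is there because \<open>g\<close> is only locally integrable; its countably many
  exceptional sets remain negligible together.\<close>

lemma has_weak_derivative_AE_derivative:
  fixes f g :: "real \<Rightarrow> 'v::euclidean_space"
  assumes w: "has_weak_derivative f g {a<..<b}" and f: "continuous_on {a<..<b} f"
  shows "AE x in lebesgue. x \<in> {a<..<b} \<longrightarrow> (f has_vector_derivative g x) (at x)"
proof -
  define s where "s n = a + 1 / real (Suc n)" for n
  define t where "t n = b - 1 / real (Suc n)" for n
  have "\<exists>N. negligible N \<and> (\<forall>x. s n < x \<longrightarrow> x < t n \<longrightarrow> x \<notin> N \<longrightarrow> (f has_vector_derivative g x) (at x))" for n
  proof (cases "s n < t n")
    case True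
    have ab: "a < s n" "t n < b" by (simp_all add: s_def t_def)
    have "g integrable_on {s n..t n}"
      by (rule has_integral_integrable[OF has_weak_derivative_increment[OF w f ab(1) True ab(2)]])
    then obtain N where N: "negligible N" "\<And>x. s n < x \<Longrightarrow> x < t n \<Longrightarrow> x \<notin> N \<Longrightarrow>
       ((\<lambda>u. integral {s n..u} g) has_vector_derivative g x) (at x)"
      using lebesgue_differentiation by blast
    have "(f has_vector_derivative g x) (at x)" if x: "s n < x" "x < t n" "x \<notin> N" for x
    proof -
      have "((\<lambda>u. f (s n) + integral {s n..u} g) has_vector_derivative g x) (at x)"
        using has_vector_derivative_add[OF has_vector_derivative_const N(2)[OF x]] by simp
      then show ?thesis
      proof (rule has_vector_derivative_transform_within_open)
        show "open {s n<..<t n}" "x \<in> {s n<..<t n}" using x by simp_all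
        fix u assume "u \<in> {s n<..<t n}"
        then have u: "s n < u" "u < b" using ab(2) by simp_all
        have "integral {s n..u} g = f u - f (s n)"
          by (rule integral_unique[OF has_weak_derivative_increment[OF w f ab(1) u]])
        then show "f (s n) + integral {s n..u} g = f u" by (metis add.commute diff_add_cancel)
      qed
    qed
    with N(1) show ?thesis by (intro exI[of _ N]) simp
  next
    case False
    then show ?thesis by (intro exI[of _ "{}"]) auto
  qed
  then obtain N where N: "\<And>n. negligible (N n)"
    "\<And>n x. s n < x \<Longrightarrow> x < t n \<Longrightarrow> x \<notin> N n \<Longrightarrow> (f has_vector_derivative g x) (at x)"
    by metis
  have "negligible (\<Union>n. N n)" by (intro negligible_Union_nat N(1))
  moreover have "(f has_vector_derivative g x) (at x)" if x: "x \<in> {a<..<b}" "x \<notin> (\<Union>n. N n)" for x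
  proof -
    have "0 < min (x - a) (b - x)" using x(1) by simp
    then obtain n where "1 / real (Suc n) < min (x - a) (b - x)"
      using nat_approx_posE by blast
    then have "s n < x" "x < t n" by (auto simp: s_def t_def)
    with N(2) x(2) show ?thesis by blast
  qed
  ultimately show ?thesis
    unfolding eventually_ae_filter_negligible by (intro exI[of _ "\<Union>n. N n"]) auto
qed

section \<open>From almost everywhere derivatives to weak derivatives\<close>

text \<open>A common criterion for two later uses: products with a test function, where the term
  \<open>\<bar>v - u\<bar>\<close> pays for the variation of the test function, and compositions
  with a Lipschitz map.\<close>

lemma abs_continuous_on_dominated:
  fixes f :: "real \<Rightarrow> 'v::euclidean_space" and h :: "real \<Rightarrow> 'w::euclidean_space"
  assumes f: "abs_continuous_on I f" and "J \<subseteq> I" and "0 \<le> M"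
    and dom: "\<And>u v. u \<in> J \<Longrightarrow> v \<in> J \<Longrightarrow> norm (h v - h u) \<le> M * (norm (f v - f u) + \<bar>v - u\<bar>)"
  shows "abs_continuous_on J h"
  unfolding abs_continuous_on_def
proof (intro allI impI)
  fix \<epsilon> :: real assume "0 < \<epsilon>"
  define \<eta> where "\<eta> = \<epsilon> / (2 * (M + 1))"
  have \<eta>: "0 < \<eta>" using \<open>0 < \<epsilon>\<close> \<open>0 \<le> M\<close> by (simp add: \<eta>_def)
  obtain \<delta> where \<delta>: "0 < \<delta>" "\<And>D :: (real \<times> real) set.
        finite D \<and> (\<forall>(s, t)\<in>D. s \<le> t \<and> {s..t} \<subseteq> I) \<and>
        pairwise (\<lambda>(s, t) (s', t'). {s<..<t} \<inter> {s'<..<t'} = {}) D \<and>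
        (\<Sum>(s, t)\<in>D. t - s) < \<delta>
        \<Longrightarrow> (\<Sum>(s, t)\<in>D. norm (f t - f s)) < \<eta>"
    using f \<eta> unfolding abs_continuous_on_def by meson
  show "\<exists>\<delta>>0. \<forall>D :: (real \<times> real) set.
        finite D \<and> (\<forall>(s, t)\<in>D. s \<le> t \<and> {s..t} \<subseteq> J) \<and>
        pairwise (\<lambda>(s, t) (s', t'). {s<..<t} \<inter> {s'<..<t'} = {}) D \<and>
        (\<Sum>(s, t)\<in>D. t - s) < \<delta>
        \<longrightarrow> (\<Sum>(s, t)\<in>D. norm (h t - h s)) < \<epsilon>"
  \<comment> \<open>The total length must also be below \<open>\<eta>\<close>, to absorb the terms
    \<open>\<bar>v - u\<bar>\<close>.\<close>
  proof (intro exI[of _ "min \<delta> \<eta>"] conjI allI impI)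
    show "0 < min \<delta> \<eta>" using \<delta>(1) \<eta> by simp
    fix D :: "(real \<times> real) set"
    assume D: "finite D \<and> (\<forall>(s, t)\<in>D. s \<le> t \<and> {s..t} \<subseteq> J) \<and>
        pairwise (\<lambda>(s, t) (s', t'). {s<..<t} \<inter> {s'<..<t'} = {}) D \<and>
        (\<Sum>(s, t)\<in>D. t - s) < min \<delta> \<eta>"
    then have D1: "(\<Sum>(s, t)\<in>D. norm (f t - f s)) < \<eta>"
      using \<open>J \<subseteq> I\<close> by (intro \<delta>(2)) fastforce
    have "(\<Sum>(s, t)\<in>D. norm (h t - h s)) \<le> (\<Sum>(s, t)\<in>D. M * (norm (f t - f s) + (t - s)))"
    proof (rule sum_mono)
      fix z assume z: "z \<in> D"
      obtain s t where st: "z = (s, t)" by fastforce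
      with z D have "s \<le> t" "{s..t} \<subseteq> J" by blast+
      then have "s \<in> J" "t \<in> J" "\<bar>t - s\<bar> = t - s" by auto
      with dom[of s t] show "(case z of (s, t) \<Rightarrow> norm (h t - h s)) \<le> (case z of (s, t) \<Rightarrow> M * (norm (f t - f s) + (t - s)))"
        by (simp add: st)
    qed
    also have "\<dots> = M * ((\<Sum>(s, t)\<in>D. norm (f t - f s)) + (\<Sum>(s, t)\<in>D. t - s))"
      by (simp add: sum_distrib_left sum.distrib case_prod_unfold distrib_left)
    also have "\<dots> \<le> M * (\<eta> + \<eta>)"
      using D1 D \<open>0 \<le> M\<close> by (intro mult_left_mono) auto
    also have "\<dots> < \<epsilon>"
    proof -
      have "M * (\<eta> + \<eta>) < (M + 1) * (\<eta> + \<eta>)" using \<eta> by simp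
      also have "\<dots> = \<epsilon>"
      proof -
        have "2 * (M + 1) \<noteq> 0" using \<open>0 \<le> M\<close> by simp
        then have "\<eta> * (2 * (M + 1)) = \<epsilon>" unfolding \<eta>_def by simp
        then show ?thesis by (simp add: algebra_simps)
      qed
      finally show ?thesis .
    qed
    finally show "(\<Sum>(s, t)\<in>D. norm (h t - h s)) < \<epsilon>" .
  qed
qed

lemma abs_continuous_on_imp_continuous_on:
  fixes f :: "real \<Rightarrow> 'v::euclidean_space"
  assumes f: "abs_continuous_on {a<..<b} f"
  shows "continuous_on {a<..<b} f"
  unfolding continuous_on_iff
proof (intro ballI allI impI)
  fix x \<epsilon> :: real assume x: "x \<in> {a<..<b}" and "0 < \<epsilon>"
  obtain \<delta> where \<delta>: "0 < \<delta>" "\<And>D :: (real \<times> real) set.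
        finite D \<and> (\<forall>(s, t)\<in>D. s \<le> t \<and> {s..t} \<subseteq> {a<..<b}) \<and>
        pairwise (\<lambda>(s, t) (s', t'). {s<..<t} \<inter> {s'<..<t'} = {}) D \<and>
        (\<Sum>(s, t)\<in>D. t - s) < \<delta>
        \<Longrightarrow> (\<Sum>(s, t)\<in>D. norm (f t - f s)) < \<epsilon>"
    using f \<open>0 < \<epsilon>\<close> unfolding abs_continuous_on_def by meson
  have "dist (f y) (f x) < \<epsilon>" if y: "y \<in> {a<..<b}" "dist y x < \<delta>" for y
  proof -
    have "{u..v} \<subseteq> {a<..<b}" if "u \<in> {a<..<b}" "v \<in> {a<..<b}" for u v
      using that by auto
    then show ?thesis
      using \<delta>(2)[of "{(min x y, max x y)}"] x y
      by (cases "x \<le> y") (auto simp: dist_norm norm_minus_commute min_def max_def)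
  qed
  with \<delta>(1) show "\<exists>d>0. \<forall>x'\<in>{a<..<b}. dist x' x < d \<longrightarrow> dist (f x') (f x) < \<epsilon>" by blast
qed

lemma compact_subset_open_interval:
  fixes K :: "real set"
  assumes "compact K" "K \<subseteq> {a<..<b}" "a < b"
  obtains s t where "a < s" "s < t" "t < b" "K \<subseteq> {s<..<t}"
proof (cases "K = {}")
  case True
  then show ?thesis using that[of "(2 * a + b) / 3" "(a + 2 * b) / 3"] assms(3) by auto
next
  case False
  obtain l u where lu: "l \<in> K" "\<And>x. x \<in> K \<Longrightarrow> l \<le> x" "u \<in> K" "\<And>x. x \<in> K \<Longrightarrow> x \<le> u"
    using compact_attains_inf[OF assms(1) False] compact_attains_sup[OF assms(1) False] by blast
  then have "a < l" "l \<le> u" "u < b" using assms(2) by auto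
  then show ?thesis
    using lu(2,4) by (intro that[of "(a + l) / 2" "(u + b) / 2"]) (auto simp: field_simps, force+)
qed

lemma continuous_on_imp_locally_integrable:
  fixes f :: "real \<Rightarrow> 'v::euclidean_space"
  assumes "continuous_on {a<..<b} f" "a < b"
  shows "locally_integrable {a<..<b} f"
  unfolding locally_integrable_def
proof (intro allI impI, elim conjE)
  fix K :: "real set" assume K: "compact K" "K \<subseteq> {a<..<b}"
  obtain s t where st: "a < s" "s < t" "t < b" "K \<subseteq> {s<..<t}"
    using compact_subset_open_interval[OF K assms(2)] .
  have "set_integrable lebesgue {s..t} f"
    by (intro absolutely_integrable_continuous_real continuous_on_subset[OF assms(1)]) (use st in auto)
  then show "set_integrable lebesgue K f"
    by (rule set_integrable_subset) (use st(4) K lmeasurable_compact in \<open>auto simp: fmeasurableD\<close>)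
qed

text \<open>Integration by parts: the product of \<open>\<phi>\<close> and \<open>f\<close> is
  absolutely continuous on a compact interval whose interior contains the support of
  \<open>\<phi>\<close>. It vanishes at both end points, so the integral of its almost everywhere
  derivative is 0.\<close>

lemma AE_derivative_has_weak_derivative:
  fixes f g :: "real \<Rightarrow> 'v::euclidean_space"
  assumes f: "abs_continuous_on {a<..<b} f" and "a < b" and g: "locally_integrable {a<..<b} g"
    and D: "AE x in lebesgue. x \<in> {a<..<b} \<longrightarrow> (f has_vector_derivative g x) (at x)"
  shows "has_weak_derivative f g {a<..<b}"
  unfolding has_weak_derivative_def
proof (intro conjI allI impI g)
  have cont: "continuous_on {a<..<b} f" by (rule abs_continuous_on_imp_continuous_on[OF f])
  then show "locally_integrable {a<..<b} f"
    using \<open>a < b\<close> by (rule continuous_on_imp_locally_integrable)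
  obtain N where N: "negligible N" "\<And>x. x \<in> {a<..<b} \<Longrightarrow> x \<notin> N \<Longrightarrow> (f has_vector_derivative g x) (at x)"
    using D unfolding eventually_ae_filter_negligible by blast
  fix \<phi> assume test: "test_function {a<..<b} \<phi>"
  have d\<phi>: "(\<phi> has_real_derivative deriv \<phi> x) (at x)" for x
  proof -
    have "(deriv ^^ 0) \<phi> field_differentiable at x" using test unfolding test_function_def by blast
    then show ?thesis by (simp add: DERIV_deriv_iff_field_differentiable)
  qed
  have d2: "deriv \<phi> field_differentiable at x" for x
  proof -
    have "(deriv ^^ 1) \<phi> field_differentiable at x" using test unfolding test_function_def by blast
    then show ?thesis by simp
  qed
  have c2: "continuous_on S (deriv \<phi>)" for S
    by (intro continuous_at_imp_continuous_on ballI field_differentiable_imp_continuous_at[OF d2])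
  have c1: "continuous_on S \<phi>" for S
    by (intro continuous_at_imp_continuous_on ballI DERIV_isCont[OF d\<phi>])
  define S where "S = closure {x. \<phi> x \<noteq> 0}"
  have S: "compact S" "S \<subseteq> {a<..<b}" using test by (simp_all add: test_function_def S_def)
  have zero: "\<phi> x = 0" "deriv \<phi> x = 0" if "x \<notin> S" for x
  proof -
    show "\<phi> x = 0" using that closure_subset[of "{x. \<phi> x \<noteq> 0}"] by (auto simp: S_def)
    have "\<forall>\<^sub>F y in nhds x. \<phi> y = 0"
    proof (rule eventually_mono)
      show "\<forall>\<^sub>F y in nhds x. y \<in> - S"
        using that by (intro eventually_nhds_in_open) (auto simp: S_def)
      show "\<phi> y = 0" if "y \<in> - S" for y
        using that closure_subset[of "{x. \<phi> x \<noteq> 0}"] by (auto simp: S_def)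
    qed
    then have "(\<phi> has_real_derivative 0) (at x)"
      by (subst DERIV_cong_ev[OF refl _ refl, of _ "\<lambda>_. 0"]) auto
    then show "deriv \<phi> x = 0" by (rule DERIV_imp_deriv)
  qed
  obtain s t where st: "a < s" "s < t" "t < b" "S \<subseteq> {s<..<t}"
    using compact_subset_open_interval[OF S \<open>a < b\<close>] .
  have sub: "{s..t} \<subseteq> {a<..<b}" using st by auto
  have fc: "continuous_on {s..t} f" by (rule continuous_on_subset[OF cont sub])
  obtain M1 where pos1: "0 \<le> M1" and M1: "\<And>x. x \<in> {s..t} \<Longrightarrow> norm (f x) \<le> M1"
    using continuous_on_compact_bound[OF compact_Icc fc] by (auto simp flip: real_norm_def)
  obtain M2 where pos2: "0 \<le> M2" and M2: "\<And>x. x \<in> {s..t} \<Longrightarrow> \<bar>\<phi> x\<bar> \<le> M2"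
    using continuous_on_compact_bound[OF compact_Icc c1[of "{s..t}"]] by (auto simp flip: real_norm_def)
  obtain M3 where pos3: "0 \<le> M3" and M3: "\<And>x. x \<in> {s..t} \<Longrightarrow> \<bar>deriv \<phi> x\<bar> \<le> M3"
    using continuous_on_compact_bound[OF compact_Icc c2[of "{s..t}"]] by (auto simp flip: real_norm_def)
  note pos = pos1 pos2 pos3
  define h where "h x = \<phi> x *\<^sub>R f x" for x
  have "abs_continuous_on {s..t} h"
  proof (rule abs_continuous_on_dominated[OF f sub, of "M2 + M3 * M1"])
    show "0 \<le> M2 + M3 * M1" using pos by simp
    fix u v assume uv: "u \<in> {s..t}" "v \<in> {s..t}"
    have lip: "\<bar>\<phi> v - \<phi> u\<bar> \<le> M3 * \<bar>v - u\<bar>"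
      using field_differentiable_bound[of "{s..t}" \<phi> "deriv \<phi>" M3 v u] uv M3
        has_field_derivative_at_within[OF d\<phi>] by (simp add: real_norm_def)
    have "h v - h u = \<phi> v *\<^sub>R (f v - f u) + (\<phi> v - \<phi> u) *\<^sub>R f u"
      by (simp add: h_def algebra_simps)
    also have "norm \<dots> \<le> \<bar>\<phi> v\<bar> * norm (f v - f u) + \<bar>\<phi> v - \<phi> u\<bar> * norm (f u)"
      by (rule order_trans[OF norm_triangle_ineq]) simp
    also have "\<dots> \<le> M2 * norm (f v - f u) + (M3 * \<bar>v - u\<bar>) * M1"
      using M1[OF uv(1)] M2[OF uv(2)] lip pos
      by (intro add_mono mult_mono) auto
    also have "\<dots> \<le> (M2 + M3 * M1) * (norm (f v - f u) + \<bar>v - u\<bar>)"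
      using pos by (simp add: algebra_simps)
    finally show "norm (h v - h u) \<le> (M2 + M3 * M1) * (norm (f v - f u) + \<bar>v - u\<bar>)" .
  qed
  then have "((\<lambda>x. \<phi> x *\<^sub>R g x + deriv \<phi> x *\<^sub>R f x) has_integral h t - h s) {s..t}"
  proof (rule abs_continuous_on_has_integral[OF _ order_refl less_imp_le[OF st(2)] N(1)])
    fix x assume x: "x \<in> {s..t} - N"
    have "(h has_vector_derivative \<phi> x *\<^sub>R g x + deriv \<phi> x *\<^sub>R f x) (at x)"
      unfolding h_def using x sub
      by (intro has_vector_derivative_scaleR d\<phi> N(2)) auto
    then show "(h has_vector_derivative \<phi> x *\<^sub>R g x + deriv \<phi> x *\<^sub>R f x) (at x within {s..t})"
      by (rule has_vector_derivative_at_within)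
  qed
  moreover have "h s = 0" "h t = 0"
  proof -
    have "s \<notin> S" "t \<notin> S" using st(4) by auto
    then show "h s = 0" "h t = 0" by (simp_all add: h_def zero)
  qed
  ultimately have sum0: "integral {s..t} (\<lambda>x. \<phi> x *\<^sub>R g x + deriv \<phi> x *\<^sub>R f x) = 0"
    by (simp add: integral_unique)
  have i1: "(\<lambda>x. deriv \<phi> x *\<^sub>R f x) absolutely_integrable_on {s..t}"
    by (intro absolutely_integrable_continuous_real continuous_intros c2 fc)
  have i2: "(\<lambda>x. \<phi> x *\<^sub>R g x) absolutely_integrable_on {s..t}"
  proof (rule absolutely_integrable_bounded_measurable_product[of "(*\<^sub>R)"])
    show "bilinear ((*\<^sub>R) :: real \<Rightarrow> 'v \<Rightarrow> 'v)"
      by (simp add: bilinear_conv_bounded_bilinear bounded_bilinear_scaleR)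
    show "\<phi> \<in> borel_measurable (lebesgue_on {s..t})"
      by (intro continuous_imp_measurable_on_sets_lebesgue c1) simp
    show "bounded (\<phi> ` {s..t})" by (auto simp: bounded_iff intro!: exI[of _ M2] M2)
    show "g absolutely_integrable_on {s..t}"
      using g[unfolded locally_integrable_def, rule_format, of "{s..t}"] sub by simp
    show "{s..t} \<in> sets lebesgue" by simp
  qed
  have outside: "indicat_real {a<..<b} x *\<^sub>R (\<psi> x *\<^sub>R u x) = indicat_real {s..t} x *\<^sub>R (\<psi> x *\<^sub>R u x)"
    if "\<And>x. x \<notin> S \<Longrightarrow> \<psi> x = 0" for \<psi> x and u :: "real \<Rightarrow> 'v"
  proof (cases "x \<in> {s..t}")
    case True
    then have "x \<in> {a<..<b}" using sub by blast
    then show ?thesis using True by simp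
  next
    case False
    then have "x \<notin> S" using st(4) by auto
    then show ?thesis by (simp add: that)
  qed
  have e1: "(LINT x:{a<..<b}|lebesgue. deriv \<phi> x *\<^sub>R f x) = (LINT x:{s..t}|lebesgue. deriv \<phi> x *\<^sub>R f x)"
    unfolding set_lebesgue_integral_def
    by (rule Bochner_Integration.integral_cong[OF refl]) (rule outside[OF zero(2)])
  have e2: "(LINT x:{a<..<b}|lebesgue. \<phi> x *\<^sub>R g x) = (LINT x:{s..t}|lebesgue. \<phi> x *\<^sub>R g x)"
    unfolding set_lebesgue_integral_def
    by (rule Bochner_Integration.integral_cong[OF refl]) (rule outside[OF zero(1)])
  have "(LINT x:{s..t}|lebesgue. \<phi> x *\<^sub>R g x) + (LINT x:{s..t}|lebesgue. deriv \<phi> x *\<^sub>R f x)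
      = (LINT x:{s..t}|lebesgue. \<phi> x *\<^sub>R g x + deriv \<phi> x *\<^sub>R f x)"
    by (rule set_integral_add(2)[OF i2 i1, symmetric])
  also have "\<dots> = 0"
    unfolding set_lebesgue_integral_eq_integral(2)[OF set_integral_add(1)[OF i2 i1]] by (rule sum0)
  finally have "(LINT x:{s..t}|lebesgue. deriv \<phi> x *\<^sub>R f x) = - (LINT x:{s..t}|lebesgue. \<phi> x *\<^sub>R g x)"
    unfolding add_eq_0_iff .
  then show "(LINT x:{a<..<b}|lebesgue. deriv \<phi> x *\<^sub>R f x) = - (LINT x:{a<..<b}|lebesgue. \<phi> x *\<^sub>R g x)"
    unfolding e1 e2 .
qed

section \<open>Convergence in Lebesgue spaces\<close>

text \<open>The power of order \<open>q\<close> of \<open>Lq_norm\<close>. Dominated convergence and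
  pointwise domination apply to this plain integral; the root is taken only when returning to
  Sobolev norms.\<close>

definition Lq_mass :: "real \<Rightarrow> real set \<Rightarrow> (real \<Rightarrow> 'v::euclidean_space) \<Rightarrow> real" where
  "Lq_mass q I f = (LINT x:I|lebesgue. norm (f x) powr q)"

lemma Lq_norm_eq_mass: "Lq_norm q I f = Lq_mass q I f powr (1 / q)"
  by (simp add: Lq_norm_def Lq_mass_def)

lemma norm_powr_measurable:
  fixes F :: "'a \<Rightarrow> 'v::euclidean_space"
  assumes "F \<in> borel_measurable M"
  shows "(\<lambda>x. norm (F x) powr q) \<in> borel_measurable M"
  using assms by measurable

lemma integrable_indicator_Ioo: "integrable lebesgue (indicat_real {a<..<b::real})"
  using emeasure_bounded_finite[of "{a<..<b}"] by (intro integrable_real_indicator) auto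

text \<open>Rests on the convention \<open>0 powr q = 0\<close>, by which both sides vanish off
  \<open>I\<close>. It turns statements over \<open>I\<close> into statements about one function on
  the whole line.\<close>

lemma norm_powr_indicator:
  "indicat_real I x *\<^sub>R norm (f x) powr q = norm (indicat_real I x *\<^sub>R f x) powr q"
  by (simp add: indicator_def)

lemma Lq_space_iff:
  "f \<in> Lq_space q I \<longleftrightarrow> (\<lambda>x. indicat_real I x *\<^sub>R f x) \<in> borel_measurable lebesgue \<and>
     integrable lebesgue (\<lambda>x. norm (indicat_real I x *\<^sub>R f x) powr q)"
  by (simp add: Lq_space_def set_borel_measurable_def set_integrable_def norm_powr_indicator
      del: real_scaleR_def)

lemma Lq_mass_eq: "Lq_mass q I f = (LINT x|lebesgue. norm (indicat_real I x *\<^sub>R f x) powr q)"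
  by (simp add: Lq_mass_def set_lebesgue_integral_def norm_powr_indicator del: real_scaleR_def)

lemma Lq_mass_nonneg: "0 \<le> Lq_mass q I f"
  unfolding Lq_mass_eq by (rule Bochner_Integration.integral_nonneg) simp

lemma Lq_space_bound:
  fixes h :: "real \<Rightarrow> 'w::euclidean_space"
  assumes k: "integrable lebesgue k"
    and h: "(\<lambda>x. indicat_real I x *\<^sub>R h x) \<in> borel_measurable lebesgue"
    and le: "AE x in lebesgue. norm (indicat_real I x *\<^sub>R h x) powr q \<le> k x"
  shows "h \<in> Lq_space q I"
proof -
  have "integrable lebesgue (\<lambda>x. norm (indicat_real I x *\<^sub>R h x) powr q)"
  proof (rule Bochner_Integration.integrable_bound[OF k norm_powr_measurable[OF h]])
    show "AE x in lebesgue. norm (norm (indicat_real I x *\<^sub>R h x) powr q) \<le> norm (k x)"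
      using le
    proof eventually_elim
      case (elim x)
      then have "norm (indicat_real I x *\<^sub>R h x) powr q \<le> \<bar>k x\<bar>" by linarith
      then show ?case unfolding real_norm_def[of "_ powr _"] real_norm_def[of "k x"] by simp
    qed
  qed
  with h show ?thesis by (simp add: Lq_space_iff)
qed

lemma Lq_space_dominated:
  fixes f :: "real \<Rightarrow> 'v::euclidean_space" and h :: "real \<Rightarrow> 'w::euclidean_space"
  assumes "0 \<le> q" "0 \<le> L" and f: "f \<in> Lq_space q I"
    and h: "(\<lambda>x. indicat_real I x *\<^sub>R h x) \<in> borel_measurable lebesgue"
    and le: "AE x in lebesgue. x \<in> I \<longrightarrow> norm (h x) \<le> L * norm (f x)"
  shows "h \<in> Lq_space q I"
proof (rule Lq_space_bound[OF _ h])
  show "integrable lebesgue (\<lambda>x. L powr q * norm (indicat_real I x *\<^sub>R f x) powr q)"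
    using f by (simp add: Lq_space_iff)
  show "AE x in lebesgue. norm (indicat_real I x *\<^sub>R h x) powr q \<le> L powr q * norm (indicat_real I x *\<^sub>R f x) powr q"
    using le
  proof eventually_elim
    case (elim x)
    then have "norm (indicat_real I x *\<^sub>R h x) \<le> L * norm (indicat_real I x *\<^sub>R f x)"
      by (simp add: indicator_def)
    then show ?case
      using assms(1,2) by (simp add: powr_mono2 flip: powr_mult)
  qed
qed

text \<open>The sum is at most twice the maximum. The crude factor \<open>2 powr q\<close> is good
  enough, since the inequality serves only to produce integrable majorants.\<close>

lemma powr_add_le:
  fixes x y :: real
  assumes "0 \<le> x" "0 \<le> y" "0 \<le> q"
  shows "(x + y) powr q \<le> 2 powr q * (x powr q + y powr q)"
proof -
  have "(x + y) powr q \<le> (2 * max x y) powr q"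
    using assms by (intro powr_mono2) auto
  also have "\<dots> = 2 powr q * max x y powr q"
    using assms by (simp add: powr_mult)
  also have "max x y powr q \<le> x powr q + y powr q"
    by (simp add: max_def)
  finally show ?thesis by simp
qed

lemma norm_diff_powr_le:
  assumes "0 \<le> q"
  shows "norm (x - y) powr q \<le> 2 powr q * (norm x powr q + norm y powr q)"
proof -
  have "norm (x - y) powr q \<le> (norm x + norm y) powr q"
    using assms by (intro powr_mono2 norm_triangle_ineq4) auto
  also have "\<dots> \<le> 2 powr q * (norm x powr q + norm y powr q)"
    using assms by (intro powr_add_le) auto
  finally show ?thesis .
qed

lemma Lq_space_diff:
  fixes f g :: "real \<Rightarrow> 'v::euclidean_space"
  assumes "0 \<le> q" "f \<in> Lq_space q I" "g \<in> Lq_space q I"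
  shows "(\<lambda>x. f x - g x) \<in> Lq_space q I"
proof (rule Lq_space_bound)
  show "integrable lebesgue (\<lambda>x. 2 powr q * (norm (indicat_real I x *\<^sub>R f x) powr q + norm (indicat_real I x *\<^sub>R g x) powr q))"
    using assms by (intro integrable_mult_right Bochner_Integration.integrable_add) (auto simp: Lq_space_iff)
  show "(\<lambda>x. indicat_real I x *\<^sub>R (f x - g x)) \<in> borel_measurable lebesgue"
    unfolding scaleR_diff_right using assms by (intro borel_measurable_diff) (auto simp: Lq_space_iff)
  show "AE x in lebesgue. norm (indicat_real I x *\<^sub>R (f x - g x)) powr q
     \<le> 2 powr q * (norm (indicat_real I x *\<^sub>R f x) powr q + norm (indicat_real I x *\<^sub>R g x) powr q)"
    unfolding scaleR_diff_right by (intro AE_I2 norm_diff_powr_le assms)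
qed

lemma Lq_space_cong_AE:
  fixes f g :: "real \<Rightarrow> 'v::euclidean_space"
  assumes f: "f \<in> Lq_space q I" and ae: "AE x in lebesgue. x \<in> I \<longrightarrow> g x = f x"
  shows "g \<in> Lq_space q I" "Lq_mass q I g = Lq_mass q I f"
proof -
  have ae': "AE x in lebesgue. indicat_real I x *\<^sub>R f x = indicat_real I x *\<^sub>R g x"
    using ae by eventually_elim (auto simp: indicator_def)
  have fm: "(\<lambda>x. indicat_real I x *\<^sub>R f x) \<in> borel_measurable lebesgue"
    using f by (simp add: Lq_space_iff)
  have gm: "(\<lambda>x. indicat_real I x *\<^sub>R g x) \<in> borel_measurable lebesgue"
    by (rule borel_measurable_AE[OF fm ae'])
  have ae'': "AE x in lebesgue. norm (indicat_real I x *\<^sub>R g x) powr q = norm (indicat_real I x *\<^sub>R f x) powr q"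
    using ae' by eventually_elim (simp only:)
  then have "AE x in lebesgue. norm (indicat_real I x *\<^sub>R g x) powr q \<le> norm (indicat_real I x *\<^sub>R f x) powr q"
    by eventually_elim (simp only: order_refl)
  with f gm show "g \<in> Lq_space q I"
    unfolding Lq_space_iff[of f] by (elim conjE) (rule Lq_space_bound)
  show "Lq_mass q I g = Lq_mass q I f"
    unfolding Lq_mass_eq
    by (rule integral_cong_AE[OF norm_powr_measurable[OF gm] norm_powr_measurable[OF fm] ae''])
qed

text \<open>Either \<open>y \<le> \<eta>\<close>, or
  \<open>y powr (1 - q) \<le> \<eta> powr (1 - q)\<close> because the exponent is nonpositive.
  Integrated over a bounded interval, this takes the place of Hoelder's inequality.\<close>

lemma le_powr_weighted:
  fixes y :: real
  assumes "1 \<le> q" "0 < \<eta>" "0 \<le> y"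
  shows "y \<le> \<eta> + \<eta> powr (1 - q) * y powr q"
proof (cases "y \<le> \<eta>")
  case True
  then show ?thesis by (simp add: add_increasing2)
next
  case False
  then have "y powr (1 - q) \<le> \<eta> powr (1 - q)"
    using assms by (intro powr_mono2') auto
  then have "y powr (1 - q) * y powr q \<le> \<eta> powr (1 - q) * y powr q"
    by (rule mult_right_mono) simp
  then have "y \<le> \<eta> powr (1 - q) * y powr q"
    using False assms by (simp flip: powr_add)
  then show ?thesis using assms by simp
qed

text \<open>The free parameter \<open>\<eta>\<close> is what makes the second bound useful:
  \<open>\<eta>\<close> is fixed first so that \<open>\<eta> * (b - a)\<close> is small, and then
  the mass is made small relative to it.\<close>

lemma Lq_space_imp_integrable:
  fixes g :: "real \<Rightarrow> 'v::euclidean_space"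
  assumes q: "1 \<le> q" and g: "g \<in> Lq_space q {a<..<b}" and "a < b"
  shows "set_integrable lebesgue {a<..<b} g"
    and "0 < \<eta> \<Longrightarrow> (LINT x:{a<..<b}|lebesgue. norm (g x)) \<le> \<eta> * (b - a) + \<eta> powr (1 - q) * Lq_mass q {a<..<b} g"
proof -
  let ?I = "{a<..<b}"
  let ?G = "\<lambda>x. indicat_real ?I x *\<^sub>R g x"
  have G: "?G \<in> borel_measurable lebesgue" "integrable lebesgue (\<lambda>x. norm (?G x) powr q)"
    using g by (simp_all add: Lq_space_iff)
  have ind: "integrable lebesgue (indicat_real ?I)"
    by (rule integrable_indicator_Ioo)
  have bnd: "norm (?G x) \<le> \<eta> * indicat_real ?I x + \<eta> powr (1 - q) * norm (?G x) powr q" if "0 < \<eta>" for \<eta> x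
    using le_powr_weighted[OF q that, of "norm (g x)"] by (simp add: indicator_def)
  have int: "integrable lebesgue (\<lambda>x. \<eta> * indicat_real ?I x + \<eta> powr (1 - q) * norm (?G x) powr q)" for \<eta>
    by (intro Bochner_Integration.integrable_add integrable_mult_right ind G)
  have "integrable lebesgue ?G"
  proof (rule Bochner_Integration.integrable_bound[OF int[of 1] G(1)], rule AE_I2)
    fix x show "norm (?G x) \<le> norm (1 * indicat_real ?I x + 1 powr (1 - q) * norm (?G x) powr q)"
      by (rule order_trans[OF bnd[OF zero_less_one]]) (simp only: real_norm_def abs_ge_self)
  qed
  then show "set_integrable lebesgue ?I g" by (simp add: set_integrable_def)
  show "(LINT x:?I|lebesgue. norm (g x)) \<le> \<eta> * (b - a) + \<eta> powr (1 - q) * Lq_mass q ?I g" if "0 < \<eta>"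
  proof -
    have "(LINT x:?I|lebesgue. norm (g x)) = (LINT x|lebesgue. norm (?G x))"
      unfolding set_lebesgue_integral_def
      by (intro Bochner_Integration.integral_cong refl) (simp add: indicator_def)
    also have "\<dots> \<le> (LINT x|lebesgue. \<eta> * indicat_real ?I x + \<eta> powr (1 - q) * norm (?G x) powr q)"
      by (intro integral_mono int integrable_norm \<open>integrable lebesgue ?G\<close> bnd that)
    also have "\<dots> = (LINT x|lebesgue. \<eta> * indicat_real ?I x) + (LINT x|lebesgue. \<eta> powr (1 - q) * norm (?G x) powr q)"
      by (intro Bochner_Integration.integral_add integrable_mult_right ind G)
    also have "(LINT x|lebesgue. \<eta> * indicat_real ?I x) = \<eta> * (b - a)"
      using \<open>a < b\<close> by simp
    also have "(LINT x|lebesgue. \<eta> powr (1 - q) * norm (?G x) powr q) = \<eta> powr (1 - q) * Lq_mass q ?I g"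
      by (simp add: Lq_mass_eq)
    finally show ?thesis .
  qed
qed

text \<open>Quantitative smallness of the \<open>q\<close>-masses makes the convergence fast enough to hold almost
  everywhere with an integrable majorant, so that no subsequence is needed.\<close>

lemma Lq_fast_convergence:
  fixes g :: "nat \<Rightarrow> real \<Rightarrow> 'v::euclidean_space"
  assumes q: "1 \<le> q" and g: "\<And>n. g n \<in> Lq_space q I" "g0 \<in> Lq_space q I"
    and fast: "\<And>n. Lq_mass q I (\<lambda>x. g n x - g0 x) \<le> (1 / 2) ^ n"
  obtains S where "integrable lebesgue S"
    "AE x in lebesgue. x \<in> I \<longrightarrow> (\<lambda>n. g n x) \<longlonglongrightarrow> g0 x"
    "AE x in lebesgue. x \<in> I \<longrightarrow> (\<forall>n. norm (g n x - g0 x) powr q \<le> S x)"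
proof -
  define u where "u n x = norm (indicat_real I x *\<^sub>R (g n x - g0 x)) powr q" for n x
  have u: "integrable lebesgue (u n)" for n
    using Lq_space_diff[OF _ g(1) g(2)] q unfolding Lq_space_iff u_def[abs_def] by simp
  have u0: "0 \<le> u n x" for n x by (simp add: u_def)
  have mass: "(LINT x|lebesgue. u n x) \<le> (1 / 2) ^ n" for n
    using fast[of n] by (simp add: Lq_mass_eq u_def)
  have sum_half: "summable (\<lambda>n. (1 / 2 :: real) ^ n)"
    by (rule summable_geometric) simp
  \<comment> \<open>Termwise integration bounds the integral of the series by a geometric sum, so
    the series is finite almost everywhere. Its terms then tend to 0, and its sum dominates each of
    them.\<close>
  have summ: "AE x in lebesgue. summable (\<lambda>n. u n x)"
  proof -
    have "(\<integral>\<^sup>+x. (\<Sum>n. ennreal (u n x)) \<partial>lebesgue) = (\<Sum>n. \<integral>\<^sup>+x. ennreal (u n x) \<partial>lebesgue)"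
      using u by (intro nn_integral_suminf) auto
    also have "\<dots> = (\<Sum>n. ennreal (LINT x|lebesgue. u n x))"
      by (intro suminf_cong nn_integral_eq_integral u AE_I2 u0)
    also have "\<dots> \<le> (\<Sum>n. ennreal ((1 / 2) ^ n))"
      by (intro suminf_le ennreal_leI mass summableI)
    also have "\<dots> = ennreal (\<Sum>n. (1 / 2) ^ n)"
      by (intro suminf_ennreal2 sum_half) simp
    also have "\<dots> < \<infinity>" by simp
    finally have fin: "(\<integral>\<^sup>+x. (\<Sum>n. ennreal (u n x)) \<partial>lebesgue) \<noteq> \<infinity>" by simp
    have "AE x in lebesgue. (\<Sum>n. ennreal (u n x)) \<noteq> \<infinity>"
      using u by (intro nn_integral_PInf_AE fin borel_measurable_suminf_order) auto
    then show ?thesis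
      by eventually_elim (intro summable_suminf_not_top u0, simp)
  qed
  show ?thesis
  proof (rule that[of "\<lambda>x. \<Sum>n. u n x"])
    show "integrable lebesgue (\<lambda>x. \<Sum>n. u n x)"
    proof (rule integrable_suminf[OF u])
      show "AE x in lebesgue. summable (\<lambda>n. norm (u n x))"
        using summ by (simp add: u0)
      show "summable (\<lambda>n. LINT x|lebesgue. norm (u n x))"
        by (rule summable_comparison_test'[OF sum_half, of 0]) (use mass u0 in simp)
    qed
    show "AE x in lebesgue. x \<in> I \<longrightarrow> (\<lambda>n. g n x) \<longlonglongrightarrow> g0 x"
      using summ
    proof (eventually_elim, intro impI)
      fix x assume s: "summable (\<lambda>n. u n x)" and "x \<in> I"
      have "(\<lambda>n. u n x powr (1 / q)) \<longlonglongrightarrow> 0"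
        by (rule tendsto_zero_powrI[OF summable_LIMSEQ_zero[OF s] tendsto_const]) (use q u0 in auto)
      moreover have "u n x powr (1 / q) = norm (g n x - g0 x)" for n
        using q \<open>x \<in> I\<close> by (simp add: u_def powr_powr)
      ultimately show "(\<lambda>n. g n x) \<longlonglongrightarrow> g0 x"
        by (simp add: tendsto_norm_zero_iff LIM_zero_iff)
    qed
    show "AE x in lebesgue. x \<in> I \<longrightarrow> (\<forall>n. norm (g n x - g0 x) powr q \<le> (\<Sum>n. u n x))"
      using summ
    proof (eventually_elim, intro impI allI)
      fix x n assume s: "summable (\<lambda>n. u n x)" and "x \<in> I"
      have "u n x \<le> (\<Sum>n. u n x)"
        using sum_le_suminf[OF s, of "{n}"] u0 by simp
      then show "norm (g n x - g0 x) powr q \<le> (\<Sum>n. u n x)"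
        using \<open>x \<in> I\<close> by (simp add: u_def)
    qed
  qed
qed

text \<open>Fast convergence supplies the almost everywhere limit of \<open>g n\<close> as well as
  an integrable majorant for the differences of the \<open>c n\<close>. The assumption
  \<open>lim\<close> is conditional on convergence of \<open>g n x\<close>, so that it asks only for
  a closedness property at a single point.\<close>

lemma Lq_dominated_convergence:
  fixes g :: "nat \<Rightarrow> real \<Rightarrow> 'v::euclidean_space" and c :: "nat \<Rightarrow> real \<Rightarrow> 'w::euclidean_space"
  assumes q: "1 \<le> q" and "0 \<le> L" and g: "\<And>n. g n \<in> Lq_space q I" "g0 \<in> Lq_space q I"
    and fast: "\<And>n. Lq_mass q I (\<lambda>x. g n x - g0 x) \<le> (1 / 2) ^ n"
    and c: "\<And>n. c n \<in> Lq_space q I" "c0 \<in> Lq_space q I"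
    and dom: "\<And>n. AE x in lebesgue. x \<in> I \<longrightarrow> norm (c n x) \<le> L * norm (g n x)"
      "AE x in lebesgue. x \<in> I \<longrightarrow> norm (c0 x) \<le> L * norm (g0 x)"
    and lim: "AE x in lebesgue. x \<in> I \<longrightarrow> (\<lambda>n. g n x) \<longlonglongrightarrow> g0 x \<longrightarrow> (\<lambda>n. c n x) \<longlonglongrightarrow> c0 x"
  shows "(\<lambda>n. Lq_mass q I (\<lambda>x. c n x - c0 x)) \<longlonglongrightarrow> 0"
proof -
  obtain S where S: "integrable lebesgue S"
    "AE x in lebesgue. x \<in> I \<longrightarrow> (\<lambda>n. g n x) \<longlonglongrightarrow> g0 x"
    "AE x in lebesgue. x \<in> I \<longrightarrow> (\<forall>n. norm (g n x - g0 x) powr q \<le> S x)"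
    using Lq_fast_convergence[OF q g fast] by blast
  \<comment> \<open>From \<open>norm (c n x - c0 x) \<le> L * (norm (g n x - g0 x) + 2 * norm (g0
    x))\<close> and \<open>powr_add_le\<close>. The absolute value makes \<open>w\<close>
    nonnegative off \<open>I\<close>, where nothing is known about \<open>S\<close>.\<close>
  define w where "w x = L powr q * (2 powr q * (\<bar>S x\<bar> + 2 powr q * norm (indicat_real I x *\<^sub>R g0 x) powr q))" for x
  have cm: "(\<lambda>x. norm (indicat_real I x *\<^sub>R (c n x - c0 x)) powr q) \<in> borel_measurable lebesgue" for n
    using Lq_space_diff[OF _ c(1) c(2)] q unfolding Lq_space_iff by (auto intro: borel_measurable_integrable)
  have "(\<lambda>n. LINT x|lebesgue. norm (indicat_real I x *\<^sub>R (c n x - c0 x)) powr q) \<longlonglongrightarrow> (LINT x::real|lebesgue. (0::real))"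
  proof (rule integral_dominated_convergence[where w = w])
    show "integrable lebesgue w"
      unfolding w_def[abs_def] using g(2) S(1)
      by (intro integrable_mult_right Bochner_Integration.integrable_add integrable_abs) (auto simp: Lq_space_iff)
    show "AE x in lebesgue. (\<lambda>n. norm (indicat_real I x *\<^sub>R (c n x - c0 x)) powr q) \<longlonglongrightarrow> 0"
      using lim S(2)
    proof eventually_elim
      case (elim x)
      show ?case
      proof (cases "x \<in> I")
        case True
        then have "(\<lambda>n. norm (c n x - c0 x)) \<longlonglongrightarrow> 0"
          using elim by (simp add: tendsto_norm_zero_iff LIM_zero_iff)
        from tendsto_zero_powrI[OF this tendsto_const[of q]] q True show ?thesis by simp
      qed simp
    qed
    show "AE x in lebesgue. norm (norm (indicat_real I x *\<^sub>R (c n x - c0 x)) powr q) \<le> w x" for n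
      using dom(1)[of n] dom(2) S(3)
    proof eventually_elim
      case (elim x)
      show ?case
      proof (cases "x \<in> I")
        case True
        with elim have e: "norm (c n x) \<le> L * norm (g n x)" "norm (c0 x) \<le> L * norm (g0 x)"
          "norm (g n x - g0 x) powr q \<le> S x" by blast+
        have "norm (g n x) \<le> norm (g n x - g0 x) + norm (g0 x)"
          using norm_triangle_sub[of "g n x" "g0 x"] by simp
        then have "norm (c n x - c0 x) \<le> L * ((norm (g n x - g0 x) + norm (g0 x)) + norm (g0 x))"
          using e(1,2) \<open>0 \<le> L\<close> norm_triangle_ineq4[of "c n x" "c0 x"]
          by (smt (verit) distrib_left mult_left_mono)
        also have "\<dots> = L * (norm (g n x - g0 x) + 2 * norm (g0 x))" by simp
        finally have "norm (c n x - c0 x) powr q \<le> (L * (norm (g n x - g0 x) + 2 * norm (g0 x))) powr q"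
          using q by (intro powr_mono2) auto
        also have "\<dots> = L powr q * (norm (g n x - g0 x) + 2 * norm (g0 x)) powr q"
          using \<open>0 \<le> L\<close> by (simp add: powr_mult)
        also have "\<dots> \<le> L powr q * (2 powr q * (norm (g n x - g0 x) powr q + (2 * norm (g0 x)) powr q))"
          using q by (intro mult_left_mono powr_add_le) auto
        also have "\<dots> \<le> w x"
          unfolding w_def using True e(3) by (intro mult_left_mono add_mono) (auto simp: powr_mult)
        finally show ?thesis using True by simp
      next
        case False
        then show ?thesis by (simp add: w_def)
      qed
    qed
  qed (use cm in simp_all)
  then show ?thesis by (simp add: Lq_mass_eq)
qed

section \<open>Sobolev functions and composition\<close>

text \<open>A Sobolev function together with a named classical derivative. This replaces the
  arbitrary choice in \<open>weak_derivative\<close> and gives access to pointwise difference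
  quotients.\<close>

definition sobolev_pair ::
  "real \<Rightarrow> real set \<Rightarrow> (real \<Rightarrow> 'v::euclidean_space) \<Rightarrow> (real \<Rightarrow> 'v) \<Rightarrow> bool" where
  "sobolev_pair q I f f' \<longleftrightarrow> abs_continuous_on I f \<and> f \<in> Lq_space q I \<and> f' \<in> Lq_space q I \<and>
     (AE x in lebesgue. x \<in> I \<longrightarrow> (f has_vector_derivative f' x) (at x))"

lemma sobolev_pairD:
  assumes "sobolev_pair q I f f'"
  shows "abs_continuous_on I f" "f \<in> Lq_space q I" "f' \<in> Lq_space q I"
    "AE x in lebesgue. x \<in> I \<longrightarrow> (f has_vector_derivative f' x) (at x)"
  using assms by (simp_all add: sobolev_pair_def)

lemma Lq_space_imp_locally_integrable:
  fixes g :: "real \<Rightarrow> 'v::euclidean_space"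
  assumes "1 \<le> q" "g \<in> Lq_space q {a<..<b}" "a < b"
  shows "locally_integrable {a<..<b} g"
  unfolding locally_integrable_def
  using set_integrable_subset[OF Lq_space_imp_integrable(1)[OF assms]]
  by (auto intro: fmeasurableD lmeasurable_compact)

lemma sobolev_pair_has_weak_derivative:
  fixes f :: "real \<Rightarrow> 'v::euclidean_space"
  assumes "1 \<le> q" "a < b" "sobolev_pair q {a<..<b} f f'"
  shows "has_weak_derivative f f' {a<..<b}"
  using assms unfolding sobolev_pair_def
  by (intro AE_derivative_has_weak_derivative Lq_space_imp_locally_integrable) auto

lemma sobolev_space_iff:
  fixes f :: "real \<Rightarrow> 'v::euclidean_space"
  assumes "1 \<le> q" "a < b"
  shows "f \<in> sobolev_space q {a<..<b} \<longleftrightarrow> (\<exists>f'. sobolev_pair q {a<..<b} f f')"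
proof
  assume "f \<in> sobolev_space q {a<..<b}"
  then obtain g where g: "abs_continuous_on {a<..<b} f" "f \<in> Lq_space q {a<..<b}" "g \<in> Lq_space q {a<..<b}"
    "has_weak_derivative f g {a<..<b}"
    by (auto simp: sobolev_space_def)
  have "sobolev_pair q {a<..<b} f g"
    unfolding sobolev_pair_def
    using g(1-3) has_weak_derivative_AE_derivative[OF g(4) abs_continuous_on_imp_continuous_on[OF g(1)]] by simp
  then show "\<exists>f'. sobolev_pair q {a<..<b} f f'" by (rule exI[where x = g])
next
  assume "\<exists>f'. sobolev_pair q {a<..<b} f f'"
  then obtain f' where f': "sobolev_pair q {a<..<b} f f'" ..
  then show "f \<in> sobolev_space q {a<..<b}"
    using sobolev_pair_has_weak_derivative[OF assms f'] unfolding sobolev_space_def sobolev_pair_def by auto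
qed

text \<open>Whatever weak derivative \<open>SOME\<close> selects, it is the classical derivative
  almost everywhere, hence agrees with \<open>f'\<close> up to a negligible set.\<close>

lemma sobolev_norm_eq:
  fixes f :: "real \<Rightarrow> 'v::euclidean_space"
  assumes q: "1 \<le> q" "a < b" and f: "sobolev_pair q {a<..<b} f f'"
  shows "sobolev_norm q {a<..<b} f = Lq_norm q {a<..<b} f + Lq_norm q {a<..<b} f'"
proof -
  have cont: "continuous_on {a<..<b} f"
    by (rule abs_continuous_on_imp_continuous_on[OF sobolev_pairD(1)[OF f]])
  have "has_weak_derivative f (weak_derivative {a<..<b} f) {a<..<b}"
    unfolding weak_derivative_def by (rule someI[where P = "\<lambda>g. has_weak_derivative f g {a<..<b}", OF sobolev_pair_has_weak_derivative[OF assms]])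
  from has_weak_derivative_AE_derivative[OF this cont] sobolev_pairD(4)[OF f]
  have "AE x in lebesgue. x \<in> {a<..<b} \<longrightarrow> weak_derivative {a<..<b} f x = f' x"
    by eventually_elim (metis vector_derivative_unique_at)
  then have "Lq_mass q {a<..<b} (weak_derivative {a<..<b} f) = Lq_mass q {a<..<b} f'"
    by (rule Lq_space_cong_AE(2)[OF sobolev_pairD(3)[OF f]])
  then show ?thesis by (simp add: sobolev_norm_def Lq_norm_eq_mass)
qed

lemma sobolev_pair_diff:
  fixes f g :: "real \<Rightarrow> 'v::euclidean_space"
  assumes q: "0 \<le> q" and f: "sobolev_pair q {a<..<b} f f'" and g: "sobolev_pair q {a<..<b} g g'"
  shows "sobolev_pair q {a<..<b} (\<lambda>x. f x - g x) (\<lambda>x. f' x - g' x)"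
  unfolding sobolev_pair_def
proof (intro conjI)
  show "(\<lambda>x. f x - g x) \<in> Lq_space q {a<..<b}" "(\<lambda>x. f' x - g' x) \<in> Lq_space q {a<..<b}"
    by (intro Lq_space_diff q sobolev_pairD[OF f] sobolev_pairD[OF g])+
  show "AE x in lebesgue. x \<in> {a<..<b} \<longrightarrow> ((\<lambda>x. f x - g x) has_vector_derivative f' x - g' x) (at x)"
    using sobolev_pairD(4)[OF f] sobolev_pairD(4)[OF g]
    by eventually_elim (simp add: has_vector_derivative_diff)
  have acf: "abs_continuous_on {a<..<b} f" and acg: "abs_continuous_on {a<..<b} g"
    by (rule sobolev_pairD(1)[OF f], rule sobolev_pairD(1)[OF g])
  show "abs_continuous_on {a<..<b} (\<lambda>x. f x - g x)"
    unfolding abs_continuous_on_def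
  proof (intro allI impI)
    fix \<epsilon> :: real assume "0 < \<epsilon>"
    then have half: "0 < \<epsilon> / 2" by simp
    let ?ok = "\<lambda>D \<delta>. finite D \<and> (\<forall>(s, t)\<in>D. s \<le> t \<and> {s..t} \<subseteq> {a<..<b}) \<and>
        pairwise (\<lambda>(s, t) (s', t'). {s<..<t} \<inter> {s'<..<t'} = {}) D \<and> (\<Sum>(s, t)\<in>D. t - s) < \<delta>"
    obtain d where d: "0 < d" "\<And>D. ?ok D d \<Longrightarrow> (\<Sum>(s, t)\<in>D. norm (f t - f s)) < \<epsilon> / 2"
      using acf half unfolding abs_continuous_on_def by meson
    obtain e where e: "0 < e" "\<And>D. ?ok D e \<Longrightarrow> (\<Sum>(s, t)\<in>D. norm (g t - g s)) < \<epsilon> / 2"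
      using acg half unfolding abs_continuous_on_def by meson
    show "\<exists>\<delta>>0. \<forall>D. ?ok D \<delta> \<longrightarrow> (\<Sum>(s, t)\<in>D. norm ((f t - g t) - (f s - g s))) < \<epsilon>"
    proof (intro exI[of _ "min d e"] conjI allI impI)
      show "0 < min d e" using d e by simp
      fix D assume D: "?ok D (min d e)"
      have "(\<Sum>(s, t)\<in>D. norm ((f t - g t) - (f s - g s))) \<le> (\<Sum>(s, t)\<in>D. norm (f t - f s) + norm (g t - g s))"
      proof (rule sum_mono, clarify)
        fix s t
        have "(f t - g t) - (f s - g s) = (f t - f s) - (g t - g s)" by simp
        then show "norm ((f t - g t) - (f s - g s)) \<le> norm (f t - f s) + norm (g t - g s)"
          by (metis norm_triangle_ineq4)
      qed
      also have "\<dots> = (\<Sum>(s, t)\<in>D. norm (f t - f s)) + (\<Sum>(s, t)\<in>D. norm (g t - g s))"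
        by (simp add: sum.distrib case_prod_unfold)
      also have "\<dots> < \<epsilon> / 2 + \<epsilon> / 2"
        using D by (intro add_strict_mono d(2) e(2)) auto
      finally show "(\<Sum>(s, t)\<in>D. norm ((f t - g t) - (f s - g s))) < \<epsilon>" by simp
    qed
  qed
qed

section \<open>Control of the supremum by the Sobolev norm\<close>

lemma sobolev_pair_increment:
  fixes f :: "real \<Rightarrow> 'v::euclidean_space"
  assumes q: "1 \<le> q" "a < b" and f: "sobolev_pair q {a<..<b} f f'"
    and st: "s \<in> {a<..<b}" "t \<in> {a<..<b}"
  shows "norm (f t - f s) \<le> (LINT x:{a<..<b}|lebesgue. norm (f' x))"
proof -
  have *: "norm (f t - f s) \<le> (LINT x:{a<..<b}|lebesgue. norm (f' x))"
    if "s \<in> {a<..<b}" "t \<in> {a<..<b}" "s \<le> t" for s t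
  proof -
    have sub: "{s..t} \<subseteq> {a<..<b}" using that by auto
    have int: "set_integrable lebesgue {a<..<b} f'"
      by (rule Lq_space_imp_integrable(1)[OF q(1) sobolev_pairD(3)[OF f] q(2)])
    then have int': "set_integrable lebesgue {s..t} f'"
      by (rule set_integrable_subset) (use sub in auto)
    obtain N where N: "negligible N" "\<And>x. x \<in> {a<..<b} \<Longrightarrow> x \<notin> N \<Longrightarrow> (f has_vector_derivative f' x) (at x)"
      using sobolev_pairD(4)[OF f] unfolding eventually_ae_filter_negligible by blast
    have "(f' has_integral f t - f s) {s..t}"
    proof (rule abs_continuous_on_has_integral[OF sobolev_pairD(1)[OF f] sub \<open>s \<le> t\<close> N(1)])
      show "(f has_vector_derivative f' x) (at x within {s..t})" if x: "x \<in> {s..t} - N" for x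
      proof (rule has_vector_derivative_at_within[OF N(2)])
        show "x \<in> {a<..<b}" "x \<notin> N" using x sub by blast+
      qed
    qed
    then have "f t - f s = (LINT x:{s..t}|lebesgue. f' x)"
      using set_lebesgue_integral_eq_integral(2)[OF int'] by (simp add: integral_unique)
    also have "norm \<dots> \<le> (LINT x:{s..t}|lebesgue. norm (f' x))"
      by (rule set_integral_norm_bound[OF int'])
    also have "\<dots> \<le> (LINT x:{a<..<b}|lebesgue. norm (f' x))"
      unfolding set_lebesgue_integral_def
    proof (rule integral_mono)
      show "integrable lebesgue (\<lambda>x. indicat_real {s..t} x *\<^sub>R norm (f' x))"
        "integrable lebesgue (\<lambda>x. indicat_real {a<..<b} x *\<^sub>R norm (f' x))"
        using set_integrable_norm[OF int'] set_integrable_norm[OF int] unfolding set_integrable_def .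
      show "indicat_real {s..t} x *\<^sub>R norm (f' x) \<le> indicat_real {a<..<b} x *\<^sub>R norm (f' x)" for x
        using subsetD[OF sub, of x] by (cases "x \<in> {s..t}") auto
    qed
    finally show ?thesis .
  qed
  show ?thesis
  proof (cases "s \<le> t")
    case True
    then show ?thesis by (rule *[OF st])
  next
    case False
    then show ?thesis using *[OF st(2,1)] by (simp add: norm_minus_commute)
  qed
qed

lemma sobolev_pair_bounded:
  fixes f :: "real \<Rightarrow> 'v::euclidean_space"
  assumes q: "1 \<le> q" "a < b" and f: "sobolev_pair q {a<..<b} f f'"
  obtains R where "\<And>x. x \<in> {a<..<b} \<Longrightarrow> norm (f x) \<le> R"
proof -
  define c where "c = (a + b) / 2"
  have c: "c \<in> {a<..<b}" using q by (simp add: c_def)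
  have "norm (f x) \<le> norm (f c) + (LINT x:{a<..<b}|lebesgue. norm (f' x))" if "x \<in> {a<..<b}" for x
    using sobolev_pair_increment[OF q f c that] norm_triangle_sub[of "f x" "f c"] by linarith
  then show ?thesis by (rule that)
qed

text \<open>The embedding into the bounded functions, in the form of smallness: a small mass of
  \<open>f\<close> forces a small value at some point, and a small mass of \<open>f'\<close> keeps
  all other values close to that one.\<close>

lemma sobolev_pair_sup_small:
  assumes q: "1 \<le> q" "a < b" and "0 < \<epsilon>"
  obtains \<delta> where "0 < \<delta>"
    "\<And>(f :: real \<Rightarrow> 'v::euclidean_space) f' x. sobolev_pair q {a<..<b} f f' \<Longrightarrow>
       Lq_mass q {a<..<b} f < \<delta> \<Longrightarrow> Lq_mass q {a<..<b} f' < \<delta> \<Longrightarrow> x \<in> {a<..<b} \<Longrightarrow> norm (f x) < \<epsilon>"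
proof -
  let ?I = "{a<..<b}"
  define \<eta> where "\<eta> = \<epsilon> / (6 * (b - a))"
  have \<eta>: "0 < \<eta>" using q \<open>0 < \<epsilon>\<close> by (simp add: \<eta>_def)
  \<comment> \<open>The first entry keeps the mass term of \<open>f'\<close> at most
    \<open>\<epsilon> / 6\<close>, which together with
    \<open>\<eta> * (b - a) = \<epsilon> / 6\<close> bounds increments by
    \<open>\<epsilon> / 3\<close>. The second excludes that \<open>norm (f y)\<close> is at least
    \<open>\<epsilon> / 3\<close> throughout the interval.\<close>
  define \<delta> where "\<delta> = min (\<epsilon> / 6 / \<eta> powr (1 - q)) ((\<epsilon> / 3) powr q * (b - a))"
  have \<delta>: "0 < \<delta>" using \<eta> q \<open>0 < \<epsilon>\<close> by (simp add: \<delta>_def)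
  have "norm (f x) < \<epsilon>"
    if f: "sobolev_pair q ?I f f'" and small: "Lq_mass q ?I f < \<delta>" "Lq_mass q ?I f' < \<delta>" and x: "x \<in> ?I"
    for f f' :: "real \<Rightarrow> 'v" and x
  proof -
    have fL: "f \<in> Lq_space q ?I" "f' \<in> Lq_space q ?I" by (rule sobolev_pairD[OF f])+
    have "(LINT x:?I|lebesgue. norm (f' x)) \<le> \<eta> * (b - a) + \<eta> powr (1 - q) * Lq_mass q ?I f'"
      by (rule Lq_space_imp_integrable(2)[OF q(1) fL(2) q(2) \<eta>])
    also have "\<eta> * (b - a) = \<epsilon> / 6"
    proof -
      have "\<epsilon> / (6 * r) * r = \<epsilon> / 6" if "r \<noteq> 0" for r :: real
        using that by simp
      from this[of "b - a"] show ?thesis using q by (simp only: \<eta>_def)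
    qed
    also have "\<eta> powr (1 - q) * Lq_mass q ?I f' \<le> \<eta> powr (1 - q) * (\<epsilon> / 6 / \<eta> powr (1 - q))"
      using small(2) by (intro mult_left_mono) (auto simp: \<delta>_def)
    also have "\<dots> = \<epsilon> / 6" using \<eta> by simp
    finally have inc: "(LINT x:?I|lebesgue. norm (f' x)) \<le> \<epsilon> / 3" by simp
    have "\<exists>y\<in>?I. norm (f y) < \<epsilon> / 3"
    proof (rule ccontr)
      assume "\<not> ?thesis"
      then have ge: "\<epsilon> / 3 \<le> norm (f y)" if "y \<in> ?I" for y using that by force
      have "(LINT y|lebesgue. (\<epsilon> / 3) powr q * indicat_real ?I y) \<le> Lq_mass q ?I f"
        unfolding Lq_mass_eq
      proof (rule integral_mono)
        show "integrable lebesgue (\<lambda>y. (\<epsilon> / 3) powr q * indicat_real ?I y)"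
          by (intro integrable_mult_right integrable_indicator_Ioo)
        show "integrable lebesgue (\<lambda>x. norm (indicat_real ?I x *\<^sub>R f x) powr q)"
          using fL by (simp add: Lq_space_iff)
        show "(\<epsilon> / 3) powr q * indicat_real ?I y \<le> norm (indicat_real ?I y *\<^sub>R f y) powr q" for y
          using ge[of y] q \<open>0 < \<epsilon>\<close> by (cases "y \<in> ?I") (auto intro: powr_mono2)
      qed
      moreover have "(LINT y|lebesgue. (\<epsilon> / 3) powr q * indicat_real ?I y) = (\<epsilon> / 3) powr q * (b - a)"
        using q by simp
      moreover have "Lq_mass q ?I f < (\<epsilon> / 3) powr q * (b - a)" using small(1) by (simp add: \<delta>_def)
      ultimately show False by linarith
    qed
    then obtain y where y: "y \<in> ?I" "norm (f y) < \<epsilon> / 3" by blast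
    have "norm (f x) \<le> norm (f y) + norm (f x - f y)"
      using norm_triangle_sub[of "f x" "f y"] .
    also have "\<dots> < \<epsilon>"
      using sobolev_pair_increment[OF q f y(1) x] y(2) inc \<open>0 < \<epsilon>\<close> by linarith
    finally show ?thesis .
  qed
  with \<delta> show ?thesis by (rule that)
qed

text \<open>The Sobolev norm is a sum of roots of two masses, so a radius
  \<open>\<delta> powr (1 / q)\<close> bounds each mass by \<open>\<delta>\<close>. All radii chosen
  below have this shape.\<close>

lemma sobolev_norm_less_imp_mass_less:
  fixes f :: "real \<Rightarrow> 'v::euclidean_space"
  assumes q: "1 \<le> q" "a < b" and f: "sobolev_pair q {a<..<b} f f'"
    and "0 < \<delta>" "sobolev_norm q {a<..<b} f < \<delta> powr (1 / q)"
  shows "Lq_mass q {a<..<b} f < \<delta>" "Lq_mass q {a<..<b} f' < \<delta>"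
proof -
  have *: "m < \<delta>" if "0 \<le> m" "m powr (1 / q) < \<delta> powr (1 / q)" for m
  proof (rule ccontr)
    assume "\<not> m < \<delta>"
    then have "\<delta> powr (1 / q) \<le> m powr (1 / q)"
      using q \<open>0 < \<delta>\<close> by (intro powr_mono2) auto
    then show False using that(2) by simp
  qed
  have "Lq_mass q {a<..<b} f powr (1 / q) + Lq_mass q {a<..<b} f' powr (1 / q) < \<delta> powr (1 / q)"
    using assms(5) by (simp add: sobolev_norm_eq[OF q f] Lq_norm_eq_mass)
  moreover have "0 \<le> Lq_mass q {a<..<b} f powr (1 / q)" "0 \<le> Lq_mass q {a<..<b} f' powr (1 / q)"
    by simp_all
  ultimately have "Lq_mass q {a<..<b} f powr (1 / q) < \<delta> powr (1 / q)"
    "Lq_mass q {a<..<b} f' powr (1 / q) < \<delta> powr (1 / q)" by linarith+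
  then show "Lq_mass q {a<..<b} f < \<delta>" "Lq_mass q {a<..<b} f' < \<delta>"
    by (auto intro: * Lq_mass_nonneg)
qed

section \<open>Continuity of composition with a Lipschitz function\<close>

text \<open>Isolates what has to be known about \<open>F\<close>: \<open>D\<close> relates point,
  direction and derivative, holds almost everywhere along curves in \<open>U\<close>, and is stable
  under limits. With constant sequences, \<open>closed\<close> also says that \<open>D\<close> is
  single-valued over \<open>K\<close>. If continuity failed, a fast sequence of counterexamples
  would have derivatives converging almost everywhere under a common majorant.\<close>

theorem sobolev_continuous_composition:
  fixes F :: "'v::euclidean_space \<Rightarrow> real" and U :: "(real \<Rightarrow> 'v) set"
    and D :: "'v \<Rightarrow> 'v \<Rightarrow> real \<Rightarrow> bool"
  assumes q: "1 \<le> q" "a < b" and U: "U \<subseteq> sobolev_space q {a<..<b}"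
    and K: "\<And>A x. A \<in> U \<Longrightarrow> x \<in> {a<..<b} \<Longrightarrow> A x \<in> K"
    and L: "0 \<le> L" "\<And>x y. x \<in> K \<Longrightarrow> y \<in> K \<Longrightarrow> \<bar>F x - F y\<bar> \<le> L * norm (x - y)"
    and diff: "\<And>A A'. A \<in> U \<Longrightarrow> sobolev_pair q {a<..<b} A A' \<Longrightarrow>
       AE x in lebesgue. x \<in> {a<..<b} \<longrightarrow>
         (\<exists>c. D (A x) (A' x) c \<and> ((\<lambda>y. F (A y)) has_vector_derivative c) (at x))"
    and closed: "\<And>x0 v0 c0 x v c. (\<And>n. x n \<in> K) \<Longrightarrow> x0 \<in> K \<Longrightarrow> x \<longlonglongrightarrow> x0 \<Longrightarrow> v \<longlonglongrightarrow> v0 \<Longrightarrow>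
       (\<And>n. D (x n) (v n) (c n)) \<Longrightarrow> D x0 v0 c0 \<Longrightarrow> c \<longlonglongrightarrow> c0"
  shows "(\<forall>A\<in>U. (\<lambda>x. F (A x)) \<in> sobolev_space q {a<..<b}) \<and>
    sobolev_continuous_on q {a<..<b} U (\<lambda>A x. F (A x))"
proof -
  let ?I = "{a<..<b}"
  have pair: "\<exists>c. sobolev_pair q ?I (\<lambda>x. F (A x)) c \<and>
      (AE x in lebesgue. x \<in> ?I \<longrightarrow> D (A x) (A' x) (c x)) \<and>
      (AE x in lebesgue. x \<in> ?I \<longrightarrow> norm (c x) \<le> L * norm (A' x))"
    if A: "A \<in> U" and A': "sobolev_pair q ?I A A'" for A A'
  proof -
    \<comment> \<open>Picked point by point, so its measurability is not automatic and is recovered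
      in \<open>meas\<close>.\<close>
    define c where "c x = (SOME c. D (A x) (A' x) c \<and> ((\<lambda>y. F (A y)) has_vector_derivative c) (at x))" for x
    have c: "AE x in lebesgue. x \<in> ?I \<longrightarrow> D (A x) (A' x) (c x) \<and> ((\<lambda>y. F (A y)) has_vector_derivative c x) (at x)"
      using diff[OF A A']
    proof (eventually_elim, intro impI)
      fix x assume "x \<in> ?I \<longrightarrow> (\<exists>c. D (A x) (A' x) c \<and> ((\<lambda>y. F (A y)) has_vector_derivative c) (at x))" "x \<in> ?I"
      then have "\<exists>c. D (A x) (A' x) c \<and> ((\<lambda>y. F (A y)) has_vector_derivative c) (at x)" by simp
      then show "D (A x) (A' x) (c x) \<and> ((\<lambda>y. F (A y)) has_vector_derivative c x) (at x)"
        unfolding c_def by (rule someI_ex)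
    qed
    have lip: "\<bar>F (A y) - F (A x)\<bar> \<le> L * norm (A y - A x)" if "x \<in> ?I" "y \<in> ?I" for x y
      using K[OF A] that by (intro L)
    have ac: "abs_continuous_on ?I (\<lambda>x. F (A x))"
    proof (rule abs_continuous_on_dominated)
      show "abs_continuous_on ?I A" by (rule sobolev_pairD(1)[OF A'])
      show "norm (F (A v) - F (A u)) \<le> L * (norm (A v - A u) + \<bar>v - u\<bar>)" if "u \<in> ?I" "v \<in> ?I" for u v
        using lip[OF that] L(1) by (simp add: distrib_left add_increasing2)
    qed (use L in auto)
    then have cont: "continuous_on ?I (\<lambda>x. F (A x))"
      by (rule abs_continuous_on_imp_continuous_on)
    have dA: "AE x in lebesgue. x \<in> ?I \<longrightarrow> (A has_vector_derivative A' x) (at x)"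
      by (rule sobolev_pairD(4)[OF A'])
    have bound: "AE x in lebesgue. x \<in> ?I \<longrightarrow> norm (c x) \<le> L * norm (A' x)"
      using c dA
    proof (eventually_elim, intro impI)
      fix x
      assume "x \<in> ?I \<longrightarrow> D (A x) (A' x) (c x) \<and> ((\<lambda>y. F (A y)) has_vector_derivative c x) (at x)"
        and "x \<in> ?I \<longrightarrow> (A has_vector_derivative A' x) (at x)" and x: "x \<in> ?I"
      then have q1: "((\<lambda>y. (F (A y) - F (A x)) /\<^sub>R (y - x)) \<longlongrightarrow> c x) (at x)"
        and q2: "((\<lambda>y. (A y - A x) /\<^sub>R (y - x)) \<longlongrightarrow> A' x) (at x)"
        unfolding has_vector_derivative_iff_quotient by blast+
      have l1: "((\<lambda>y. norm ((F (A y) - F (A x)) /\<^sub>R (y - x))) \<longlongrightarrow> norm (c x)) (at x)"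
        by (rule tendsto_norm[OF q1])
      have l2: "((\<lambda>y. L * norm ((A y - A x) /\<^sub>R (y - x))) \<longlongrightarrow> L * norm (A' x)) (at x)"
        by (rule tendsto_mult_left[OF tendsto_norm[OF q2]])
      have "\<forall>\<^sub>F y in at x. y \<in> ?I"
        using x by (intro eventually_at_in_open') auto
      then have "\<forall>\<^sub>F y in at x. norm ((F (A y) - F (A x)) /\<^sub>R (y - x)) \<le> L * norm ((A y - A x) /\<^sub>R (y - x))"
      proof eventually_elim
        case (elim y)
        from mult_left_mono[OF lip[OF x elim], of "inverse \<bar>y - x\<bar>"]
        show ?case by (simp add: abs_mult mult.left_commute)
      qed
      then show "norm (c x) \<le> L * norm (A' x)"
        by (rule tendsto_le[OF at_neq_bot l2 l1])
    qed
    have meas: "(\<lambda>x. indicat_real ?I x *\<^sub>R c x) \<in> borel_measurable lebesgue"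
    proof -
      \<comment> \<open>Forward difference quotients, cut off where the shifted argument would leave
        the interval. They are measurable by continuity, and their limit is \<open>c\<close> almost
        everywhere.\<close>
      define d where "d n x = indicat_real {a<..<b - 1 / real (Suc n)} x *\<^sub>R
          ((F (A (x + 1 / real (Suc n))) - F (A x)) /\<^sub>R (1 / real (Suc n)))" for n x
      have "d n \<in> borel_measurable lebesgue" for n
      proof -
        define e where "e = 1 / real (Suc n)"
        have "0 < e" by (simp add: e_def)
        then have "continuous_on {a<..<b - e} (\<lambda>x. (F (A (x + e)) - F (A x)) /\<^sub>R e)"
          by (intro continuous_intros continuous_on_compose2[OF cont] continuous_on_subset[OF cont]) auto
        from borel_measurable_continuous_on_indicator[OF _ this]
        have "d n \<in> borel_measurable borel" by (simp add: d_def[abs_def] e_def del: of_nat_Suc)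
        then show ?thesis by (intro measurable_completion) simp
      qed
      then have lm: "(\<lambda>x. lim (\<lambda>n. d n x)) \<in> borel_measurable lebesgue"
        by (intro borel_measurable_lim_metric)
      have "AE x in lebesgue. lim (\<lambda>n. d n x) = indicat_real ?I x *\<^sub>R c x"
        using c
      proof eventually_elim
        case (elim x)
        have "(\<lambda>n. d n x) \<longlonglongrightarrow> indicat_real ?I x *\<^sub>R c x"
        proof (cases "x \<in> ?I")
          case True
          with elim have l: "((\<lambda>y. (F (A y) - F (A x)) /\<^sub>R (y - x)) \<longlongrightarrow> c x) (at x)"
            unfolding has_vector_derivative_iff_quotient by blast
          have z: "(\<lambda>n. 1 / real (Suc n)) \<longlonglongrightarrow> 0"
            using LIMSEQ_inverse_real_of_nat by (simp only: inverse_eq_divide)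
          have "(\<lambda>n. x + 1 / real (Suc n)) \<longlonglongrightarrow> x"
            using tendsto_add[OF tendsto_const z, of x] by simp
          then have seq: "filterlim (\<lambda>n. x + 1 / real (Suc n)) (at x) sequentially"
            by (auto simp: filterlim_at)
          have "(\<lambda>n. (F (A (x + 1 / real (Suc n))) - F (A x)) /\<^sub>R (1 / real (Suc n))) \<longlonglongrightarrow> c x"
            using filterlim_compose[OF l seq] by simp
          moreover have "\<forall>\<^sub>F n in sequentially. 1 / real (Suc n) < b - x"
            using True by (intro order_tendstoD(2)[OF z]) simp
          then have "\<forall>\<^sub>F n in sequentially. (F (A (x + 1 / real (Suc n))) - F (A x)) /\<^sub>R (1 / real (Suc n)) = d n x"
            by eventually_elim (use True in \<open>simp add: d_def\<close>)
          ultimately show ?thesis using True by (simp add: Lim_transform_eventually)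
        next
          case False
          have "x \<notin> {a<..<b - e}" if "0 < e" for e using False that by auto
          then have "d n x = 0" for n by (simp add: d_def del: of_nat_Suc)
          then show ?thesis using False by simp
        qed
        then show ?case by (rule limI)
      qed
      with lm show ?thesis by (rule borel_measurable_AE)
    qed
    have cL: "c \<in> Lq_space q ?I"
      using q by (intro Lq_space_dominated[OF _ L(1) sobolev_pairD(3)[OF A'] meas bound]) simp
    have FL: "(\<lambda>x. F (A x)) \<in> Lq_space q ?I"
    proof -
      obtain R where R: "\<And>x. x \<in> ?I \<Longrightarrow> norm (A x) \<le> R"
        by (rule sobolev_pair_bounded[OF q A']) blast
      define m where "m = (a + b) / 2"
      have m: "m \<in> ?I" using q by (simp add: m_def)
      \<comment> \<open>Any two values of \<open>A\<close> are at most \<open>2 * R\<close> apart,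
        so the Lipschitz bound controls \<open>F\<close> along the curve from its value at the
        midpoint.\<close>
      define B where "B = \<bar>F (A m)\<bar> + L * (2 * R)"
      have B: "\<bar>F (A x)\<bar> \<le> B" if "x \<in> ?I" for x
      proof -
        have "norm (A x - A m) \<le> 2 * R"
          using norm_triangle_ineq4[of "A x" "A m"] R[OF that] R[OF m] by linarith
        then have "L * norm (A x - A m) \<le> L * (2 * R)" using L(1) by (rule mult_left_mono)
        then show ?thesis using lip[OF m that] unfolding B_def by linarith
      qed
      show ?thesis
      proof (rule Lq_space_bound)
        show "integrable lebesgue (\<lambda>x. B powr q * indicat_real ?I x)"
          by (intro integrable_mult_right integrable_indicator_Ioo)
        show "(\<lambda>x. indicat_real ?I x *\<^sub>R F (A x)) \<in> borel_measurable lebesgue"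
          using borel_measurable_continuous_on_indicator[OF _ cont] by (intro measurable_completion) simp
        show "AE x in lebesgue. norm (indicat_real ?I x *\<^sub>R F (A x)) powr q \<le> B powr q * indicat_real ?I x"
          using B q by (intro AE_I2) (auto simp: indicator_def intro!: powr_mono2)
      qed
    qed
    have "sobolev_pair q ?I (\<lambda>x. F (A x)) c"
    proof -
      have "AE x in lebesgue. x \<in> ?I \<longrightarrow> ((\<lambda>y. F (A y)) has_vector_derivative c x) (at x)"
        using c by eventually_elim simp
      then show ?thesis using ac FL cL by (simp add: sobolev_pair_def)
    qed
    moreover have "AE x in lebesgue. x \<in> ?I \<longrightarrow> D (A x) (A' x) (c x)"
      using c by eventually_elim blast
    ultimately show ?thesis using bound by blast
  qed
  have "(\<lambda>x. F (A x)) \<in> sobolev_space q ?I" if A: "A \<in> U" for A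
  proof -
    obtain A' where "sobolev_pair q ?I A A'"
      using U A sobolev_space_iff[OF q, of A] by blast
    from pair[OF A this] show ?thesis
      using sobolev_space_iff[OF q, of "\<lambda>x. F (A x)"] by blast
  qed
  moreover have "sobolev_continuous_on q ?I U (\<lambda>A x. F (A x))"
    unfolding sobolev_continuous_on_def
  proof (intro ballI allI impI, rule ccontr)
    fix A \<epsilon> assume A: "A \<in> U" and "0 < (\<epsilon>::real)"
      and neg: "\<not> (\<exists>\<delta>>0. \<forall>B\<in>U. sobolev_dist q ?I B A < \<delta> \<longrightarrow> sobolev_dist q ?I (\<lambda>x. F (B x)) (\<lambda>x. F (A x)) < \<epsilon>)"
    obtain A' where A': "sobolev_pair q ?I A A'"
      using U A sobolev_space_iff[OF q, of A] by blast
    obtain k where k: "sobolev_pair q ?I (\<lambda>x. F (A x)) k"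
      "AE x in lebesgue. x \<in> ?I \<longrightarrow> D (A x) (A' x) (k x)"
      "AE x in lebesgue. x \<in> ?I \<longrightarrow> norm (k x) \<le> L * norm (A' x)"
      using pair[OF A A'] by blast
    \<comment> \<open>The radius is the root of \<open>(1 / 2) ^ n\<close>, so that the masses of
      \<open>B n - A\<close> and of its derivative are both below \<open>(1 / 2) ^ n\<close>, as
      fast convergence requires.\<close>
    have "\<exists>B. B \<in> U \<and> sobolev_dist q ?I B A < ((1 / 2) ^ n) powr (1 / q) \<and>
        \<epsilon> \<le> sobolev_dist q ?I (\<lambda>x. F (B x)) (\<lambda>x. F (A x))" for n :: nat
    proof -
      have "0 < ((1 / 2 :: real) ^ n) powr (1 / q)" by simp
      with neg show ?thesis by (meson not_le)
    qed
    then obtain B where B: "\<And>n. B n \<in> U"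
      "\<And>n. sobolev_dist q ?I (B n) A < ((1 / 2) ^ n) powr (1 / q)"
      "\<And>n. \<epsilon> \<le> sobolev_dist q ?I (\<lambda>x. F (B n x)) (\<lambda>x. F (A x))"
      by metis
    have "\<exists>B'. sobolev_pair q ?I (B n) B'" for n
      using U B(1) sobolev_space_iff[OF q, of "B n"] by blast
    then obtain B' where B': "\<And>n. sobolev_pair q ?I (B n) (B' n)" by metis
    have "\<forall>n. \<exists>c. sobolev_pair q ?I (\<lambda>x. F (B n x)) c \<and>
      (AE x in lebesgue. x \<in> ?I \<longrightarrow> D (B n x) (B' n x) (c x)) \<and>
      (AE x in lebesgue. x \<in> ?I \<longrightarrow> norm (c x) \<le> L * norm (B' n x))"
      by (rule allI) (rule pair[OF B(1) B'])
    from choice[OF this] obtain c where c': "\<forall>n. sobolev_pair q ?I (\<lambda>x. F (B n x)) (c n) \<and>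
      (AE x in lebesgue. x \<in> ?I \<longrightarrow> D (B n x) (B' n x) (c n x)) \<and>
      (AE x in lebesgue. x \<in> ?I \<longrightarrow> norm (c n x) \<le> L * norm (B' n x))"
      by (rule exE)
    note c = spec[OF c', THEN conjunct1] spec[OF c', THEN conjunct2, THEN conjunct1]
      spec[OF c', THEN conjunct2, THEN conjunct2]
    have q0: "0 \<le> q" using q by simp
    have BA: "sobolev_pair q ?I (\<lambda>x. B n x - A x) (\<lambda>x. B' n x - A' x)" for n
      by (rule sobolev_pair_diff[OF q0 B' A'])
    have mass: "Lq_mass q ?I (\<lambda>x. B n x - A x) < (1 / 2) ^ n" "Lq_mass q ?I (\<lambda>x. B' n x - A' x) < (1 / 2) ^ n" for n
      using sobolev_norm_less_imp_mass_less[OF q BA, of "(1 / 2) ^ n"] B(2)[of n]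
      by (simp_all add: sobolev_dist_def)
    \<comment> \<open>Base points converge everywhere on the interval, by the supremum bound;
      directions converge only almost everywhere, by speed.\<close>
    have conv: "(\<lambda>n. B n x) \<longlonglongrightarrow> A x" if x: "x \<in> ?I" for x
    proof (rule LIMSEQ_I)
      fix r :: real assume "0 < r"
      obtain \<delta> where \<delta>: "0 < \<delta>" "\<And>(f :: real \<Rightarrow> 'v) f' x. sobolev_pair q ?I f f' \<Longrightarrow>
         Lq_mass q ?I f < \<delta> \<Longrightarrow> Lq_mass q ?I f' < \<delta> \<Longrightarrow> x \<in> ?I \<Longrightarrow> norm (f x) < r"
        using sobolev_pair_sup_small[OF q \<open>0 < r\<close>] by blast
      obtain no where no: "(1 / 2 :: real) ^ no < \<delta>"
        using real_arch_pow_inv[OF \<delta>(1), of "1 / 2"] by auto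
      have "norm (B n x - A x) < r" if "no \<le> n" for n
      proof (rule \<delta>(2)[OF BA _ _ x])
        have "(1 / 2 :: real) ^ n \<le> (1 / 2) ^ no" using that by (intro power_decreasing) auto
        then show "Lq_mass q ?I (\<lambda>x. B n x - A x) < \<delta>" "Lq_mass q ?I (\<lambda>x. B' n x - A' x) < \<delta>"
          using mass[of n] no by linarith+
      qed
      then show "\<exists>no. \<forall>n\<ge>no. norm (B n x - A x) < r" by blast
    qed
    have Lq: "B n \<in> Lq_space q ?I" "B' n \<in> Lq_space q ?I" "A \<in> Lq_space q ?I" "A' \<in> Lq_space q ?I"
      "c n \<in> Lq_space q ?I" "k \<in> Lq_space q ?I" "(\<lambda>x. F (B n x)) \<in> Lq_space q ?I" "(\<lambda>x. F (A x)) \<in> Lq_space q ?I" for n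
      by (rule sobolev_pairD[OF B'] sobolev_pairD[OF A'] sobolev_pairD[OF c(1)] sobolev_pairD[OF k(1)])+
    have "(\<lambda>n. Lq_mass q ?I (\<lambda>x. c n x - k x)) \<longlonglongrightarrow> 0"
    proof (rule Lq_dominated_convergence[OF q(1) L(1) Lq(2,4) less_imp_le[OF mass(2)] Lq(5,6) c(3) k(3)])
      have "AE x in lebesgue. \<forall>n. x \<in> ?I \<longrightarrow> D (B n x) (B' n x) (c n x)"
        by (rule AE_all_countable[THEN iffD2]) (intro allI c(2))
      with k(2) show "AE x in lebesgue. x \<in> ?I \<longrightarrow> (\<lambda>n. B' n x) \<longlonglongrightarrow> A' x \<longrightarrow> (\<lambda>n. c n x) \<longlonglongrightarrow> k x"
      proof eventually_elim
        case (elim x)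
        show ?case
        proof (intro impI)
          assume x: "x \<in> ?I" and v: "(\<lambda>n. B' n x) \<longlonglongrightarrow> A' x"
          show "(\<lambda>n. c n x) \<longlonglongrightarrow> k x"
            by (rule closed[OF K[OF B(1) x] K[OF A x] conv[OF x] v]) (use elim x in blast)+
        qed
      qed
    qed
    \<comment> \<open>For the functions themselves the Lipschitz bound already gives geometric
      decay.\<close>
    moreover have "(\<lambda>n. Lq_mass q ?I (\<lambda>x. F (B n x) - F (A x))) \<longlonglongrightarrow> 0"
    proof -
      have le: "Lq_mass q ?I (\<lambda>x. F (B n x) - F (A x)) \<le> L powr q * (1 / 2) ^ n" for n
      proof -
        have "Lq_mass q ?I (\<lambda>x. F (B n x) - F (A x)) \<le> L powr q * Lq_mass q ?I (\<lambda>x. B n x - A x)"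
          unfolding Lq_mass_eq integral_mult_right_zero[symmetric]
        proof (rule integral_mono)
          show "integrable lebesgue (\<lambda>x. norm (indicat_real ?I x *\<^sub>R (F (B n x) - F (A x))) powr q)"
            using Lq_space_diff[OF q0 Lq(7)[of n] Lq(8)] unfolding Lq_space_iff by blast
          show "integrable lebesgue (\<lambda>x. L powr q * norm (indicat_real ?I x *\<^sub>R (B n x - A x)) powr q)"
            using Lq_space_diff[OF q0 Lq(1)[of n] Lq(3)] unfolding Lq_space_iff by simp
          show "norm (indicat_real ?I x *\<^sub>R (F (B n x) - F (A x))) powr q
            \<le> L powr q * norm (indicat_real ?I x *\<^sub>R (B n x - A x)) powr q" for x
          proof (cases "x \<in> ?I")
            case True
            then have "\<bar>F (B n x) - F (A x)\<bar> \<le> L * norm (B n x - A x)"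
              by (intro L K A B(1))
            then show ?thesis
              using True q0 L(1) by (simp add: powr_mono2 flip: powr_mult)
          qed simp
        qed
        also have "\<dots> \<le> L powr q * (1 / 2) ^ n"
          using mass(1)[of n] by (intro mult_left_mono) auto
        finally show ?thesis .
      qed
      have "(\<lambda>n. L powr q * (1 / 2) ^ n) \<longlonglongrightarrow> L powr q * 0"
        by (intro tendsto_intros) simp
      then have "(\<lambda>n. L powr q * (1 / 2) ^ n) \<longlonglongrightarrow> 0" by simp
      then show ?thesis
        by (rule tendsto_sandwich[OF _ _ tendsto_const, rotated 2]) (use le in \<open>auto simp: Lq_mass_nonneg\<close>)
    qed
    ultimately have "(\<lambda>n. Lq_norm q ?I (\<lambda>x. F (B n x) - F (A x)) + Lq_norm q ?I (\<lambda>x. c n x - k x)) \<longlonglongrightarrow> 0 + 0"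
      unfolding Lq_norm_eq_mass using q
      by (intro tendsto_add tendsto_zero_powrI[OF _ tendsto_const]) (auto simp: Lq_mass_nonneg)
    moreover have "sobolev_dist q ?I (\<lambda>x. F (B n x)) (\<lambda>x. F (A x))
        = Lq_norm q ?I (\<lambda>x. F (B n x) - F (A x)) + Lq_norm q ?I (\<lambda>x. c n x - k x)" for n
      unfolding sobolev_dist_def by (rule sobolev_norm_eq[OF q sobolev_pair_diff[OF q0 c(1) k(1)]])
    ultimately have "(\<lambda>n. sobolev_dist q ?I (\<lambda>x. F (B n x)) (\<lambda>x. F (A x))) \<longlonglongrightarrow> 0" by simp
    then have "\<epsilon> \<le> 0"
      by (rule LIMSEQ_le_const) (use B(3) in blast)
    then show False using \<open>0 < \<epsilon>\<close> by simp
  qed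
  ultimately show ?thesis by blast
qed

section \<open>Singular values\<close>

lemma bounded_bilinear_matrix_vector_mult:
  "bounded_bilinear ((*v) :: complex^'n^'m \<Rightarrow> complex^'n \<Rightarrow> complex^'m)"
  by (simp flip: bilinear_conv_bounded_bilinear
      add: bilinear_def linear_iff matrix_vector_mult_def vec_eq_iff sum.distrib algebra_simps
        sum_distrib_left scaleR_sum_right)

lemma bounded_bilinear_matrix_matrix_mult:
  "bounded_bilinear ((**) :: complex^'n^'m \<Rightarrow> complex^'p^'n \<Rightarrow> complex^'p^'m)"
  by (simp flip: bilinear_conv_bounded_bilinear
      add: bilinear_def linear_iff matrix_matrix_mult_def vec_eq_iff sum.distrib algebra_simps
        sum_distrib_left scaleR_sum_right)

text \<open>The hermitian inner product, linear in the first argument. Its real part is the ambient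
  real inner product, but the complex form is what shows that Gram eigenvalues are real.\<close>

definition cinner :: "complex^'n \<Rightarrow> complex^'n \<Rightarrow> complex" where
  "cinner x y = (\<Sum>i\<in>UNIV. x $ i * cnj (y $ i))"

lemma cinner_self: "cinner x x = of_real ((norm x)\<^sup>2)"
proof -
  have "(norm x)\<^sup>2 = (\<Sum>i\<in>UNIV. (cmod (x $ i))\<^sup>2)"
    by (simp add: norm_vec_def L2_set_def sum_nonneg)
  then show ?thesis by (simp only: cinner_def complex_norm_square of_real_sum)
qed

lemma cinner_conj_transpose: "cinner (conj_transpose B *v x) y = cinner x (B *v y)"
proof -
  have "cinner (conj_transpose B *v x) y = (\<Sum>i\<in>UNIV. \<Sum>j\<in>UNIV. cnj (B $ j $ i) * x $ j * cnj (y $ i))"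
    by (simp add: cinner_def matrix_vector_mult_def conj_transpose_def sum_distrib_right)
  also have "\<dots> = (\<Sum>j\<in>UNIV. \<Sum>i\<in>UNIV. cnj (B $ j $ i) * x $ j * cnj (y $ i))"
    by (rule sum.swap)
  also have "\<dots> = cinner x (B *v y)"
    by (simp add: cinner_def matrix_vector_mult_def sum_distrib_left mult.assoc mult.left_commute)
  finally show ?thesis .
qed

lemma Re_cinner: "Re (cinner x y) = x \<bullet> y"
  by (simp add: cinner_def inner_vec_def inner_complex_def)

lemma inner_gram: "(conj_transpose B ** B *v x) \<bullet> y = (B *v x) \<bullet> (B *v y)"
  by (simp flip: Re_cinner matrix_vector_mul_assoc add: cinner_conj_transpose)

lemma matrix_vector_mult_scaleR_right: "(B :: complex^'n^'m) *v (c *\<^sub>R x) = c *\<^sub>R (B *v x)"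
  by (rule bounded_bilinear.scaleR_right[OF bounded_bilinear_matrix_vector_mult])

lemma matrix_vector_mult_of_real:
  "of_real c *s (x :: complex^'n) = c *\<^sub>R x"
  by (simp add: vec_eq_iff) (simp add: scaleR_conv_of_real)

section \<open>The characteristic polynomial and the eigenvalues of the Gram matrix\<close>

lemma poly_charpoly: "poly (charpoly M) z = det (mat z - M)"
proof -
  have *: "poly (\<Prod>i\<in>UNIV. (if i = p i then [:0, 1:] else 0) - [:M $ i $ p i:]) z
      = (\<Prod>i\<in>UNIV. (mat z - M) $ i $ p i)" for p :: "'a \<Rightarrow> 'a"
    by (auto simp: poly_prod mat_def intro!: prod.cong)
  have "poly (charpoly M) z = (\<Sum>p | p permutes UNIV. of_int (sign p) * (\<Prod>i\<in>UNIV. (mat z - M) $ i $ p i))"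
    unfolding charpoly_def det_def by (simp only: poly_sum poly_mult poly_of_int * vec_lambda_beta)
  then show ?thesis by (simp add: det_def)
qed

lemma poly_charpoly_eq_0_iff:
  fixes M :: "complex^'d^'d"
  shows "poly (charpoly M) z = 0 \<longleftrightarrow> (\<exists>x. x \<noteq> 0 \<and> M *v x = z *s x)"
proof -
  have "mat z *v x = z *s x" for x :: "complex^'d"
    by (simp add: vec_eq_iff matrix_vector_mult_def mat_def if_distrib[of "\<lambda>a. a * _"] cong: if_cong)
  then have "(mat z - M) *v x = 0 \<longleftrightarrow> M *v x = z *s x" for x
    by (auto simp: matrix_vector_mult_diff_rdistrib)
  moreover have "det (mat z - M) = 0 \<longleftrightarrow> \<not> (\<forall>x. (mat z - M) *v x = 0 \<longrightarrow> x = 0)"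
    by (metis invertible_det_nz invertible_left_inverse matrix_left_invertible_ker)
  ultimately show ?thesis by (auto simp: poly_charpoly)
qed

text \<open>In the Leibniz sum only the identity permutation collects a linear factor from every
  row; any other permutation misses a diagonal entry and stays below that degree. This fixes the
  number of singular values and shows that the polynomial is nonzero.\<close>

lemma degree_charpoly:
  fixes M :: "complex^'d^'d"
  shows "degree (charpoly M) = CARD('d)"
proof -
  define t where "t p = (\<Prod>i\<in>UNIV. (if i = p i then [:0, 1:] else 0) - [:M $ i $ p i:])" for p :: "'d \<Rightarrow> 'd"
  have charpoly: "charpoly M = (\<Sum>p | p permutes UNIV. of_int (sign p) * t p)"
    unfolding charpoly_def det_def t_def by simp
  have deg1: "degree ((if b then [:0, 1:] else 0) - [:m:]) = (if b then 1 else 0)" for b and m :: complex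
    by simp
  have small: "degree (of_int (sign p) * t p) < CARD('d)" if "p permutes UNIV" "p \<noteq> id" for p
  proof -
    obtain j where j: "p j \<noteq> j" using \<open>p \<noteq> id\<close> by (metis ext id_apply)
    have "degree (of_int (sign p) * t p) \<le> degree (t p)"
      by (rule order_trans[OF degree_mult_le]) simp
    also have "\<dots> \<le> (\<Sum>i\<in>UNIV. degree ((if i = p i then [:0, 1:] else 0) - [:M $ i $ p i:]))"
      unfolding t_def by (rule degree_prod_sum_le[unfolded comp_def]) simp
    also have "\<dots> = (\<Sum>i\<in>UNIV. if i = p i then 1 else 0)"
      by (simp only: deg1)
    also have "\<dots> < (\<Sum>i\<in>(UNIV :: 'd set). 1)"
      by (rule sum_strict_mono_ex1) (use j in \<open>auto intro!: exI[of _ j]\<close>)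
    finally show ?thesis by simp
  qed
  have id: "degree (t id) = CARD('d)" "t id \<noteq> 0"
  proof -
    show "t id \<noteq> 0" by (simp add: t_def)
    show "degree (t id) = CARD('d)"
      unfolding t_def by (subst degree_prod_eq_sum_degree) simp_all
  qed
  have "charpoly M = t id + (\<Sum>p\<in>{p. p permutes UNIV} - {id}. of_int (sign p) * t p)"
    unfolding charpoly
    by (subst sum.remove[of _ id]) (auto simp: permutes_id finite_permutations sign_id)
  moreover have "degree (\<Sum>p\<in>{p. p permutes (UNIV :: 'd set)} - {id}. of_int (sign p) * t p) < CARD('d)"
    by (rule degree_sum_less) (auto intro: small)
  ultimately show ?thesis
    using id by (simp add: degree_add_eq_left)
qed

text \<open>Pair the eigenvector equation with \<open>x\<close> and move
  \<open>conj_transpose B\<close> to the other side. The eigenvalue is thus real and nonnegative,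
  which justifies \<open>Re\<close> and \<open>sqrt\<close> in
  \<open>singular_values\<close>.\<close>

lemma gram_eigenvalue:
  fixes B :: "complex^'d^'d"
  assumes "x \<noteq> 0" "conj_transpose B ** B *v x = z *s x"
  shows "z = of_real ((norm (B *v x) / norm x)\<^sup>2)"
proof -
  have "z * cinner x x = cinner (conj_transpose B ** B *v x) x"
    by (simp add: assms(2) cinner_def sum_distrib_left mult.assoc)
  also have "\<dots> = cinner (B *v x) (B *v x)"
    by (simp flip: matrix_vector_mul_assoc add: cinner_conj_transpose)
  finally have "z * of_real ((norm x)\<^sup>2) = of_real ((norm (B *v x))\<^sup>2)"
    by (simp only: cinner_self)
  then show ?thesis using assms(1) by (simp add: field_simps power_divide)
qed

text \<open>A first variation argument. The form \<open>q\<close> has constant sign and vanishes at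
  \<open>x\<close>, so \<open>x\<close> is an extremum of it. The vector \<open>w\<close> is half
  the gradient of \<open>q\<close> there, and moving along \<open>w\<close> and \<open>- w\<close>
  would produce both signs if \<open>w\<close> were nonzero.\<close>

lemma extremal_is_eigenvector:
  fixes B :: "complex^'d^'d"
  assumes ext: "(\<forall>y. \<mu> * (norm y)\<^sup>2 \<le> (norm (B *v y))\<^sup>2) \<or> (\<forall>y. (norm (B *v y))\<^sup>2 \<le> \<mu> * (norm y)\<^sup>2)"
    and eq: "(norm (B *v x))\<^sup>2 = \<mu> * (norm x)\<^sup>2"
  shows "conj_transpose B ** B *v x = of_real \<mu> *s x"
proof -
  define w where "w = conj_transpose B ** B *v x - \<mu> *\<^sub>R x"
  define q where "q y = (norm (B *v y))\<^sup>2 - \<mu> * (norm y)\<^sup>2" for y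
  have expand: "q (x + t *\<^sub>R w) = 2 * t * (norm w)\<^sup>2 + t\<^sup>2 * q w" for t
  proof -
    have sq: "(norm (a + t *\<^sub>R b))\<^sup>2 = (norm a)\<^sup>2 + 2 * t * (a \<bullet> b) + t\<^sup>2 * (norm b)\<^sup>2" for a b :: "complex^'d"
      unfolding power2_norm_eq_inner
      by (simp add: inner_add_left inner_add_right inner_commute[of b a] power2_eq_square algebra_simps)
    have "(norm (B *v (x + t *\<^sub>R w)))\<^sup>2 = (norm (B *v x))\<^sup>2 + 2 * t * ((B *v x) \<bullet> (B *v w)) + t\<^sup>2 * (norm (B *v w))\<^sup>2"
      by (simp add: matrix_vector_right_distrib matrix_vector_mult_scaleR_right sq)
    moreover have "(norm (x + t *\<^sub>R w))\<^sup>2 = (norm x)\<^sup>2 + 2 * t * (x \<bullet> w) + t\<^sup>2 * (norm w)\<^sup>2"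
      by (rule sq)
    moreover have "(B *v x) \<bullet> (B *v w) - \<mu> * (x \<bullet> w) = (norm w)\<^sup>2"
    proof -
      have "(B *v x) \<bullet> (B *v w) - \<mu> * (x \<bullet> w) = (conj_transpose B ** B *v x - \<mu> *\<^sub>R x) \<bullet> w"
        by (simp add: inner_gram inner_diff_left)
      then show ?thesis unfolding w_def[symmetric] power2_norm_eq_inner .
    qed
    ultimately show ?thesis
      using eq unfolding q_def by (simp add: algebra_simps)
  qed
  have "w = 0"
  proof (rule ccontr)
    assume "w \<noteq> 0"
    then have n: "0 < (norm w)\<^sup>2" by simp
    have sgn: "(\<forall>y. 0 \<le> q y) \<or> (\<forall>y. q y \<le> 0)"
      using ext by (simp add: q_def)
    \<comment> \<open>Small enough for the quadratic term \<open>t\<^sup>2 * q w\<close> to stay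
      below \<open>t * (norm w)\<^sup>2\<close>; the \<open>+ 1\<close> covers
      \<open>q w = 0\<close>.\<close>
    define t where "t = (norm w)\<^sup>2 / (\<bar>q w\<bar> + 1)"
    have t: "0 < t" using n by (simp add: t_def)
    have "\<bar>t\<^sup>2 * q w\<bar> < t * (norm w)\<^sup>2"
    proof -
      have "t * \<bar>q w\<bar> < t * (\<bar>q w\<bar> + 1)" using t by simp
      also have "\<dots> = (norm w)\<^sup>2" by (simp add: t_def)
      finally have "t * (t * \<bar>q w\<bar>) < t * (norm w)\<^sup>2" using t by simp
      then show ?thesis by (simp add: abs_mult power2_eq_square mult.assoc)
    qed
    moreover have "q (x + t *\<^sub>R w) = 2 * (t * (norm w)\<^sup>2) + t\<^sup>2 * q w"
      "q (x + (- t) *\<^sub>R w) = - 2 * (t * (norm w)\<^sup>2) + t\<^sup>2 * q w"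
      unfolding expand by simp_all
    moreover have "0 < t * (norm w)\<^sup>2" using t n by simp
    ultimately have "0 < q (x + t *\<^sub>R w)" "q (x + (- t) *\<^sub>R w) < 0"
      by linarith+
    with sgn show False by (meson not_le)
  qed
  then show ?thesis by (simp add: w_def matrix_vector_mult_of_real)
qed

text \<open>Singular values are the stretching ratios of \<open>B\<close> at eigenvectors of its
  Gram matrix. Multiplicities matter only for the length of the list; the extreme values are read
  off from the set.\<close>

lemma
  fixes B :: "complex^'d^'d"
  shows length_singular_values: "length (singular_values B) = CARD('d)"
    and set_singular_values: "set (singular_values B) =
      {norm (B *v x) / norm x | x z. x \<noteq> 0 \<and> conj_transpose B ** B *v x = z *s x}"
    and sorted_singular_values: "sorted (rev (singular_values B))"
proof -
  let ?p = "charpoly (conj_transpose B ** B)"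
  have "?p \<noteq> 0" using degree_charpoly[of "conj_transpose B ** B"] by auto
  have "size (mset (singular_values B)) = CARD('d)"
    by (simp add: singular_values_def size_proots_complex degree_charpoly)
  then show "length (singular_values B) = CARD('d)" by simp
  show "sorted (rev (singular_values B))" by (simp add: singular_values_def)
  have "set (singular_values B) = (\<lambda>z. sqrt (Re z)) ` {z. poly ?p z = 0}"
    using \<open>?p \<noteq> 0\<close> by (simp add: singular_values_def)
  also have "\<dots> = {norm (B *v x) / norm x | x z. x \<noteq> 0 \<and> conj_transpose B ** B *v x = z *s x}"
    (is "?L = ?R")
  proof -
    have *: "sqrt (Re z) = norm (B *v x) / norm x"
      if "x \<noteq> 0" "conj_transpose B ** B *v x = z *s x" for x z
      by (simp add: gram_eigenvalue[OF that])
    show ?thesis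
    proof (intro equalityI subsetI)
      fix s assume "s \<in> ?L"
      then obtain x z where "s = sqrt (Re z)" "x \<noteq> 0" "conj_transpose B ** B *v x = z *s x"
        by (auto simp: poly_charpoly_eq_0_iff)
      with * show "s \<in> ?R" by blast
    next
      fix s assume "s \<in> ?R"
      then obtain x z where s: "s = norm (B *v x) / norm x" "x \<noteq> 0" "conj_transpose B ** B *v x = z *s x"
        by blast
      then have "s = sqrt (Re z)" using * by simp
      moreover have "poly ?p z = 0" using s by (auto simp: poly_charpoly_eq_0_iff)
      ultimately show "s \<in> ?L" by blast
    qed
  qed
  finally show "set (singular_values B) = {norm (B *v x) / norm x | x z. x \<noteq> 0 \<and> conj_transpose B ** B *v x = z *s x}" .
qed

lemma sing_val_extremal:
  fixes B :: "complex^'d^'d"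
  assumes "s \<in> set (singular_values B)"
  shows "sing_val CARD('d) B \<le> s" "s \<le> sing_val 1 B"
    "sing_val 1 B \<in> set (singular_values B)" "sing_val CARD('d) B \<in> set (singular_values B)"
proof -
  let ?l = "singular_values B"
  have len: "length ?l = CARD('d)" "0 < CARD('d)"
    by (simp_all add: length_singular_values)
  obtain i where i: "i < CARD('d)" "s = ?l ! i"
    using assms len by (metis in_set_conv_nth)
  have anti: "?l ! k \<le> ?l ! j" if "j \<le> k" "k < CARD('d)" for j k
    using sorted_rev_nth_mono[OF sorted_singular_values[of B] that(1)] that len by simp
  show "sing_val CARD('d) B \<le> s" "s \<le> sing_val 1 B"
    using anti[of i "CARD('d) - 1"] anti[of 0 i] i by (simp_all add: sing_val_def)
  show "sing_val 1 B \<in> set (singular_values B)" "sing_val CARD('d) B \<in> set (singular_values B)"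
    using len by (simp_all add: sing_val_def)
qed

section \<open>Extreme singular values as extreme stretching ratios\<close>

text \<open>Compactness of the unit sphere gives extremal unit vectors; homogeneity extends the
  inequalities to all vectors.\<close>

lemma norm_matrix_vector_attains:
  fixes B :: "complex^'d^'d"
  obtains x y where "norm x = 1" "norm y = 1"
    "\<And>v. norm (B *v v) \<le> norm (B *v x) * norm v" "\<And>v. norm (B *v y) * norm v \<le> norm (B *v v)"
proof -
  have bl: "bounded_linear ((*v) B)"
    by (rule bounded_bilinear.bounded_linear_right[OF bounded_bilinear_matrix_vector_mult])
  have cont: "continuous_on (sphere 0 1) (\<lambda>x. norm (B *v x))"
    by (intro continuous_intros bounded_linear.continuous_on[OF bl])
  have ne: "sphere (0 :: complex^'d) 1 \<noteq> {}" by simp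
  obtain x where x: "norm x = 1" "\<And>v. norm v = 1 \<Longrightarrow> norm (B *v v) \<le> norm (B *v x)"
    using continuous_attains_sup[OF compact_sphere ne cont] by auto
  obtain y where y: "norm y = 1" "\<And>v. norm v = 1 \<Longrightarrow> norm (B *v y) \<le> norm (B *v v)"
    using continuous_attains_inf[OF compact_sphere ne cont] by auto
  have *: "norm (B *v v) = norm v * norm (B *v (v /\<^sub>R norm v))" "norm (v /\<^sub>R norm v) = 1" if "v \<noteq> 0" for v
    using that by (simp_all add: matrix_vector_mult_scaleR_right)
  show ?thesis
  proof (rule that[OF x(1) y(1)])
    fix v
    show "norm (B *v v) \<le> norm (B *v x) * norm v"
    proof (cases "v = 0")
      case False
      then show ?thesis using x(2)[OF *(2)[OF False]] *(1)[OF False] by (metis mult.commute mult_left_mono norm_ge_zero)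
    qed simp
    show "norm (B *v y) * norm v \<le> norm (B *v v)"
    proof (cases "v = 0")
      case False
      then show ?thesis using y(2)[OF *(2)[OF False]] *(1)[OF False] by (metis mult.commute mult_left_mono norm_ge_zero)
    qed simp
  qed
qed

text \<open>Unit vectors of maximal and minimal stretching are eigenvectors of the Gram matrix, so
  their ratios are singular values; conversely every singular value is such a ratio and lies between
  them. The first and last list entries are identified in this way without diagonalizing.\<close>

lemma
  fixes B :: "complex^'d^'d"
  shows sing_val_1_eq_onorm: "sing_val 1 B = onorm ((*v) B)"
    and sing_val_last_le: "sing_val CARD('d) B * norm v \<le> norm (B *v v)"
    and sing_val_last_attained: "\<exists>y. norm y = 1 \<and> norm (B *v y) = sing_val CARD('d) B"
proof -
  obtain x y where x: "norm x = 1" "\<And>v. norm (B *v v) \<le> norm (B *v x) * norm v"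
    and y: "norm y = 1" "\<And>v. norm (B *v y) * norm v \<le> norm (B *v v)"
    by (rule norm_matrix_vector_attains[of B]) blast
  have ex: "conj_transpose B ** B *v x = of_real ((norm (B *v x))\<^sup>2) *s x"
  proof (rule extremal_is_eigenvector)
    have "(norm (B *v v))\<^sup>2 \<le> (norm (B *v x))\<^sup>2 * (norm v)\<^sup>2" for v
      using power_mono[OF x(2), of v 2] by (simp add: power_mult_distrib)
    then show "(\<forall>v. (norm (B *v x))\<^sup>2 * (norm v)\<^sup>2 \<le> (norm (B *v v))\<^sup>2) \<or>
       (\<forall>v. (norm (B *v v))\<^sup>2 \<le> (norm (B *v x))\<^sup>2 * (norm v)\<^sup>2)" by blast
  qed (simp add: x(1))
  have ey: "conj_transpose B ** B *v y = of_real ((norm (B *v y))\<^sup>2) *s y"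
  proof (rule extremal_is_eigenvector)
    have "(norm (B *v y))\<^sup>2 * (norm v)\<^sup>2 \<le> (norm (B *v v))\<^sup>2" for v
      using power_mono[OF y(2), of v 2] by (simp add: power_mult_distrib)
    then show "(\<forall>v. (norm (B *v y))\<^sup>2 * (norm v)\<^sup>2 \<le> (norm (B *v v))\<^sup>2) \<or>
       (\<forall>v. (norm (B *v v))\<^sup>2 \<le> (norm (B *v y))\<^sup>2 * (norm v)\<^sup>2)" by blast
  qed (simp add: y(1))
  have nz: "x \<noteq> 0" "y \<noteq> 0" using x(1) y(1) by auto
  have mem: "norm (B *v x) \<in> set (singular_values B)" "norm (B *v y) \<in> set (singular_values B)"
    unfolding set_singular_values using ex ey nz x(1) y(1) by (metis (mono_tags, lifting) div_by_1 mem_Collect_eq)+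
  have bnd: "norm (B *v y) \<le> s \<and> s \<le> norm (B *v x)" if s: "s \<in> set (singular_values B)" for s
  proof -
    obtain v where v: "v \<noteq> 0" "s = norm (B *v v) / norm v"
      using s unfolding set_singular_values by blast
    then show ?thesis using x(2)[of v] y(2)[of v] by (simp add: pos_divide_le_eq pos_le_divide_eq)
  qed
  have s1: "sing_val 1 B = norm (B *v x)"
    using sing_val_extremal[OF mem(1)] bnd by (meson order_antisym)
  have sd: "sing_val CARD('d) B = norm (B *v y)"
    using sing_val_extremal[OF mem(2)] bnd by (meson order_antisym)
  show "sing_val CARD('d) B * norm v \<le> norm (B *v v)" using y(2) sd by simp
  show "\<exists>y. norm y = 1 \<and> norm (B *v y) = sing_val CARD('d) B" using sd y(1) by auto
  have "bounded_linear ((*v) B)"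
    by (rule bounded_bilinear.bounded_linear_right[OF bounded_bilinear_matrix_vector_mult])
  then have "norm (B *v x) \<le> onorm ((*v) B)"
    using onorm[of "(*v) B" x] x(1) by simp
  moreover have "onorm ((*v) B) \<le> norm (B *v x)"
    by (rule onorm_le) (rule x(2))
  ultimately show "sing_val 1 B = onorm ((*v) B)" using s1 by simp
qed

lemma invertible_iff_sing_val_last_pos:
  fixes B :: "complex^'d^'d"
  shows "invertible B \<longleftrightarrow> 0 < sing_val CARD('d) B"
proof -
  have ker: "invertible B \<longleftrightarrow> (\<forall>x. B *v x = 0 \<longrightarrow> x = 0)"
    by (simp add: invertible_left_inverse matrix_left_invertible_ker)
  obtain y where y: "norm y = 1" "norm (B *v y) = sing_val CARD('d) B"
    using sing_val_last_attained by blast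
  show ?thesis
  proof
    assume "invertible B"
    moreover have "y \<noteq> 0" using y(1) by auto
    ultimately have "B *v y \<noteq> 0" using ker by blast
    then show "0 < sing_val CARD('d) B" by (simp flip: y(2))
  next
    assume pos: "0 < sing_val CARD('d) B"
    have "x = 0" if "B *v x = 0" for x
    proof (rule ccontr)
      assume "x \<noteq> 0"
      then have "0 < sing_val CARD('d) B * norm x" using pos by simp
      with sing_val_last_le[of B x] that show False by simp
    qed
    then show "invertible B" using ker by blast
  qed
qed

lemma matrix_inv_mult:
  fixes B :: "complex^'d^'d"
  assumes "invertible B"
  shows "matrix_inv B ** B = mat 1" "B ** matrix_inv B = mat 1"
    "matrix_inv B *v (B *v v) = v" "B *v (matrix_inv B *v v) = v"
proof -
  show 1: "matrix_inv B ** B = mat 1" and 2: "B ** matrix_inv B = mat 1"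
    using someI_ex[OF assms[unfolded invertible_def]] by (simp_all add: matrix_inv_def)
  show "matrix_inv B *v (B *v v) = v" "B *v (matrix_inv B *v v) = v"
    by (simp_all add: matrix_vector_mul_assoc 1 2)
qed

text \<open>The lower bound \<open>?s * norm v \<le> norm (B *v v)\<close> says that the inverse
  stretches by at most \<open>1 / ?s\<close>, and a minimizing vector \<open>y\<close> shows that
  the inverse attains this ratio at \<open>B *v y\<close>.\<close>

lemma cond_number_eq:
  fixes B :: "complex^'d^'d"
  assumes inv: "invertible B"
  shows "cond_number B = onorm ((*v) B) * onorm ((*v) (matrix_inv B))"
proof -
  let ?s = "sing_val CARD('d) B"
  have pos: "0 < ?s" using inv invertible_iff_sing_val_last_pos by blast
  have bl: "bounded_linear ((*v) (matrix_inv B))"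
    by (rule bounded_bilinear.bounded_linear_right[OF bounded_bilinear_matrix_vector_mult])
  have "onorm ((*v) (matrix_inv B)) = 1 / ?s"
  proof (rule antisym)
    show "onorm ((*v) (matrix_inv B)) \<le> 1 / ?s"
    proof (rule onorm_le)
      fix v
      show "norm (matrix_inv B *v v) \<le> 1 / ?s * norm v"
        using sing_val_last_le[of B "matrix_inv B *v v"] pos matrix_inv_mult(4)[OF inv, of v]
        by (simp add: field_simps)
    qed
    obtain y where y: "norm y = 1" "norm (B *v y) = ?s"
      using sing_val_last_attained by blast
    show "1 / ?s \<le> onorm ((*v) (matrix_inv B))"
      using onorm[OF bl, of "B *v y"] matrix_inv_mult(3)[OF inv, of y] y pos
      by (simp add: field_simps)
  qed
  then show ?thesis unfolding cond_number_def sing_val_1_eq_onorm by simp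
qed

section \<open>Convexity of the operator norm\<close>

text \<open>The first two properties give convexity, the third a Lipschitz bound with respect to the
  ambient norm. Nothing further about the operator norm enters the derivative arguments.\<close>

locale dominated_seminorm =
  fixes N :: "'v::real_normed_vector \<Rightarrow> real" and C :: real
  assumes triangle: "N (x + y) \<le> N x + N y"
    and scale: "N (r *\<^sub>R x) = \<bar>r\<bar> * N x"
    and le_norm: "N x \<le> C * norm x"
begin

lemma diff_le: "\<bar>N x - N y\<bar> \<le> N (x - y)"
proof -
  have "N x \<le> N (x - y) + N y" using triangle[of "x - y" y] by simp
  moreover have "N y \<le> N (y - x) + N x" using triangle[of "y - x" x] by simp
  moreover have "N (y - x) = N (x - y)" using scale[of "-1" "x - y"] by simp
  ultimately show ?thesis by simp
qed

lemma lipschitz: "\<bar>N x - N y\<bar> \<le> C * norm (x - y)"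
  using diff_le le_norm order_trans by blast

lemma tendsto_seminorm:
  assumes "(f \<longlongrightarrow> l) F"
  shows "((\<lambda>x. N (f x)) \<longlongrightarrow> N l) F"
proof -
  have "((\<lambda>x. C * norm (f x - l)) \<longlongrightarrow> C * 0) F"
    by (intro tendsto_mult tendsto_const tendsto_norm_zero) (simp add: LIM_zero assms)
  then have lim: "((\<lambda>x. C * norm (f x - l)) \<longlongrightarrow> 0) F" by simp
  have le: "\<forall>\<^sub>F x in F. norm (N (f x) - N l) \<le> C * norm (f x - l)"
    by (rule always_eventually) (simp add: lipschitz)
  show ?thesis
    by (rule LIM_zero_cancel[OF Lim_null_comparison[OF le lim]])
qed

text \<open>Both signs of \<open>t\<close> are meant, so that a limit at 0 is a two-sided
  directional derivative.\<close>

definition slope :: "'v \<Rightarrow> 'v \<Rightarrow> real \<Rightarrow> real" where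
  "slope y v t = (N (y + t *\<^sub>R v) - N y) / t"

text \<open>Monotonicity of difference quotients of a convex function: the nearer point
  \<open>y + s *\<^sub>R v\<close> is the convex combination of \<open>y\<close> and
  \<open>y + t *\<^sub>R v\<close> with weight \<open>s / t\<close>.\<close>

lemma slope_mono:
  assumes "0 < s" "s \<le> t"
  shows "slope y v s \<le> slope y v t"
proof -
  have r: "0 \<le> s / t" "s / t \<le> 1" using assms by auto
  have "y + s *\<^sub>R v = (1 - s / t) *\<^sub>R y + (s / t) *\<^sub>R (y + t *\<^sub>R v)"
    using assms by (simp add: algebra_simps)
  then have "N (y + s *\<^sub>R v) \<le> (1 - s / t) * N y + (s / t) * N (y + t *\<^sub>R v)"
    using triangle[of "(1 - s / t) *\<^sub>R y" "(s / t) *\<^sub>R (y + t *\<^sub>R v)"] r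
    by (simp only: scale abs_of_nonneg diff_ge_0_iff_ge)
  then have "N (y + s *\<^sub>R v) - N y \<le> (s / t) * (N (y + t *\<^sub>R v) - N y)"
    by (simp add: algebra_simps)
  then show ?thesis
    using assms by (simp add: slope_def field_simps)
qed

lemma slope_minus: "slope y v (- t) = - slope y (- v) t"
  by (simp add: slope_def)

lemma slope_ge: "0 < t \<Longrightarrow> - N v \<le> slope y v t"
  using diff_le[of "y + t *\<^sub>R v" y] scale[of t v] by (simp add: slope_def field_simps)

text \<open>The quotients decrease as the positive step shrinks and are bounded below by
  \<open>- N v\<close>, so they tend to their infimum.\<close>

lemma slope_tendsto_right: "\<exists>r. (slope y v \<longlongrightarrow> r) (at_right 0)"
proof -
  define r where "r = Inf (slope y v ` {0<..})"
  have bdd: "bdd_below (slope y v ` {0<..})"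
    by (rule bdd_belowI2[of _ "- N v"]) (simp add: slope_ge)
  have "(slope y v \<longlongrightarrow> r) (at_right 0)"
  proof (rule decreasing_tendsto)
    have "r \<le> slope y v t" if "0 < t" for t
      unfolding r_def using bdd that by (intro cInf_lower) auto
    then show "\<forall>\<^sub>F t in at_right 0. r \<le> slope y v t"
      by (auto simp: eventually_at_right_field intro!: exI[of _ 1])
    fix z assume "r < z"
    then obtain t where t: "0 < t" "slope y v t < z"
      unfolding r_def using cInf_lessD[of "slope y v ` {0<..}" z] by auto
    then show "\<forall>\<^sub>F t in at_right 0. slope y v t < z"
      unfolding eventually_at_right_field
    proof (intro exI[of _ t] conjI allI impI)
      show "slope y v s < z" if "0 < s" "s < t" for s
        by (rule le_less_trans[OF slope_mono t(2)]) (use that in simp_all)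
    qed
  qed
  then show ?thesis ..
qed

lemma slope_tendsto_left: "\<exists>l. (slope y v \<longlongrightarrow> l) (at_left 0)"
proof -
  obtain r where "(slope y (- v) \<longlongrightarrow> r) (at_right 0)"
    using slope_tendsto_right by blast
  then have "((\<lambda>t. - slope y v (- t)) \<longlongrightarrow> r) (at_right 0)"
    by (simp add: slope_minus)
  then have "((\<lambda>t. slope y v (- t)) \<longlongrightarrow> - r) (at_right 0)"
    using tendsto_minus_cancel_left by fastforce
  then have "(slope y v \<longlongrightarrow> - r) (at_left 0)"
    using filterlim_at_left_to_right[of "slope y v" "nhds (- r)" 0] by simp
  then show ?thesis ..
qed

text \<open>By convexity the difference quotients of \<open>N\<close> bound the derivative from both sides, which
  makes two-sided directional derivatives stable under limits.\<close>

lemma directional_derivative_closed: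
  assumes y: "y \<longlonglongrightarrow> y0" and v: "v \<longlonglongrightarrow> v0"
    and c: "\<And>n. (slope (y n) (v n) \<longlongrightarrow> c n) (at 0)" and c0: "(slope y0 v0 \<longlongrightarrow> c0) (at 0)"
  shows "c \<longlonglongrightarrow> c0"
proof -
  have upper: "c n \<le> slope (y n) (v n) t" if "0 < t" for n t
  proof (rule tendsto_upperbound)
    show "(slope (y n) (v n) \<longlongrightarrow> c n) (at_right 0)"
      by (rule filterlim_mono[OF c order_refl]) (simp add: at_le)
    show "\<forall>\<^sub>F s in at_right 0. slope (y n) (v n) s \<le> slope (y n) (v n) t"
      unfolding eventually_at_right_field using that by (intro exI[of _ t]) (auto intro: slope_mono)
  qed simp
  have lower: "slope (y n) (v n) (- t) \<le> c n" if "0 < t" for n t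
  proof (rule tendsto_lowerbound)
    show "(slope (y n) (v n) \<longlongrightarrow> c n) (at_left 0)"
      by (rule filterlim_mono[OF c order_refl]) (simp add: at_le)
    have "slope (y n) (v n) (- t) \<le> slope (y n) (v n) s" if "- t < s" "s < 0" for s
      using slope_mono[of "- s" t "y n" "- v n"] that by (simp add: slope_minus[of _ _ t] slope_minus[of _ _ "- s", simplified])
    then show "\<forall>\<^sub>F s in at_left 0. slope (y n) (v n) (- t) \<le> slope (y n) (v n) s"
      unfolding eventually_at_left_field using that by (intro exI[of _ "- t"]) auto
  qed simp
  \<comment> \<open>At a fixed nonzero step the quotient is continuous in base point and direction.
    A step is fixed at which the quotient of the limit data satisfies the desired strict bound; for
    large \<open>n\<close> the bound passes to the quotient of the approximations and then to
    \<open>c n\<close> by \<open>upper\<close> or \<open>lower\<close>.\<close>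
  have conv: "(\<lambda>n. slope (y n) (v n) t) \<longlonglongrightarrow> slope y0 v0 t" if "t \<noteq> 0" for t
    unfolding slope_def using that by (intro tendsto_intros tendsto_seminorm y v) auto
  show ?thesis
    unfolding order_tendsto_iff
  proof (intro conjI allI impI)
    fix z assume "z < c0"
    then have "\<forall>\<^sub>F t in at_left 0. z < slope y0 v0 t"
      using order_tendstoD(1)[OF filterlim_mono[OF c0 order_refl at_le]] by simp
    then obtain b where b: "b < 0" "\<And>t. b < t \<Longrightarrow> t < 0 \<Longrightarrow> z < slope y0 v0 t"
      unfolding eventually_at_left_field by blast
    define t where "t = - b / 2"
    have t: "0 < t" "z < slope y0 v0 (- t)" using b by (auto simp: t_def)
    then have "\<forall>\<^sub>F n in sequentially. z < slope (y n) (v n) (- t)"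
      by (intro order_tendstoD(1)[OF conv]) auto
    then show "\<forall>\<^sub>F n in sequentially. z < c n"
      by eventually_elim (rule less_le_trans[OF _ lower[OF t(1)]])
  next
    fix z assume "c0 < z"
    then have "\<forall>\<^sub>F t in at_right 0. slope y0 v0 t < z"
      using order_tendstoD(2)[OF filterlim_mono[OF c0 order_refl at_le]] by simp
    then obtain b where b: "0 < b" "\<And>t. 0 < t \<Longrightarrow> t < b \<Longrightarrow> slope y0 v0 t < z"
      unfolding eventually_at_right_field by blast
    define t where "t = b / 2"
    have t: "0 < t" "slope y0 v0 t < z" using b by (auto simp: t_def)
    then have "\<forall>\<^sub>F n in sequentially. slope (y n) (v n) t < z"
      by (intro order_tendstoD(2)[OF conv]) auto
    then show "\<forall>\<^sub>F n in sequentially. c n < z"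
      by eventually_elim (rule le_less_trans[OF upper[OF t(1)]])
  qed
qed

text \<open>Replacing the curve by its tangent line changes the quotient by at most \<open>C\<close>
  times the error of the quotient of \<open>X\<close>, which tends to 0. The filter \<open>F\<close>
  also covers the one-sided limits, which come before the two-sided one.\<close>

lemma curve_slope:
  assumes X: "(X has_vector_derivative X') (at x)" and F: "F \<le> at x"
  shows "((\<lambda>y. (N (X y) - N (X x)) /\<^sub>R (y - x)) \<longlongrightarrow> c) F \<longleftrightarrow> ((\<lambda>y. slope (X x) X' (y - x)) \<longlongrightarrow> c) F"
proof -
  have "((\<lambda>y. (X y - X x) /\<^sub>R (y - x)) \<longlongrightarrow> X') F"
    using X unfolding has_vector_derivative_iff_quotient by (rule filterlim_mono[OF _ order_refl F])
  then have "((\<lambda>y. C * norm ((X y - X x) /\<^sub>R (y - x) - X')) \<longlongrightarrow> C * 0) F"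
    by (intro tendsto_mult tendsto_const tendsto_norm_zero) (simp add: LIM_zero)
  then have lim: "((\<lambda>y. C * norm ((X y - X x) /\<^sub>R (y - x) - X')) \<longlongrightarrow> 0) F" by simp
  have le: "\<bar>(N (X y) - N (X x)) /\<^sub>R (y - x) - slope (X x) X' (y - x)\<bar> \<le> C * norm ((X y - X x) /\<^sub>R (y - x) - X')"
    if "y \<noteq> x" for y
  proof -
    have "(N (X y) - N (X x)) /\<^sub>R (y - x) - slope (X x) X' (y - x)
        = (N (X y) - N (X x + (y - x) *\<^sub>R X')) / (y - x)"
      by (simp add: slope_def divide_inverse algebra_simps)
    also have "\<bar>\<dots>\<bar> = \<bar>N (X y) - N (X x + (y - x) *\<^sub>R X')\<bar> / \<bar>y - x\<bar>"
      by (simp add: abs_divide)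
    also have "\<dots> \<le> C * norm (X y - (X x + (y - x) *\<^sub>R X')) / \<bar>y - x\<bar>"
      by (intro divide_right_mono lipschitz) simp
    also have "X y - (X x + (y - x) *\<^sub>R X') = (y - x) *\<^sub>R ((X y - X x) /\<^sub>R (y - x) - X')"
      using that by (simp add: scaleR_diff_right)
    also have "C * norm \<dots> / \<bar>y - x\<bar> = C * norm ((X y - X x) /\<^sub>R (y - x) - X')"
      using that by simp
    finally show ?thesis .
  qed
  have ne: "\<forall>\<^sub>F y in F. y \<noteq> x"
    using F by (rule filter_leD) (simp add: eventually_at_filter)
  have z': "((\<lambda>y. (N (X y) - N (X x)) /\<^sub>R (y - x) - slope (X x) X' (y - x)) \<longlongrightarrow> 0) F"
  proof (rule Lim_null_comparison[OF _ lim])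
    show "\<forall>\<^sub>F y in F. norm ((N (X y) - N (X x)) /\<^sub>R (y - x) - slope (X x) X' (y - x))
      \<le> C * norm ((X y - X x) /\<^sub>R (y - x) - X')"
      using ne by eventually_elim (simp only: real_norm_def, rule le)
  qed
  have z: "((\<lambda>y. slope (X x) X' (y - x) - (N (X y) - N (X x)) /\<^sub>R (y - x)) \<longlongrightarrow> 0) F"
    using tendsto_minus[OF z'] by simp
  show ?thesis
  proof
    assume "((\<lambda>y. (N (X y) - N (X x)) /\<^sub>R (y - x)) \<longlongrightarrow> c) F"
    from tendsto_add[OF z this] show "((\<lambda>y. slope (X x) X' (y - x)) \<longlongrightarrow> c) F"
      by (simp only: diff_add_cancel add_0)
  next
    assume "((\<lambda>y. slope (X x) X' (y - x)) \<longlongrightarrow> c) F"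
    from tendsto_add[OF z' this] show "((\<lambda>y. (N (X y) - N (X x)) /\<^sub>R (y - x)) \<longlongrightarrow> c) F"
      by (simp only: diff_add_cancel add_0)
  qed
qed

text \<open>The countability lemma is applied to the real function
  \<open>\<lambda>y. N (X y)\<close>. The exceptional set therefore consists of parameters and is
  negligible however often the curve visits points where \<open>N\<close> has no gradient.\<close>

lemma curve_AE_directional_derivative:
  assumes X: "AE x in lebesgue. x \<in> I \<longrightarrow> (X has_vector_derivative X' x) (at x)"
  shows "AE x in lebesgue. x \<in> I \<longrightarrow> (\<exists>c. (slope (X x) (X' x) \<longlongrightarrow> c) (at 0) \<and>
     ((\<lambda>y. N (X y)) has_vector_derivative c) (at x))"
proof -
  let ?f = "\<lambda>y. N (X y)"
  let ?E = "{x. \<exists>l r. (?f has_vector_derivative l) (at_left x) \<and>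
    (?f has_vector_derivative r) (at_right x) \<and> l \<noteq> r}"
  have "negligible ?E"
    using countable_imp_null_set_lborel[OF countable_one_sided_derivatives_differ]
    by (simp add: negligible_iff_null_sets null_sets_completionI)
  then have "AE x in lebesgue. x \<notin> ?E"
    unfolding eventually_ae_filter_negligible by blast
  with X show ?thesis
  proof (eventually_elim, intro impI)
    fix x assume "x \<in> I \<longrightarrow> (X has_vector_derivative X' x) (at x)" "x \<in> I" and E: "x \<notin> ?E"
    then have d: "(X has_vector_derivative X' x) (at x)" by blast
    have fr: "filterlim (\<lambda>y. y - x) (at_right 0) (at_right x)"
      unfolding filterlim_at by (auto intro!: tendsto_eq_intros simp: eventually_at_filter)
    have fl: "filterlim (\<lambda>y. y - x) (at_left 0) (at_left x)"
      unfolding filterlim_at by (auto intro!: tendsto_eq_intros simp: eventually_at_filter)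
    obtain r where "(slope (X x) (X' x) \<longlongrightarrow> r) (at_right 0)" using slope_tendsto_right by blast
    from filterlim_compose[OF this fr] have r: "(?f has_vector_derivative r) (at_right x)"
      unfolding has_vector_derivative_iff_quotient by (subst curve_slope[OF d]) (simp_all add: at_le)
    obtain l where "(slope (X x) (X' x) \<longlongrightarrow> l) (at_left 0)" using slope_tendsto_left by blast
    from filterlim_compose[OF this fl] have l: "(?f has_vector_derivative l) (at_left x)"
      unfolding has_vector_derivative_iff_quotient by (subst curve_slope[OF d]) (simp_all add: at_le)
    have "l = r" using E l r by blast
    with l r have c: "(?f has_vector_derivative r) (at x)"
      unfolding has_vector_derivative_iff_quotient by (simp add: filterlim_at_split)
    then have "((\<lambda>y. slope (X x) (X' x) (y - x)) \<longlongrightarrow> r) (at x)"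
      unfolding has_vector_derivative_iff_quotient by (subst (asm) curve_slope[OF d]) simp_all
    moreover have "filterlim (\<lambda>h. x + h) (at x) (at 0)"
      unfolding filterlim_at by (auto intro!: tendsto_eq_intros simp: eventually_at_filter)
    ultimately have "(slope (X x) (X' x) \<longlongrightarrow> r) (at 0)"
      using filterlim_compose[of "\<lambda>y. slope (X x) (X' x) (y - x)" "nhds r" "at x" "\<lambda>h. x + h" "at 0"] by simp
    with c show "\<exists>c. (slope (X x) (X' x) \<longlongrightarrow> c) (at 0) \<and> (?f has_vector_derivative c) (at x)" by blast
  qed
qed

end

section \<open>The operator norm and matrix inversion\<close>

definition opnorm :: "complex^'d^'d \<Rightarrow> real" where
  "opnorm B = onorm ((*v) B)"

lemma bounded_linear_mv: "bounded_linear ((*v) (B :: complex^'n^'m))"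
  by (rule bounded_bilinear.bounded_linear_right[OF bounded_bilinear_matrix_vector_mult])

lemma opnorm_bound: "norm (B *v x) \<le> opnorm B * norm x"
  unfolding opnorm_def by (rule onorm[OF bounded_linear_mv])

lemma opnorm_le: "(\<And>x. norm (B *v x) \<le> c * norm x) \<Longrightarrow> opnorm B \<le> c"
  unfolding opnorm_def by (rule onorm_le)

lemma opnorm_nonneg: "0 \<le> opnorm B"
  unfolding opnorm_def by (rule onorm_pos_le[OF bounded_linear_mv])

lemma opnorm_dominated_seminorm:
  obtains C where "0 < C" "dominated_seminorm (opnorm :: complex^'d^'d \<Rightarrow> real) C"
proof -
  obtain C where C: "0 < C" "\<And>(B :: complex^'d^'d) x. norm (B *v x) \<le> norm B * norm x * C"
    using bounded_bilinear.pos_bounded[OF bounded_bilinear_matrix_vector_mult] by blast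
  have "dominated_seminorm (opnorm :: complex^'d^'d \<Rightarrow> real) C"
  proof
    fix A B :: "complex^'d^'d" and r :: real
    show "opnorm (A + B) \<le> opnorm A + opnorm B"
      using onorm_triangle[OF bounded_linear_mv[of A] bounded_linear_mv[of B]]
      by (simp add: opnorm_def matrix_vector_mult_add_rdistrib[abs_def])
    show "opnorm (r *\<^sub>R A) = \<bar>r\<bar> * opnorm A"
    proof -
      have "(*v) (r *\<^sub>R A) = (\<lambda>x. r *\<^sub>R (A *v x))"
        by (rule ext) (rule bounded_bilinear.scaleR_left[OF bounded_bilinear_matrix_vector_mult])
      then show ?thesis
        using onorm_scaleR[OF bounded_linear_mv[of A], of r] by (simp add: opnorm_def)
    qed
    show "opnorm A \<le> C * norm A"
      by (rule opnorm_le) (use C(2)[of A] in \<open>simp add: mult_ac\<close>)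
  qed
  with C(1) show ?thesis by (rule that)
qed

lemma opnorm_mult: "opnorm (A ** B) \<le> opnorm A * opnorm B"
  using onorm_compose[OF bounded_linear_mv[of A] bounded_linear_mv[of B]]
  by (simp add: opnorm_def comp_def matrix_vector_mul_assoc)

text \<open>Each entry of \<open>B\<close> is a coordinate of the image of a unit vector. The
  estimate converts bounds on products, natural for the operator norm, into convergence in the
  Frobenius norm.\<close>

lemma norm_le_opnorm: "norm (B :: complex^'d^'d) \<le> (real CARD('d))\<^sup>2 * opnorm B"
proof -
  have "norm B \<le> (\<Sum>i\<in>UNIV. norm (B $ i))"
    unfolding norm_vec_def[of B] by (rule L2_set_le_sum) simp
  also have "\<dots> \<le> (\<Sum>i\<in>UNIV. \<Sum>j\<in>UNIV. norm (B $ i $ j))"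
  proof (rule sum_mono)
    show "norm (B $ i) \<le> (\<Sum>j\<in>UNIV. norm (B $ i $ j))" for i
      unfolding norm_vec_def[of "B $ i"] by (rule L2_set_le_sum) simp
  qed
  also have "\<dots> \<le> (\<Sum>i\<in>(UNIV::'d set). \<Sum>j\<in>(UNIV::'d set). opnorm B)"
  proof (intro sum_mono)
    fix i j
    have "B $ i $ j = (B *v axis j 1) $ i"
      by (simp add: matrix_vector_mult_def axis_def if_distrib cong: if_cong)
    then have "norm (B $ i $ j) \<le> norm (B *v axis j 1)"
      by (simp add: Finite_Cartesian_Product.norm_nth_le)
    also have "\<dots> \<le> opnorm B"
      using opnorm_bound[of B "axis j 1"] by (simp add: norm_axis_1)
    finally show "norm (B $ i $ j) \<le> opnorm B" .
  qed
  also have "\<dots> = (real CARD('d))\<^sup>2 * opnorm B"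
    by (simp add: power2_eq_square mult.assoc)
  finally show ?thesis .
qed

lemma matrix_inv_bounded_below:
  fixes B :: "complex^'d^'d"
  assumes "0 < c" "\<And>v. c * norm v \<le> norm (B *v v)"
  shows "invertible B" "opnorm (matrix_inv B) \<le> 1 / c"
proof -
  have "x = 0" if "B *v x = 0" for x
    using assms(2)[of x] assms(1) that by (simp add: mult_le_0_iff)
  then show inv: "invertible B"
    by (simp add: invertible_left_inverse matrix_left_invertible_ker)
  show "opnorm (matrix_inv B) \<le> 1 / c"
  proof (rule opnorm_le)
    fix v show "norm (matrix_inv B *v v) \<le> 1 / c * norm v"
      using assms(2)[of "matrix_inv B *v v"] assms(1) matrix_inv_mult(4)[OF inv, of v]
      by (simp add: field_simps)
  qed
qed

text \<open>The resolvent identity, from which continuity of inversion, its derivative along a curve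
  and the Lipschitz bound are all read off.\<close>

lemma matrix_inv_diff:
  fixes A B :: "complex^'d^'d"
  assumes "invertible A" "invertible B"
  shows "matrix_inv A - matrix_inv B = - (matrix_inv A ** (A - B) ** matrix_inv B)"
proof -
  have "matrix_inv A ** (A - B) ** matrix_inv B = (matrix_inv A ** A - matrix_inv A ** B) ** matrix_inv B"
    by (simp add: bounded_bilinear.diff_right[OF bounded_bilinear_matrix_matrix_mult])
  also have "\<dots> = mat 1 ** matrix_inv B - matrix_inv A ** (B ** matrix_inv B)"
    by (simp add: bounded_bilinear.diff_left[OF bounded_bilinear_matrix_matrix_mult]
        matrix_inv_mult(1)[OF assms(1)] matrix_mul_assoc)
  also have "\<dots> = matrix_inv B - matrix_inv A"
    by (simp add: matrix_inv_mult(2)[OF assms(2)])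
  finally show ?thesis by simp
qed

text \<open>The set on which inversion and the condition number are Lipschitz. It need not be
  convex, as it may contain a matrix and its negative but never 0; the bounds are therefore derived
  from algebraic identities and not from a mean value estimate.\<close>

definition bounded_invertibles :: "real \<Rightarrow> (complex^'d^'d) set" where
  "bounded_invertibles R = {B. invertible B \<and> opnorm B \<le> R \<and> opnorm (matrix_inv B) \<le> R}"

lemma tendsto_matrix_inv:
  fixes f :: "'a \<Rightarrow> complex^'d^'d"
  assumes f: "(f \<longlongrightarrow> B) F" and K: "\<forall>\<^sub>F x in F. f x \<in> bounded_invertibles R" and B: "B \<in> bounded_invertibles R"
  shows "((\<lambda>x. matrix_inv (f x)) \<longlongrightarrow> matrix_inv B) F"
proof -
  obtain C where C: "0 < C" "dominated_seminorm (opnorm :: complex^'d^'d \<Rightarrow> real) C"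
    by (rule opnorm_dominated_seminorm)
  interpret dominated_seminorm "opnorm :: complex^'d^'d \<Rightarrow> real" C by (rule C(2))
  \<comment> \<open>A factor \<open>R\<close> for each inverse in the resolvent identity,
    \<open>C\<close> for passing to the operator norm, and the squared dimension for returning to
    the Frobenius norm.\<close>
  let ?M = "(real CARD('d))\<^sup>2 * (R * C * R)"
  have le: "norm (matrix_inv (f x) - matrix_inv B) \<le> ?M * norm (f x - B)"
    if x: "f x \<in> bounded_invertibles R" for x
  proof -
    have i: "invertible (f x)" "invertible B" "opnorm (matrix_inv (f x)) \<le> R" "opnorm (matrix_inv B) \<le> R"
      using x B by (auto simp: bounded_invertibles_def)
    have R: "0 \<le> R" using i(4) opnorm_nonneg order_trans by blast
    have "opnorm (matrix_inv (f x) - matrix_inv B) = opnorm (matrix_inv (f x) ** (f x - B) ** matrix_inv B)"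
      unfolding matrix_inv_diff[OF i(1,2)] using scale[of "-1"] by simp
    also have "\<dots> \<le> opnorm (matrix_inv (f x)) * opnorm (f x - B) * opnorm (matrix_inv B)"
      by (rule order_trans[OF opnorm_mult]) (intro mult_right_mono opnorm_mult opnorm_nonneg)
    also have "\<dots> \<le> R * (C * norm (f x - B)) * R"
      using R C(1) by (intro mult_mono i le_norm opnorm_nonneg mult_nonneg_nonneg) auto
    finally have "opnorm (matrix_inv (f x) - matrix_inv B) \<le> R * (C * norm (f x - B)) * R" .
    then have "(real CARD('d))\<^sup>2 * opnorm (matrix_inv (f x) - matrix_inv B) \<le> (real CARD('d))\<^sup>2 * (R * (C * norm (f x - B)) * R)"
      by (intro mult_left_mono) simp_all
    with norm_le_opnorm have "norm (matrix_inv (f x) - matrix_inv B)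
        \<le> (real CARD('d))\<^sup>2 * (R * (C * norm (f x - B)) * R)"
      by (rule order_trans)
    then show ?thesis by (simp add: mult_ac)
  qed
  have "((\<lambda>x. ?M * norm (f x - B)) \<longlongrightarrow> ?M * 0) F"
    by (intro tendsto_mult tendsto_const tendsto_norm_zero) (simp add: LIM_zero f)
  then have lim: "((\<lambda>x. ?M * norm (f x - B)) \<longlongrightarrow> 0) F" by simp
  have "((\<lambda>x. matrix_inv (f x) - matrix_inv B) \<longlongrightarrow> 0) F"
    by (rule Lim_null_comparison[OF _ lim]) (use K le in \<open>auto elim: eventually_mono\<close>)
  then show ?thesis by (rule LIM_zero_cancel)
qed

text \<open>Divided by \<open>y - x\<close>, the resolvent identity expresses the quotient of the
  inverse curve as a product whose factors converge, the left one by continuity of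
  inversion.\<close>

lemma has_vector_derivative_matrix_inv:
  fixes A :: "real \<Rightarrow> complex^'d^'d"
  assumes A: "(A has_vector_derivative A') (at x)" and S: "open S" "x \<in> S"
    and K: "\<And>y. y \<in> S \<Longrightarrow> A y \<in> bounded_invertibles R"
  shows "((\<lambda>y. matrix_inv (A y)) has_vector_derivative - (matrix_inv (A x) ** A' ** matrix_inv (A x))) (at x)"
proof -
  have ev: "\<forall>\<^sub>F y in at x. y \<in> S" by (rule eventually_at_in_open'[OF S])
  have "(A \<longlongrightarrow> A x) (at x)"
    using has_vector_derivative_continuous[OF A] by (simp add: isCont_def)
  then have inv: "((\<lambda>y. matrix_inv (A y)) \<longlongrightarrow> matrix_inv (A x)) (at x)"
    by (rule tendsto_matrix_inv) (use ev K S in \<open>auto elim: eventually_mono\<close>)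
  have quot: "((\<lambda>y. (A y - A x) /\<^sub>R (y - x)) \<longlongrightarrow> A') (at x)"
    using A by (simp add: has_vector_derivative_iff_quotient)
  note tm = bounded_bilinear.tendsto[OF bounded_bilinear_matrix_matrix_mult]
  have "((\<lambda>y. - (matrix_inv (A y) ** ((A y - A x) /\<^sub>R (y - x)) ** matrix_inv (A x))) \<longlongrightarrow>
      - (matrix_inv (A x) ** A' ** matrix_inv (A x))) (at x)"
    by (intro tendsto_minus tm inv quot tendsto_const)
  moreover have "\<forall>\<^sub>F y in at x. - (matrix_inv (A y) ** ((A y - A x) /\<^sub>R (y - x)) ** matrix_inv (A x))
      = (matrix_inv (A y) - matrix_inv (A x)) /\<^sub>R (y - x)"
    using ev
  proof eventually_elim
    case (elim y)
    have "matrix_inv (A y) - matrix_inv (A x) = - (matrix_inv (A y) ** (A y - A x) ** matrix_inv (A x))"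
      using K[OF elim] K[OF S(2)] by (intro matrix_inv_diff) (auto simp: bounded_invertibles_def)
    then show ?case
      by (simp add: bounded_bilinear.scaleR_right[OF bounded_bilinear_matrix_matrix_mult]
          bounded_bilinear.scaleR_left[OF bounded_bilinear_matrix_matrix_mult])
  qed
  ultimately show ?thesis
    unfolding has_vector_derivative_iff_quotient by (rule Lim_transform_eventually)
qed

lemma cond_number_eq_opnorm:
  "invertible B \<Longrightarrow> cond_number B = opnorm B * opnorm (matrix_inv B)"
  by (simp add: cond_number_eq opnorm_def)

lemma cond_number_lipschitz:
  obtains L where "0 \<le> L" "\<And>A B :: complex^'d^'d. A \<in> bounded_invertibles R \<Longrightarrow> B \<in> bounded_invertibles R \<Longrightarrow>
    \<bar>cond_number A - cond_number B\<bar> \<le> L * norm (A - B)"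
proof -
  obtain C where C: "0 < C" "dominated_seminorm (opnorm :: complex^'d^'d \<Rightarrow> real) C"
    by (rule opnorm_dominated_seminorm)
  interpret dominated_seminorm "opnorm :: complex^'d^'d \<Rightarrow> real" C by (rule C(2))
  \<comment> \<open>The absolute value secures \<open>0 \<le> L\<close> also for negative
    \<open>R\<close>, when \<open>bounded_invertibles R\<close> is empty.\<close>
  define L where "L = \<bar>C * R + R * (R * C * R)\<bar>"
  have "\<bar>cond_number A - cond_number B\<bar> \<le> L * norm (A - B)"
    if "A \<in> bounded_invertibles R" "B \<in> bounded_invertibles R" for A B :: "complex^'d^'d"
  proof -
    let ?A = "matrix_inv A" and ?B = "matrix_inv B"
    have i: "invertible A" "invertible B" "opnorm A \<le> R" "opnorm B \<le> R" "opnorm ?A \<le> R" "opnorm ?B \<le> R"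
      using that by (auto simp: bounded_invertibles_def)
    have R: "0 \<le> R" using i(3) opnorm_nonneg order_trans by blast
    have "opnorm (?A - ?B) = opnorm (?A ** (A - B) ** ?B)"
      unfolding matrix_inv_diff[OF i(1,2)] using scale[of "-1"] by simp
    also have "\<dots> \<le> opnorm ?A * opnorm (A - B) * opnorm ?B"
      by (rule order_trans[OF opnorm_mult]) (intro mult_right_mono opnorm_mult opnorm_nonneg)
    also have "\<dots> \<le> R * (C * norm (A - B)) * R"
      using R C(1) by (intro mult_mono i le_norm opnorm_nonneg mult_nonneg_nonneg) auto
    finally have inv: "\<bar>opnorm ?A - opnorm ?B\<bar> \<le> R * (C * norm (A - B)) * R"
      using diff_le order_trans by blast
    have "cond_number A - cond_number B = (opnorm A - opnorm B) * opnorm ?A + opnorm B * (opnorm ?A - opnorm ?B)"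
      by (simp add: cond_number_eq_opnorm i algebra_simps)
    also have "\<bar>\<dots>\<bar> \<le> \<bar>opnorm A - opnorm B\<bar> * opnorm ?A + opnorm B * \<bar>opnorm ?A - opnorm ?B\<bar>"
      by (rule order_trans[OF abs_triangle_ineq]) (simp add: abs_mult opnorm_nonneg)
    also have "\<dots> \<le> (C * norm (A - B)) * R + R * (R * (C * norm (A - B)) * R)"
      using R C(1) by (intro add_mono mult_mono i inv lipschitz opnorm_nonneg mult_nonneg_nonneg) auto
    also have "\<dots> = (C * R + R * (R * C * R)) * norm (A - B)" by (simp add: algebra_simps)
    also have "\<dots> \<le> L * norm (A - B)"
      unfolding L_def by (intro mult_right_mono abs_ge_self) simp
    finally show ?thesis .
  qed
  moreover have "0 \<le> L" by (simp add: L_def)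
  ultimately show ?thesis using that by blast
qed

section \<open>Continuity of the condition number\<close>

text \<open>A relation, since the two-sided directional derivatives of the norm need not exist.\<close>

definition cond_derivative :: "complex^'d^'d \<Rightarrow> complex^'d^'d \<Rightarrow> real \<Rightarrow> bool" where
  "cond_derivative Y V c \<longleftrightarrow> (\<exists>c1 c2.
     (dominated_seminorm.slope opnorm Y V \<longlongrightarrow> c1) (at 0) \<and>
     (dominated_seminorm.slope opnorm (matrix_inv Y) (- (matrix_inv Y ** V ** matrix_inv Y)) \<longlongrightarrow> c2) (at 0) \<and>
     c = c1 * opnorm (matrix_inv Y) + opnorm Y * c2)"

text \<open>Stability of directional derivatives is applied twice: at \<open>Y n\<close>, and at its
  inverse in the direction in which the inverse moves. Both the inverses and these directions
  converge by continuity of inversion on \<open>bounded_invertibles R\<close>.\<close>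

lemma cond_derivative_closed:
  assumes Y: "\<And>n. Y n \<in> bounded_invertibles R" "Y0 \<in> bounded_invertibles R" "Y \<longlonglongrightarrow> Y0"
    and V: "V \<longlonglongrightarrow> V0"
    and c: "\<And>n. cond_derivative (Y n) (V n) (c n)" "cond_derivative Y0 V0 c0"
  shows "c \<longlonglongrightarrow> c0"
proof -
  obtain C where C: "dominated_seminorm (opnorm :: complex^'a^'a \<Rightarrow> real) C"
    by (rule opnorm_dominated_seminorm)
  interpret dominated_seminorm "opnorm :: complex^'a^'a \<Rightarrow> real" C by (rule C)
  obtain c1 c2 where cn: "\<And>n. (slope (Y n) (V n) \<longlongrightarrow> c1 n) (at 0)"
    "\<And>n. (slope (matrix_inv (Y n)) (- (matrix_inv (Y n) ** V n ** matrix_inv (Y n))) \<longlongrightarrow> c2 n) (at 0)"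
    "\<And>n. c n = c1 n * opnorm (matrix_inv (Y n)) + opnorm (Y n) * c2 n"
    using c(1) unfolding cond_derivative_def by metis
  obtain d1 d2 where d: "(slope Y0 V0 \<longlongrightarrow> d1) (at 0)"
    "(slope (matrix_inv Y0) (- (matrix_inv Y0 ** V0 ** matrix_inv Y0)) \<longlongrightarrow> d2) (at 0)"
    "c0 = d1 * opnorm (matrix_inv Y0) + opnorm Y0 * d2"
    using c(2) unfolding cond_derivative_def by blast
  have inv: "(\<lambda>n. matrix_inv (Y n)) \<longlonglongrightarrow> matrix_inv Y0"
    by (rule tendsto_matrix_inv[OF Y(3) always_eventually Y(2)]) (simp add: Y(1))
  note tm = bounded_bilinear.tendsto[OF bounded_bilinear_matrix_matrix_mult]
  have "c1 \<longlonglongrightarrow> d1"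
    by (rule directional_derivative_closed[OF Y(3) V cn(1) d(1)])
  moreover have "c2 \<longlonglongrightarrow> d2"
    by (rule directional_derivative_closed[OF inv _ cn(2) d(2)]) (intro tendsto_minus tm inv V)
  ultimately have "(\<lambda>n. c1 n * opnorm (matrix_inv (Y n)) + opnorm (Y n) * c2 n)
      \<longlonglongrightarrow> d1 * opnorm (matrix_inv Y0) + opnorm Y0 * d2"
    by (intro tendsto_add tendsto_mult tendsto_seminorm inv Y(3))
  then show ?thesis by (simp flip: cn(3) d(3))
qed

text \<open>Wherever \<open>A\<close> is differentiable so is its inverse, and the convexity result
  applies to both curves; outside the union of the two exceptional sets the product rule gives the
  derivative.\<close>

lemma cond_number_AE_derivative:
  fixes A :: "real \<Rightarrow> complex^'d^'d"
  assumes A: "AE x in lebesgue. x \<in> {a<..<b} \<longrightarrow> (A has_vector_derivative A' x) (at x)"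
    and K: "\<And>x. x \<in> {a<..<b} \<Longrightarrow> A x \<in> bounded_invertibles R"
  shows "AE x in lebesgue. x \<in> {a<..<b} \<longrightarrow>
    (\<exists>c. cond_derivative (A x) (A' x) c \<and> ((\<lambda>y. cond_number (A y)) has_vector_derivative c) (at x))"
proof -
  obtain C where C: "dominated_seminorm (opnorm :: complex^'d^'d \<Rightarrow> real) C"
    by (rule opnorm_dominated_seminorm)
  interpret dominated_seminorm "opnorm :: complex^'d^'d \<Rightarrow> real" C by (rule C)
  have "AE x in lebesgue. x \<in> {a<..<b} \<longrightarrow>
     ((\<lambda>y. matrix_inv (A y)) has_vector_derivative - (matrix_inv (A x) ** A' x ** matrix_inv (A x))) (at x)"
    using A
  proof (eventually_elim, intro impI)
    fix x assume "x \<in> {a<..<b} \<longrightarrow> (A has_vector_derivative A' x) (at x)" and x: "x \<in> {a<..<b}"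
    then have "(A has_vector_derivative A' x) (at x)" by blast
    then show "((\<lambda>y. matrix_inv (A y)) has_vector_derivative - (matrix_inv (A x) ** A' x ** matrix_inv (A x))) (at x)"
      by (rule has_vector_derivative_matrix_inv[OF _ open_greaterThanLessThan x K])
  qed
  from curve_AE_directional_derivative[OF A] curve_AE_directional_derivative[OF this]
  show ?thesis
  proof (eventually_elim, intro impI)
    fix x assume x: "x \<in> {a<..<b}"
      and "x \<in> {a<..<b} \<longrightarrow> (\<exists>c. (slope (A x) (A' x) \<longlongrightarrow> c) (at 0) \<and>
         ((\<lambda>y. opnorm (A y)) has_vector_derivative c) (at x))"
      and "x \<in> {a<..<b} \<longrightarrow> (\<exists>c. (slope (matrix_inv (A x)) (- (matrix_inv (A x) ** A' x ** matrix_inv (A x))) \<longlongrightarrow> c) (at 0) \<and>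
         ((\<lambda>y. opnorm (matrix_inv (A y))) has_vector_derivative c) (at x))"
    then obtain c1 c2 where
      c1: "(slope (A x) (A' x) \<longlongrightarrow> c1) (at 0)" "((\<lambda>y. opnorm (A y)) has_vector_derivative c1) (at x)" and
      c2: "(slope (matrix_inv (A x)) (- (matrix_inv (A x) ** A' x ** matrix_inv (A x))) \<longlongrightarrow> c2) (at 0)"
        "((\<lambda>y. opnorm (matrix_inv (A y))) has_vector_derivative c2) (at x)"
      by blast
    let ?c = "c1 * opnorm (matrix_inv (A x)) + opnorm (A x) * c2"
    have "cond_derivative (A x) (A' x) ?c"
      unfolding cond_derivative_def using c1(1) c2(1) by blast
    moreover have "((\<lambda>y. cond_number (A y)) has_vector_derivative ?c) (at x)"
    proof (rule has_vector_derivative_transform_within_open[OF _ open_greaterThanLessThan x])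
      show "((\<lambda>y. opnorm (A y) * opnorm (matrix_inv (A y))) has_vector_derivative ?c) (at x)"
        using has_vector_derivative_mult[OF c1(2) c2(2)] by (simp add: add.commute)
      fix y assume "y \<in> {a<..<b}"
      from K[OF this] show "opnorm (A y) * opnorm (matrix_inv (A y)) = cond_number (A y)"
        by (simp add: cond_number_eq_opnorm bounded_invertibles_def)
    qed
    ultimately show "\<exists>c. cond_derivative (A x) (A' x) c \<and> ((\<lambda>y. cond_number (A y)) has_vector_derivative c) (at x)"
      by blast
  qed
qed

theorem theorem1p19:
  fixes A0 :: "real \<Rightarrow> complex^'d^'d" and q a b :: real and I :: "real set"
  assumes "1 \<le> q"
    and "a < b" and "I = {a<..<b}"
    and "A0 \<in> sobolev_space q I"
    and "(INF x\<in>I. sing_val CARD('d) (A0 x)) > 0"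
  shows "\<exists>U. sobolev_neighborhood q I A0 U \<and>
           (\<forall>A\<in>U. (\<forall>x\<in>I. invertible (A x)) \<and>
                   (\<lambda>x. cond_number (A x)) \<in> sobolev_space q I) \<and>
           sobolev_continuous_on q I U (\<lambda>A x. cond_number (A x))"
proof -
  note q = \<open>1 \<le> q\<close> \<open>a < b\<close>
  note I = \<open>I = {a<..<b}\<close>
  obtain C where C: "0 < C" "dominated_seminorm (opnorm :: complex^'d^'d \<Rightarrow> real) C"
    by (rule opnorm_dominated_seminorm)
  interpret dominated_seminorm "opnorm :: complex^'d^'d \<Rightarrow> real" C by (rule C(2))
  define m where "m = (INF x\<in>I. sing_val CARD('d) (A0 x))"
  have m: "0 < m" using assms(5) by (simp add: m_def)
  \<comment> \<open>Provides the lower bound without which the real infimum would not be known to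
    lie below the values.\<close>
  have sing_nonneg: "0 \<le> sing_val CARD('d) B" for B :: "complex^'d^'d"
    using sing_val_last_attained[of B] norm_ge_zero by metis
  have m_le: "m \<le> sing_val CARD('d) (A0 x)" if "x \<in> I" for x
    unfolding m_def using that sing_nonneg by (intro cINF_lower bdd_belowI2[of _ 0])
  obtain A0' where A0': "sobolev_pair q I A0 A0'"
    using assms(4) sobolev_space_iff[OF q, of A0] by (auto simp: I)
  obtain R0 where R0: "\<And>x. x \<in> I \<Longrightarrow> norm (A0 x) \<le> R0"
    using sobolev_pair_bounded[OF q A0'[unfolded I]] unfolding I by blast
  \<comment> \<open>For a perturbation of operator norm at most \<open>m / 2\<close>: the first
    entry bounds the norm of \<open>A x\<close>. The second bounds that of the inverse, because half
    of the lower bound \<open>m\<close> on the stretching survives.\<close>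
  define R where "R = max (C * R0 + m / 2) (2 / m)"
  define \<epsilon> where "\<epsilon> = m / (2 * C)"
  have \<epsilon>: "0 < \<epsilon>" "C * \<epsilon> = m / 2" using m C(1) by (simp_all add: \<epsilon>_def)
  \<comment> \<open>A neighbourhood in the supremum norm. It contains a Sobolev ball by
    \<open>sobolev_pair_sup_small\<close>, and it places the values of all its members in one set
    \<open>bounded_invertibles R\<close>.\<close>
  define U where "U = {A \<in> sobolev_space q I. \<forall>x\<in>I. norm (A x - A0 x) < \<epsilon>}"
  have K: "A x \<in> bounded_invertibles R" if "A \<in> U" "x \<in> I" for A x
  proof -
    have d: "opnorm (A x - A0 x) \<le> m / 2"
    proof -
      have "norm (A x - A0 x) \<le> \<epsilon>" using that by (auto simp: U_def)
      then have "C * norm (A x - A0 x) \<le> C * \<epsilon>" using C(1) by simp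
      with le_norm[of "A x - A0 x"] show ?thesis by (simp add: \<epsilon>(2))
    qed
    have below: "m / 2 * norm v \<le> norm (A x *v v)" for v
    proof -
      have "m * norm v \<le> sing_val CARD('d) (A0 x) * norm v"
        using m_le[OF that(2)] by (rule mult_right_mono) simp
      also have "\<dots> \<le> norm (A0 x *v v)" by (rule sing_val_last_le)
      also have "A0 x *v v = A x *v v - (A x - A0 x) *v v"
        by (simp add: matrix_vector_mult_diff_rdistrib)
      also have "norm \<dots> \<le> norm (A x *v v) + norm ((A x - A0 x) *v v)"
        by (rule norm_triangle_ineq4)
      also have "norm ((A x - A0 x) *v v) \<le> opnorm (A x - A0 x) * norm v"
        by (rule opnorm_bound)
      also have "\<dots> \<le> m / 2 * norm v"
        using d by (rule mult_right_mono) simp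
      finally show ?thesis by simp
    qed
    have "opnorm (A x) \<le> opnorm (A0 x) + opnorm (A x - A0 x)"
      using triangle[of "A0 x" "A x - A0 x"] by simp
    also have "\<dots> \<le> C * R0 + m / 2"
    proof (rule add_mono[OF _ d])
      have "C * norm (A0 x) \<le> C * R0" using R0[OF that(2)] C(1) by simp
      with le_norm[of "A0 x"] show "opnorm (A0 x) \<le> C * R0" by simp
    qed
    finally have "opnorm (A x) \<le> R" by (simp add: R_def)
    moreover have "invertible (A x)" "opnorm (matrix_inv (A x)) \<le> 1 / (m / 2)"
      using matrix_inv_bounded_below[of "m / 2" "A x"] m below by simp_all
    ultimately show ?thesis by (simp add: bounded_invertibles_def R_def)
  qed
  obtain L where L: "0 \<le> L" "\<And>A B :: complex^'d^'d. A \<in> bounded_invertibles R \<Longrightarrow> B \<in> bounded_invertibles R \<Longrightarrow>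
    \<bar>cond_number A - cond_number B\<bar> \<le> L * norm (A - B)"
    by (rule cond_number_lipschitz[of R]) blast
  have main: "(\<forall>A\<in>U. (\<lambda>x. cond_number (A x)) \<in> sobolev_space q {a<..<b}) \<and>
      sobolev_continuous_on q {a<..<b} U (\<lambda>A x. cond_number (A x))"
  proof (rule sobolev_continuous_composition[OF q, where K = "bounded_invertibles R" and D = cond_derivative])
    show "U \<subseteq> sobolev_space q {a<..<b}" by (auto simp: U_def I)
    show "A x \<in> bounded_invertibles R" if "A \<in> U" "x \<in> {a<..<b}" for A x
      using K that by (simp add: I)
    show "0 \<le> L" by (rule L)
    show "\<bar>cond_number A - cond_number B\<bar> \<le> L * norm (A - B)"
      if "A \<in> bounded_invertibles R" "B \<in> bounded_invertibles R" for A B :: "complex^'d^'d"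
      using that by (rule L(2))
    show "AE x in lebesgue. x \<in> {a<..<b} \<longrightarrow>
        (\<exists>c. cond_derivative (A x) (A' x) c \<and> ((\<lambda>y. cond_number (A y)) has_vector_derivative c) (at x))"
      if "A \<in> U" "sobolev_pair q {a<..<b} A A'" for A A'
      using K[OF that(1)] by (intro cond_number_AE_derivative[OF sobolev_pairD(4)[OF that(2)]]) (simp add: I)
    show "c \<longlonglongrightarrow> c0"
      if "\<And>n. x n \<in> bounded_invertibles R" "x0 \<in> bounded_invertibles R" "x \<longlonglongrightarrow> x0" "v \<longlonglongrightarrow> v0"
        "\<And>n. cond_derivative (x n) (v n) (c n)" "cond_derivative x0 v0 c0"
      for x0 v0 :: "complex^'d^'d" and c0 x v c
      using that by (rule cond_derivative_closed)
  qed
  obtain \<delta> where \<delta>: "0 < \<delta>"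
    "\<And>(f :: real \<Rightarrow> complex^'d^'d) f' x. sobolev_pair q {a<..<b} f f' \<Longrightarrow>
       Lq_mass q {a<..<b} f < \<delta> \<Longrightarrow> Lq_mass q {a<..<b} f' < \<delta> \<Longrightarrow> x \<in> {a<..<b} \<Longrightarrow> norm (f x) < \<epsilon>"
    by (rule sobolev_pair_sup_small[OF q \<epsilon>(1)]) blast
  have "sobolev_neighborhood q I A0 U"
    unfolding sobolev_neighborhood_def
  proof (intro conjI exI[of _ "\<delta> powr (1 / q)"] ballI impI)
    show "A0 \<in> sobolev_space q I" by (rule assms(4))
    show "U \<subseteq> sobolev_space q I" by (auto simp: U_def)
    show "0 < \<delta> powr (1 / q)" using \<delta>(1) by simp
    fix A assume A: "A \<in> sobolev_space q I" and near: "sobolev_dist q I A A0 < \<delta> powr (1 / q)"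
    obtain A' where A': "sobolev_pair q I A A'"
      using A sobolev_space_iff[OF q, of A] by (auto simp: I)
    have "sobolev_pair q {a<..<b} (\<lambda>x. A x - A0 x) (\<lambda>x. A' x - A0' x)"
      using q A' A0' unfolding I by (intro sobolev_pair_diff) auto
    note pair = this sobolev_norm_less_imp_mass_less[OF q this \<delta>(1) near[unfolded sobolev_dist_def I]]
    show "A \<in> U"
      using A \<delta>(2)[OF pair] by (simp add: U_def I)
  qed
  moreover have "invertible (A x)" if "A \<in> U" "x \<in> I" for A x
    using K[OF that] by (simp add: bounded_invertibles_def)
  ultimately show ?thesis using main unfolding I by blast
qed

end
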